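(* Let $n$ be a positive integer and, with the conventions $x_{ii}=0$, $x_{ij}=-x_{ji}$, consider the generic $(2n+1)\times(2n+1)$ skew-symmetric matrix of indeterminates $(x_{ij})$. Let $I$ denote the ideal in the polynomial ring $S=\mathbb{C}[x_{ij}: 1\le i<j\le 2n+1]$ generated by the $2n\times 2n$ Pfaffians of $(x_{ij})$ (the Pfaffians of the principal $2n\times 2n$ skew-symmetric submatrices). The $b$-function (Bernstein--Sato polynomial) of $I$ is given by \[b_I(s)=\prod_{i=0}^{n-1}(s+2i+3).\]
   Context: Definition of the $b$-function of an ideal. Let $S=\mathbb{C}[x_1,\dots,x_N]$ be a polynomial ring and $\mathcal{D}=\mathcal{D}_X=S[\partial_1,\dots,\partial_N]$, $\partial_i=\partial/\partial x_i$, the Weyl algebra of differential operators on $X=\mathbb{A}^N$ (here the $x_i$ are the indeterminates $x_{ij}$, $i<j$). Let $f=(f_1,\dots,f_r)$ be a tuple of non-zero polynomials in $S$, and let $\underline{s}=(s_1,\dots,s_r)$ be independent commuting variables, one for each $f_i$. Let \[B^f_{\underline s}=S_{f_1\cdots f_r}[s_1,\dots,s_r]\cdot f^{\underline s},\] where $S_{f_1\cdots f_r}$ is the localization of $S$ at the product $f_1\cdots f_r$ and $f^{\underline s}$ stands for the formal product $f_1^{s_1}\cdots f_r^{s_r}$. It is a free rank one $S_{f_1\cdots f_r}[s_1,\dots,s_r]$-module with generator $f^{\underline s}$, and a $\mathcal{D}_X[s_1,\dots,s_r]$-module via the Leibniz rule and $\partial_i\cdot f^{\underline s}=\sum_{j=1}^r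 \frac{s_j\,(\partial f_j/\partial x_i)}{f_j}\cdot f^{\underline s}$. For $\hat c=(c_1,\dots,c_r)\in\mathbb{Z}^r$ write $|\hat c|=c_1+\cdots+c_r$, write $\prod_i f_i^{s_i+c_i}$ for the element $f_1^{c_1}\cdots f_r^{c_r}\cdot f^{\underline s}$, and put \[\hat c_{\underline s}=\prod_{i:\,c_i<0} s_i(s_i-1)\cdots(s_i+c_i+1).\] Put $s=s_1+\cdots+s_r$. The $b$-function $b_f(s)$ is the monic polynomial in $s$ (with complex coefficients) of lowest degree for which there exist a finite set of tuples $\hat c\in\mathbb{Z}^r$ with $|\hat c|=1$ and operators $P_{\hat c}\in\mathcal{D}_X[s_1,\dots,s_r]$ such that \[\sum_{\hat c}P_{\hat c}\cdot\hat c_{\underline s}\cdot\prod_{i=1}^r f_i^{s_i+c_i}=b_f(s)\cdot f^{\underline s}.\] It is known that $b_f(s)$ exists and depends only on the ideal $I$ generated by $f_1,\dots,f_r$; it is denoted $b_I(s)$. *)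

theory Defs
  imports
    "HOL-Computational_Algebra.Computational_Algebra"
    "HOL-Combinatorics.Permutations"
    "HOL-Library.Poly_Mapping"
    "HOL-Library.Product_Lexorder"
    "HOL-Library.FuncSet"
begin

text \<open>
  A type variable \<open>'v\<close> indexes all available indeterminates; the polynomial ring in the
  indeterminates of a set \<open>V\<close> is the subset \<open>poly_ring V\<close> of \<open>'v mpol\<close>. The linear order on
  \<open>'v\<close> is only there because the library needs it to make \<open>'v mpol\<close> an integral domain.
\<close>

type_synonym 'v mpol = "('v \<Rightarrow>\<^sub>0 nat) \<Rightarrow>\<^sub>0 complex"

definition mvar :: "'v \<Rightarrow> 'v mpol" where
  "mvar v = Poly_Mapping.single (Poly_Mapping.single v 1) 1"

definition poly_ring :: "'v set \<Rightarrow> 'v mpol set" where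
  "poly_ring V = {p. \<forall>m \<in> Poly_Mapping.keys p. Poly_Mapping.keys m \<subseteq> V}"

definition ideal_generated :: "'v set \<Rightarrow> 'v mpol set \<Rightarrow> 'v mpol set" where
  "ideal_generated V F =
     {p. \<exists>A a. finite A \<and> A \<subseteq> F \<and> a \<in> A \<rightarrow> poly_ring V \<and> p = (\<Sum>g\<in>A. a g * g)}"


section \<open>Partial derivatives\<close>

definition mpderiv :: "'v \<Rightarrow> 'v mpol \<Rightarrow> 'v mpol" where
  "mpderiv v p = (\<Sum>m \<in> Poly_Mapping.keys p.
     Poly_Mapping.single (m - Poly_Mapping.single v 1)
       (of_nat (Poly_Mapping.lookup m v) * Poly_Mapping.lookup p m))"

lemma mpderiv_add: "mpderiv v (p + q) = mpderiv v p + mpderiv v q"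
  unfolding mpderiv_def
  by (rule setsum_keys_plus_distrib) (simp_all add: distrib_left single_add)

lemma mpderiv_zero [simp]: "mpderiv v 0 = 0"
  by (simp add: mpderiv_def)

lemma mpderiv_sum: "mpderiv v (sum f A) = (\<Sum>x\<in>A. mpderiv v (f x))"
  by (induction A rule: infinite_finite_induct) (simp_all add: mpderiv_add)

lemma mpderiv_single:
  "mpderiv v (Poly_Mapping.single m c) =
     Poly_Mapping.single (m - Poly_Mapping.single v 1) (of_nat (Poly_Mapping.lookup m v) * c)"
  by (cases "c = 0") (simp_all add: mpderiv_def)

lemma mpol_sum_monomials:
  "(p :: 'v mpol) = (\<Sum>m \<in> Poly_Mapping.keys p. Poly_Mapping.single m (Poly_Mapping.lookup p m))"
proof (rule poly_mapping_eqI)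
  fix k
  have "(\<Sum>m \<in> Poly_Mapping.keys p. Poly_Mapping.lookup p m when m = k) = Poly_Mapping.lookup p k"
    by (simp add: when_def sum.delta' in_keys_iff)
  then show "Poly_Mapping.lookup p k = Poly_Mapping.lookup
    (\<Sum>m \<in> Poly_Mapping.keys p. Poly_Mapping.single m (Poly_Mapping.lookup p m)) k"
    by (simp add: lookup_sum lookup_single)
qed

lemma single_monomial_shift:
  fixes m m' :: "'v \<Rightarrow>\<^sub>0 nat" and c :: complex
  shows "Poly_Mapping.single (m - Poly_Mapping.single v 1 + m') (of_nat (Poly_Mapping.lookup m v) * c)
       = Poly_Mapping.single (m + m' - Poly_Mapping.single v 1) (of_nat (Poly_Mapping.lookup m v) * c)"
proof (cases "Poly_Mapping.lookup m v = 0")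
  case False
  have "m - Poly_Mapping.single v 1 + m' = m + m' - Poly_Mapping.single v 1"
    by (rule poly_mapping_eqI) (use False in \<open>auto simp: lookup_add lookup_minus lookup_single when_def\<close>)
  then show ?thesis by simp
qed simp

lemma mpderiv_mult_single:
  "mpderiv v (Poly_Mapping.single m c * Poly_Mapping.single m' c') =
     mpderiv v (Poly_Mapping.single m c) * Poly_Mapping.single m' c' +
     Poly_Mapping.single m c * mpderiv v (Poly_Mapping.single m' c')"
  using single_monomial_shift[of m v m' "c * c'"] single_monomial_shift[of m' v m "c * c'"]
  by (simp add: mpderiv_single mult_single lookup_add algebra_simps flip: single_add)

lemma mpderiv_mult: "mpderiv v (p * q) = mpderiv v p * q + p * mpderiv v q"
proof -
  let ?t = "\<lambda>p m. Poly_Mapping.single m (Poly_Mapping.lookup p m) :: 'a mpol"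
  let ?p = "\<Sum>m \<in> Poly_Mapping.keys p. ?t p m" and ?q = "\<Sum>m \<in> Poly_Mapping.keys q. ?t q m"
  have "mpderiv v (?p * ?q) = mpderiv v ?p * ?q + ?p * mpderiv v ?q"
    by (simp only: sum_product mpderiv_sum mpderiv_mult_single sum.distrib)
  then show ?thesis
    by (simp only: mpol_sum_monomials[symmetric])
qed

definition fderiv :: "'v::linorder \<Rightarrow> 'v mpol fract \<Rightarrow> 'v mpol fract" where
  "fderiv v q = (THE w. \<exists>a b. b \<noteq> 0 \<and> q = Fract a b \<and>
     w = Fract (mpderiv v a * b - a * mpderiv v b) (b * b))"

lemma fderiv_Fract:
  assumes "b \<noteq> 0"
  shows "fderiv v (Fract a b) = Fract (mpderiv v a * b - a * mpderiv v b) (b * b)"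
  unfolding fderiv_def
proof (rule the_equality)
  fix w
  assume "\<exists>c d. d \<noteq> 0 \<and> Fract a b = Fract c d \<and>
            w = Fract (mpderiv v c * d - c * mpderiv v d) (d * d)"
  then obtain c d where d: "d \<noteq> 0" and eq: "Fract a b = Fract c d"
    and w: "w = Fract (mpderiv v c * d - c * mpderiv v d) (d * d)" by blast
  have eq: "a * d = c * b"
    using eq assms d by (simp add: eq_fract)
  have "mpderiv v a * d + a * mpderiv v d = mpderiv v c * b + c * mpderiv v b"
    using arg_cong[OF eq, of "mpderiv v"] by (simp add: mpderiv_mult)
  then have "(mpderiv v a * b - a * mpderiv v b) * (d * d) =
             (mpderiv v c * d - c * mpderiv v d) * (b * b)"
    using eq by algebra
  then show "w = Fract (mpderiv v a * b - a * mpderiv v b) (b * b)"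
    using assms d by (simp add: w eq_fract)
qed (use assms in blast)


section \<open>The module generated by the formal power\<close>

text \<open>
  Elements of \<open>Frac(S)[s\<^sub>1, \<dots>, s\<^sub>r]\<close> are finitely supported families of fractions indexed by
  monomials in the \<open>s\<^sub>j\<close>, where \<open>s\<^sub>j\<close> has index \<open>j \<in> {1..r}\<close>. The element \<open>u \<cdot> f\<^sup>s\<close> of the
  free rank one module is represented by its coefficient \<open>u\<close>.
\<close>

type_synonym 'v spoly = "(nat \<Rightarrow>\<^sub>0 nat) \<Rightarrow>\<^sub>0 'v mpol fract"

definition scoeff :: "'v::linorder mpol fract \<Rightarrow> 'v spoly" where
  "scoeff a = Poly_Mapping.single 0 a"

definition emb :: "'v::linorder mpol \<Rightarrow> 'v spoly" where
  "emb p = scoeff (Fract p 1)"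

definition svar :: "nat \<Rightarrow> 'v::linorder spoly" where
  "svar j = Poly_Mapping.single (Poly_Mapping.single j 1) 1"

definition spoly_over :: "'v::linorder mpol fract set \<Rightarrow> nat \<Rightarrow> 'v spoly set" where
  "spoly_over R r = {u. (\<forall>m. Poly_Mapping.lookup u m \<in> R) \<and>
     (\<forall>m \<in> Poly_Mapping.keys u. Poly_Mapping.keys m \<subseteq> {1..r})}"

definition poly_fracts :: "'v::linorder set \<Rightarrow> 'v mpol fract set" where
  "poly_fracts V = {Fract a 1 | a. a \<in> poly_ring V}"

definition localization :: "'v::linorder set \<Rightarrow> 'v mpol \<Rightarrow> 'v mpol fract set" where
  "localization V h = {Fract a (h ^ k) | a k. a \<in> poly_ring V}"

text \<open>The module \<open>S\<^bsub>f\<^sub>1\<cdots>f\<^sub>r\<^esub>[s\<^sub>1, \<dots>, s\<^sub>r] \<cdot> f\<^sup>s\<close>.\<close>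

definition Bmod :: "'v::linorder set \<Rightarrow> nat \<Rightarrow> (nat \<Rightarrow> 'v mpol) \<Rightarrow> 'v spoly set" where
  "Bmod V r f = spoly_over (localization V (\<Prod>j=1..r. f j)) r"

definition Bderiv :: "nat \<Rightarrow> (nat \<Rightarrow> 'v mpol) \<Rightarrow> 'v \<Rightarrow> 'v::linorder spoly \<Rightarrow> 'v spoly" where
  "Bderiv r f v u = Poly_Mapping.map (fderiv v) u +
     u * (\<Sum>j=1..r. svar j * scoeff (Fract (mpderiv v (f j)) (f j)))"

text \<open>
  The operators by which \<open>\<D>[s\<^sub>1, \<dots>, s\<^sub>r]\<close> acts on \<open>Bmod V r f\<close>, where \<open>\<D> = S[\<partial>\<^sub>v : v \<in> V]\<close> is
  the Weyl algebra: the ring of operators on the module generated by the multiplications with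
  elements of \<open>S[s\<^sub>1, \<dots>, s\<^sub>r]\<close> and the \<open>\<partial>\<^sub>v\<close>. They are written as maps on all of
  \<open>Frac(S)[s\<^sub>1, \<dots>, s\<^sub>r] \<cdot> f\<^sup>s\<close>; lemma \<open>weyl_ops_Bmod\<close> shows that they preserve
  \<open>Bmod V r f\<close>.
\<close>

inductive_set weyl_ops ::
  "'v::linorder set \<Rightarrow> nat \<Rightarrow> (nat \<Rightarrow> 'v mpol) \<Rightarrow> ('v spoly \<Rightarrow> 'v spoly) set"
  for V :: "'v set" and r :: nat and f :: "nat \<Rightarrow> 'v mpol" where
  mult: "q \<in> spoly_over (poly_fracts V) r \<Longrightarrow> (\<lambda>u. q * u) \<in> weyl_ops V r f"
| deriv: "v \<in> V \<Longrightarrow> Bderiv r f v \<in> weyl_ops V r f"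
| add: "P \<in> weyl_ops V r f \<Longrightarrow> Q \<in> weyl_ops V r f \<Longrightarrow> (\<lambda>u. P u + Q u) \<in> weyl_ops V r f"
| comp: "P \<in> weyl_ops V r f \<Longrightarrow> Q \<in> weyl_ops V r f \<Longrightarrow> P \<circ> Q \<in> weyl_ops V r f"


subsection \<open>The operators preserve the module\<close>

lemma poly_ring_0: "0 \<in> poly_ring V" by (simp add: poly_ring_def)

lemma poly_ring_1: "1 \<in> poly_ring V" by (simp add: poly_ring_def)

lemma poly_ring_add: "p \<in> poly_ring V \<Longrightarrow> q \<in> poly_ring V \<Longrightarrow> p + q \<in> poly_ring V"
  using keys_add[of p q] by (fastforce simp: poly_ring_def)

lemma poly_ring_uminus: "p \<in> poly_ring V \<Longrightarrow> - p \<in> poly_ring V"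
  by (simp add: poly_ring_def in_keys_iff)

lemma poly_ring_mult:
  assumes "p \<in> poly_ring V" "q \<in> poly_ring V"
  shows "p * q \<in> poly_ring V"
  unfolding poly_ring_def
proof safe
  fix m x assume "m \<in> Poly_Mapping.keys (p * q)" and x: "x \<in> Poly_Mapping.keys m"
  then obtain a b where "m = a + b" "a \<in> Poly_Mapping.keys p" "b \<in> Poly_Mapping.keys q"
    using keys_mult[of p q] by blast
  then show "x \<in> V" using x keys_add[of a b] assms by (auto simp: poly_ring_def)
qed

lemma poly_ring_power: "p \<in> poly_ring V \<Longrightarrow> p ^ k \<in> poly_ring V"
  by (induction k) (auto simp: poly_ring_1 poly_ring_mult)

lemma poly_ring_prod: "(\<And>j. j \<in> A \<Longrightarrow> f j \<in> poly_ring V) \<Longrightarrow> prod f A \<in> poly_ring V"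
  by (induction A rule: infinite_finite_induct) (auto simp: poly_ring_1 poly_ring_mult)

lemma poly_ring_sum: "(\<And>j. j \<in> A \<Longrightarrow> f j \<in> poly_ring V) \<Longrightarrow> sum f A \<in> poly_ring V"
  by (induction A rule: infinite_finite_induct) (auto simp: poly_ring_0 poly_ring_add)

lemma poly_ring_mpderiv:
  assumes "p \<in> poly_ring V" shows "mpderiv v p \<in> poly_ring V"
  unfolding mpderiv_def
proof (rule poly_ring_sum)
  fix m assume "m \<in> Poly_Mapping.keys p"
  then have "Poly_Mapping.keys m \<subseteq> V" using assms by (auto simp: poly_ring_def)
  moreover have "Poly_Mapping.keys (m - Poly_Mapping.single v 1) \<subseteq> Poly_Mapping.keys m"
    by (auto simp: in_keys_iff lookup_minus)
  ultimately show "Poly_Mapping.single (m - Poly_Mapping.single v 1)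
      (of_nat (Poly_Mapping.lookup m v) * Poly_Mapping.lookup p m) \<in> poly_ring V"
    by (auto simp: poly_ring_def)
qed

context
  fixes V :: "'v::linorder set" and h :: "'v mpol"
  assumes h: "h \<in> poly_ring V" "h \<noteq> 0"
begin

lemma localization_poly: "poly_fracts V \<subseteq> localization V h"
proof
  fix x assume "x \<in> poly_fracts V"
  then obtain a where "a \<in> poly_ring V" "x = Fract a (h ^ 0)"
    by (auto simp: poly_fracts_def)
  then show "x \<in> localization V h"
    unfolding localization_def by blast
qed

lemma localization_0: "0 \<in> localization V h"
proof -
  have "0 \<in> poly_fracts V"
    unfolding poly_fracts_def Zero_fract_def using poly_ring_0 by blast
  then show ?thesis using localization_poly by blast
qed

lemma localization_add:
  assumes "a \<in> localization V h" "b \<in> localization V h" shows "a + b \<in> localization V h"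
proof -
  obtain p k q l where ab: "a = Fract p (h^k)" "b = Fract q (h^l)"
    and "p \<in> poly_ring V" "q \<in> poly_ring V"
    using assms by (auto simp: localization_def)
  then have "p * h^l + q * h^k \<in> poly_ring V"
    using h by (intro poly_ring_add poly_ring_mult poly_ring_power)
  moreover have "a + b = Fract (p * h^l + q * h^k) (h^(k+l))"
    using h by (simp add: ab power_add)
  ultimately show ?thesis unfolding localization_def by blast
qed

lemma localization_mult:
  assumes "a \<in> localization V h" "b \<in> localization V h" shows "a * b \<in> localization V h"
proof -
  obtain p k q l where ab: "a = Fract p (h^k)" "b = Fract q (h^l)"
    and "p \<in> poly_ring V" "q \<in> poly_ring V"
    using assms by (auto simp: localization_def)
  then have "p * q \<in> poly_ring V"
    by (intro poly_ring_mult)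
  moreover have "a * b = Fract (p * q) (h^(k+l))"
    by (simp add: ab power_add)
  ultimately show ?thesis unfolding localization_def by blast
qed

lemma localization_fderiv:
  assumes "a \<in> localization V h" shows "fderiv v a \<in> localization V h"
proof -
  obtain p k where a: "a = Fract p (h^k)" and p: "p \<in> poly_ring V"
    using assms by (auto simp: localization_def)
  have "mpderiv v p * h^k - p * mpderiv v (h^k) \<in> poly_ring V"
    using poly_ring_add[OF _ poly_ring_uminus, of "mpderiv v p * h^k" V "p * mpderiv v (h^k)"] h p
    by (simp add: poly_ring_mult poly_ring_mpderiv poly_ring_power)
  moreover have "fderiv v a = Fract (mpderiv v p * h^k - p * mpderiv v (h^k)) (h^(k+k))"
    using h by (simp add: a fderiv_Fract power_add)
  ultimately show ?thesis unfolding localization_def by blast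
qed

end

lemma fderiv_0 [simp]: "fderiv v 0 = 0"
  by (simp add: Zero_fract_def fderiv_Fract eq_fract)

lemma spoly_over_add:
  assumes "\<And>a b. a \<in> R \<Longrightarrow> b \<in> R \<Longrightarrow> a + b \<in> R" "u \<in> spoly_over R r" "w \<in> spoly_over R r"
  shows "u + w \<in> spoly_over R r"
  unfolding spoly_over_def
proof safe
  fix m show "Poly_Mapping.lookup (u + w) m \<in> R"
    using assms by (simp add: spoly_over_def lookup_add)
next
  fix m x assume "m \<in> Poly_Mapping.keys (u + w)" and x: "x \<in> Poly_Mapping.keys m"
  then have "m \<in> Poly_Mapping.keys u \<or> m \<in> Poly_Mapping.keys w"
    using keys_add[of u w] by blast
  then have "Poly_Mapping.keys m \<subseteq> {1..r}"
    using assms(2,3) unfolding spoly_over_def by blast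
  then show "x \<in> {1..r}" using x by blast
qed

lemma sum_closed:
  assumes "0 \<in> R" "\<And>a b. a \<in> R \<Longrightarrow> b \<in> R \<Longrightarrow> a + b \<in> R" "\<And>x. x \<in> A \<Longrightarrow> g x \<in> R"
  shows "sum g A \<in> R"
  using assms(3) by (induction A rule: infinite_finite_induct) (auto simp: assms(1,2))

lemma spoly_over_mult:
  assumes "0 \<in> R" "\<And>a b. a \<in> R \<Longrightarrow> b \<in> R \<Longrightarrow> a + b \<in> R" "\<And>a b. a \<in> R \<Longrightarrow> b \<in> R \<Longrightarrow> a * b \<in> R"
    and u: "u \<in> spoly_over R r" and w: "w \<in> spoly_over R r"
  shows "u * w \<in> spoly_over R r"
  unfolding spoly_over_def
proof safe
  fix m show "Poly_Mapping.lookup (u * w) m \<in> R"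
    unfolding lookup_mult Sum_any.expand_set
  proof (intro sum_closed assms(1-3))
    fix k l
    show "Poly_Mapping.lookup u k \<in> R" using u by (simp add: spoly_over_def)
    show "(Poly_Mapping.lookup w l when m = k + l) \<in> R"
      using assms(1) w by (simp add: spoly_over_def when_def)
  qed
next
  fix m x assume "m \<in> Poly_Mapping.keys (u * w)" and x: "x \<in> Poly_Mapping.keys m"
  then obtain a b where "m = a + b" "a \<in> Poly_Mapping.keys u" "b \<in> Poly_Mapping.keys w"
    using keys_mult[of u w] by blast
  moreover have "Poly_Mapping.keys a \<subseteq> {1..r}" "Poly_Mapping.keys b \<subseteq> {1..r}"
    using u w calculation by (auto simp only: spoly_over_def mem_Collect_eq)
  ultimately show "x \<in> {1..r}" using x keys_add[of a b] by blast
qed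

lemma Fract_over_prod:
  fixes f :: "nat \<Rightarrow> 'v::linorder mpol"
  assumes f: "\<And>j. j \<in> {1..r} \<Longrightarrow> f j \<in> poly_ring V \<and> f j \<noteq> 0" and j: "j \<in> {1..r}" and p: "p \<in> poly_ring V"
  shows "Fract p (f j) \<in> localization V (\<Prod>j=1..r. f j)"
proof -
  let ?g = "\<Prod>i \<in> {1..r} - {j}. f i"
  have "(\<Prod>j=1..r. f j) = f j * ?g" using j by (simp add: prod.remove)
  moreover have "?g \<noteq> 0" using f by auto
  ultimately have "Fract p (f j) = Fract (?g * p) ((\<Prod>j=1..r. f j) ^ 1)"
    using mult_fract_cancel[of ?g p "f j"] by (simp add: mult.commute)
  moreover have "?g * p \<in> poly_ring V" using f p by (intro poly_ring_mult poly_ring_prod) auto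
  ultimately show ?thesis unfolding localization_def by blast
qed

lemma weyl_ops_Bmod:
  assumes f: "\<And>j. j \<in> {1..r} \<Longrightarrow> f j \<in> poly_ring V \<and> f j \<noteq> 0"
  shows "P \<in> weyl_ops V r f \<Longrightarrow> u \<in> Bmod V r f \<Longrightarrow> P u \<in> Bmod V r f"
proof -
  let ?h = "\<Prod>j=1..r. f j"
  have h: "?h \<in> poly_ring V" "?h \<noteq> 0" using f by (auto intro!: poly_ring_prod)
  note L = localization_0[OF h] localization_add[OF h] localization_mult[OF h]
  show "P \<in> weyl_ops V r f \<Longrightarrow> u \<in> Bmod V r f \<Longrightarrow> P u \<in> Bmod V r f"
  proof (induction arbitrary: u rule: weyl_ops.induct)
    case (mult q)
    then have "q \<in> Bmod V r f"
      using localization_poly[OF h] by (auto simp: Bmod_def spoly_over_def)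
    then show ?case using mult unfolding Bmod_def by (intro spoly_over_mult L)
  next
    case (deriv v)
    have lk: "Poly_Mapping.lookup (Poly_Mapping.map (fderiv v) u) m = fderiv v (Poly_Mapping.lookup u m)" for m
      by (simp add: Poly_Mapping.map.rep_eq when_def)
    have "Poly_Mapping.keys (Poly_Mapping.map (fderiv v) u) \<subseteq> Poly_Mapping.keys u"
    proof
      fix m assume "m \<in> Poly_Mapping.keys (Poly_Mapping.map (fderiv v) u)"
      then have "fderiv v (Poly_Mapping.lookup u m) \<noteq> 0" by (simp only: in_keys_iff lk not_False_eq_True)
      then have "Poly_Mapping.lookup u m \<noteq> 0" by (metis fderiv_0)
      then show "m \<in> Poly_Mapping.keys u" by (simp only: in_keys_iff not_False_eq_True)
    qed
    then have "Poly_Mapping.map (fderiv v) u \<in> Bmod V r f"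
      using deriv localization_fderiv[OF h, of _ v] unfolding Bmod_def spoly_over_def mem_Collect_eq lk
      by blast
    moreover have "svar j * scoeff (Fract (mpderiv v (f j)) (f j)) \<in> Bmod V r f"
      if j: "j \<in> {1..r}" for j
    proof -
      have F: "Fract (mpderiv v (f j)) (f j) \<in> localization V ?h"
        using f j poly_ring_mpderiv[of "f j" V v] by (intro Fract_over_prod) auto
      have e: "svar j * scoeff a = Poly_Mapping.single (Poly_Mapping.single j 1) a" for a :: "'a mpol fract"
        by (simp add: svar_def scoeff_def mult_single)
      have "Poly_Mapping.single (Poly_Mapping.single j 1) a \<in> Bmod V r f" if "a \<in> localization V ?h" for a
        using that L(1) j unfolding Bmod_def spoly_over_def by (auto simp: lookup_single when_def)
      then show ?thesis using F by (simp only: e)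
    qed
    then have "(\<Sum>j=1..r. svar j * scoeff (Fract (mpderiv v (f j)) (f j))) \<in> Bmod V r f"
    proof (intro sum_closed)
      show "0 \<in> Bmod V r f" using L(1) by (simp add: Bmod_def spoly_over_def)
    qed (auto simp only: Bmod_def intro!: spoly_over_add L)
    ultimately show ?case
      using deriv unfolding Bderiv_def Bmod_def by (intro spoly_over_add spoly_over_mult L)
  next
    case (add P Q)
    then show ?case using L by (auto simp: Bmod_def intro!: spoly_over_add)
  next
    case (comp P Q)
    then show ?case by auto
  qed
qed


section \<open>The b-function\<close>

text \<open>\<open>f_shift r f c\<close> is \<open>\<Prod>\<^sub>j f\<^sub>j\<^bsup>s\<^sub>j + c\<^sub>j\<^esup>\<close>, i.e. \<open>f\<^sup>c \<cdot> f\<^sup>s\<close>.\<close>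

definition f_shift :: "nat \<Rightarrow> (nat \<Rightarrow> 'v mpol) \<Rightarrow> (nat \<Rightarrow> int) \<Rightarrow> 'v::linorder spoly" where
  "f_shift r f c = scoeff (\<Prod>j=1..r. Fract (f j) 1 powi c j)"

definition c_under_s :: "nat \<Rightarrow> (nat \<Rightarrow> int) \<Rightarrow> 'v::linorder spoly" where
  "c_under_s r c = (\<Prod>j \<in> {j \<in> {1..r}. c j < 0}. \<Prod>k < nat (- c j). svar j - of_nat k)"

definition eval_at_s :: "nat \<Rightarrow> complex poly \<Rightarrow> 'v::linorder spoly" where
  "eval_at_s r b = poly (map_poly (\<lambda>z. emb (Poly_Mapping.single 0 z)) b) (\<Sum>j=1..r. svar j)"

definition bfun_equation ::
  "'v::linorder set \<Rightarrow> nat \<Rightarrow> (nat \<Rightarrow> 'v mpol) \<Rightarrow> complex poly \<Rightarrow> bool" where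
  "bfun_equation V r f b \<longleftrightarrow>
     (\<exists>C P. finite C \<and> C \<subseteq> {c \<in> {1..r} \<rightarrow>\<^sub>E UNIV. (\<Sum>j=1..r. c j) = 1} \<and>
        (\<forall>c\<in>C. P c \<in> weyl_ops V r f) \<and>
        (\<Sum>c\<in>C. P c (c_under_s r c * f_shift r f c)) = eval_at_s r b)"

definition is_bfun ::
  "'v::linorder set \<Rightarrow> nat \<Rightarrow> (nat \<Rightarrow> 'v mpol) \<Rightarrow> complex poly \<Rightarrow> bool" where
  "is_bfun V r f b \<longleftrightarrow> lead_coeff b = 1 \<and> bfun_equation V r f b \<and>
     (\<forall>b'. lead_coeff b' = 1 \<and> bfun_equation V r f b' \<longrightarrow>
        Polynomial.degree b \<le> Polynomial.degree b')"

definition generating_tuple ::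
  "'v set \<Rightarrow> 'v mpol set \<Rightarrow> nat \<Rightarrow> (nat \<Rightarrow> 'v mpol) \<Rightarrow> bool" where
  "generating_tuple V I r f \<longleftrightarrow> (\<forall>j\<in>{1..r}. f j \<in> poly_ring V \<and> f j \<noteq> 0) \<and>
     I = ideal_generated V (f ` {1..r})"

text \<open>
  The b-function of an ideal is the common b-function of all its tuples of non-zero generators;
  the first conjunct excludes a vacuous second one.
\<close>

definition is_bfun_ideal :: "'v::linorder set \<Rightarrow> 'v mpol set \<Rightarrow> complex poly \<Rightarrow> bool" where
  "is_bfun_ideal V I b \<longleftrightarrow> (\<exists>r f. generating_tuple V I r f) \<and>
     (\<forall>r f. generating_tuple V I r f \<longrightarrow> is_bfun V r f b)"


section \<open>Pfaffians of the generic skew-symmetric matrix\<close>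

definition pfaffian :: "nat \<Rightarrow> (nat \<Rightarrow> nat \<Rightarrow> 'v mpol) \<Rightarrow> 'v mpol" where
  "pfaffian m A = Poly_Mapping.single 0 (1 / (2 ^ m * fact m)) *
     (\<Sum>\<sigma> | \<sigma> permutes {1..2*m}. of_int (sign \<sigma>) * (\<Prod>i=1..m. A (\<sigma> (2*i - 1)) (\<sigma> (2*i))))"

lemma pfaffian_1: "pfaffian 1 A = Poly_Mapping.single 0 (1/2) * (A 1 2 - A 2 1)"
proof -
  have "{1..2*1::nat} = {1,2}" by auto
  moreover have "{s. s permutes {1::nat,2}} = {id, transpose 1 2}"
    by (auto simp: permutes_doubleton_iff)
  moreover have "id \<noteq> transpose (1::nat) 2" by (auto simp: fun_eq_iff transpose_def)
  ultimately show ?thesis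
    by (simp add: pfaffian_def sign_swap_id transpose_def fun_eq_iff)
qed

definition skew_vars :: "nat \<Rightarrow> (nat \<times> nat) set" where
  "skew_vars n = {(i, j). 1 \<le> i \<and> i < j \<and> j \<le> 2*n + 1}"

definition generic_skew :: "nat \<Rightarrow> nat \<Rightarrow> (nat \<times> nat) mpol" where
  "generic_skew i j = (if i < j then mvar (i, j) else if j < i then - mvar (j, i) else 0)"

text \<open>\<open>sub_pfaffian n k\<close> omits row and column \<open>k \<in> {1..2*n+1}\<close>.\<close>

definition skip :: "nat \<Rightarrow> nat \<Rightarrow> nat" where
  "skip k i = (if i < k then i else i + 1)"

definition sub_pfaffian :: "nat \<Rightarrow> nat \<Rightarrow> (nat \<times> nat) mpol" where
  "sub_pfaffian n k = pfaffian n (\<lambda>i j. generic_skew (skip k i) (skip k j))"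

end

theory Submission
  imports Defs
begin

text \<open>
  Let \<open>f\<^sub>1, \<dots>, f\<^sub>r\<close> generate the ideal, introduce auxiliary variables \<open>t\<^sub>1, \<dots>, t\<^sub>r\<close> and put
  \<open>\<phi> = t\<^sub>1 f\<^sub>1 + \<dots> + t\<^sub>r f\<^sub>r\<close>. An element \<open>u(s) f\<^sup>s\<close> is determined by its values at natural
  exponents \<open>m\<close>, which are collected in the series \<open>\<Sum>\<^sub>m u(m) f\<^sup>m t\<^sup>m / m!\<close>. Then \<open>f\<^sup>s\<close> becomes the
  exponential of \<open>\<phi>\<close>, the exponent \<open>s\<^sub>j\<close> acts as \<open>t\<^sub>j \<partial>/\<partial>t\<^sub>j\<close>, and the elements
  allowed on the left-hand side of the b-function equation become the result of applying
  differential operators of weight \<open>1\<close> to the exponential (\<open>vfil\<close> and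
  \<open>bfun_equation_iff_vfil\<close>), where \<open>t\<^sub>j\<close> has weight \<open>- 1\<close> and \<open>\<partial>/\<partial>t\<^sub>j\<close> has weight \<open>1\<close>.
  The equation for \<open>b\<close> says that the series with components \<open>b(d) \<phi>\<^sup>d / d!\<close> is of this kind.

  In this form it depends only on the ideal: if two tuples generate the same ideal, a linear
  substitution of the auxiliary variables takes one exponential to the other and respects the
  weights (\<open>vfil_pull\<close>, \<open>vfil_independent\<close>). For the Pfaffians, with suitable signs, \<open>\<phi>\<close> is
  the Pfaffian of the generic skew-symmetric matrix of size \<open>2 n + 2\<close>, the auxiliary variables
  forming an additional row (\<open>phase_signed_pfaffian\<close>). Everything now rests on Cayley's identity
  \<open>\<phi>(\<partial>) \<phi>\<^sup>d\<^sup>+\<^sup>1 = (d + 1) b(d) \<phi>\<^sup>d\<close> with \<open>b(d) = (d + 3) (d + 5) \<cdots> (d + 2 n + 1)\<close>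
  (\<open>cayley\<close>, \<open>pfop_dpow\<close>).

  The identity gives the equation for \<open>b\<close> at once, because \<open>\<phi>(\<partial>)\<close> is linear in the derivatives
  \<open>\<partial>/\<partial>t\<^sub>j\<close> and so has weight \<open>1\<close> (\<open>vfil_bpoly\<close>). It also gives minimality. In the Fischer
  pairing \<open>\<langle>p, q\<rangle> = p(\<partial>) q (0)\<close>, multiplication by \<open>\<phi>\<close> is adjoint to \<open>\<phi>(\<partial>)\<close>, so the numbers
  \<open>Y(d) = \<langle>\<phi>\<^sup>d / d!, \<phi>\<^sup>d / d!\<rangle>\<close> satisfy \<open>(d + 1) Y(d + 1) = b(d) Y(d)\<close>. The component of degree \<open>d\<close>
  of whatever an operator of weight \<open>k\<close> makes of the exponential has pairing \<open>Y(d + k)\<close> times a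
  polynomial in \<open>d\<close> with \<open>\<phi>\<^sup>d / d!\<close>, for large \<open>d\<close> (\<open>vfil_tame\<close>). If \<open>b'\<close> satisfies
  the equation, this gives \<open>b'(d) Y(d) = R(d) Y(d + 1)\<close>, hence \<open>(d + 1) b'(d) = R(d) b(d)\<close>; as \<open>- 1\<close> is
  not a root of \<open>b\<close>, the polynomial \<open>b\<close> divides \<open>b'\<close>.
\<close>

abbreviation "lookup \<equiv> Poly_Mapping.lookup"
abbreviation "single \<equiv> Poly_Mapping.single"
abbreviation "keys \<equiv> Poly_Mapping.keys"

section \<open>Pfaffians of words\<close>

text \<open>
  Alternating sum over the ways to remove one letter \<open>y\<close> from a word, leaving the word \<open>r\<close>.
  The recursion moves a sign past each letter, which suits inductions on words.
\<close>

primrec altsum :: "('a \<Rightarrow> 'a list \<Rightarrow> 'r::comm_ring_1) \<Rightarrow> 'a list \<Rightarrow> 'r" where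
  "altsum F [] = 0"
| "altsum F (c # v) = F c v - altsum (\<lambda>y r. F y (c # r)) v"

lemma altsum_cong [fundef_cong]:
  assumes "w = w'"
    and "\<And>y r. y \<in> set w' \<Longrightarrow> set r \<subseteq> set w' \<Longrightarrow> length r < length w' \<Longrightarrow> F y r = G y r"
  shows "altsum F w = altsum G w'"
  using assms(2) unfolding assms(1)
proof (induction w' arbitrary: F G)
  case (Cons c v)
  have "altsum (\<lambda>y r. F y (c # r)) v = altsum (\<lambda>y r. G y (c # r)) v"
    by (rule Cons.IH, rule Cons.prems) auto
  moreover have "F c v = G c v" by (rule Cons.prems) auto
  ultimately show ?case by simp
qed simp

text \<open>
  The Pfaffian of the submatrix selected by a word, by expansion along its first letter. Words
  may repeat letters and need not be sorted; in the quadratic relation below, unwanted terms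
  disappear because they belong to words with a repeated letter.
\<close>

fun pf :: "('a \<Rightarrow> 'a \<Rightarrow> 'r::comm_ring_1) \<Rightarrow> 'a list \<Rightarrow> 'r" where
  "pf A [] = 1"
| "pf A (a # w) = altsum (\<lambda>y r. A a y * pf A r) w"

lemma altsum_add: "altsum (\<lambda>y r. F y r + G y r) w = altsum F w + altsum G w"
  by (induction w arbitrary: F G) auto

lemma altsum_additive:
  assumes "\<And>x y. h (x + y) = h x + h y"
  shows "h (altsum F w) = altsum (\<lambda>y r. h (F y r)) w"
proof -
  have 0: "h 0 = 0" using assms[of 0 0] by simp
  have "h (x - y) = h x - h y" for x y
    using assms[of "x - y" y] by (simp add: algebra_simps)
  then show ?thesis
    by (induction w arbitrary: F) (auto simp: 0)
qed

lemma altsum_mult: "c * altsum F w = altsum (\<lambda>y r. c * F y r) w"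
  by (rule altsum_additive) (rule distrib_left)

lemma altsum_mult_right: "altsum F w * c = altsum (\<lambda>y r. F y r * c) w"
  by (rule altsum_additive) (rule distrib_right)

lemma altsum_minus: "altsum (\<lambda>y r. - F y r) w = - altsum F w"
  by (rule altsum_additive[symmetric]) simp

lemma altsum_diff: "altsum (\<lambda>y r. F y r - G y r) w = altsum F w - altsum G w"
  using altsum_add[of F "\<lambda>y r. - G y r" w] by (simp add: altsum_minus)

lemma altsum_zero [simp]: "altsum (\<lambda>y r. 0) w = 0"
  by (induction w) auto

lemma altsum_append:
  "altsum F (u @ v) = altsum (\<lambda>y r. F y (r @ v)) u + (-1) ^ length u * altsum (\<lambda>y r. F y (u @ r)) v"
  by (induction u arbitrary: F) (auto simp: algebra_simps)

text \<open>
  Removing two letters in the opposite order changes the sign exactly once.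
\<close>

lemma altsum_swap:
  "altsum (\<lambda>y r. altsum (\<lambda>z s. G y z s) r) w = - altsum (\<lambda>y r. altsum (\<lambda>z s. G z y s) r) w"
proof (induction w arbitrary: G)
  case (Cons c v)
  show ?case
    using Cons.IH[of "\<lambda>y z s. G y z (c # s)"]
    by (simp add: altsum_diff)
qed simp

locale skew =
  fixes A :: "'a \<Rightarrow> 'a \<Rightarrow> 'r::comm_ring_1"
  assumes skew: "A i j = - A j i"
    and diag: "A i i = 0"
    and two_torsion_free: "x + x = 0 \<Longrightarrow> x = (0::'r)"
begin

lemma pf_swap_head: "pf A (a # b # w) = - pf A (b # a # w)"
proof -
  have *: "altsum (\<lambda>y r. A a y * pf A (b # r)) w = - altsum (\<lambda>y r. A b y * pf A (a # r)) w"
    using altsum_swap[of "\<lambda>y z s. A a y * (A b z * pf A s)" w]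
    by (simp add: altsum_mult mult.left_commute)
  have "pf A (a # b # w) = A a b * pf A w - altsum (\<lambda>y r. A a y * pf A (b # r)) w"
    by (simp only: pf.simps(2)[of A a] altsum.simps)
  moreover have "pf A (b # a # w) = A b a * pf A w - altsum (\<lambda>y r. A b y * pf A (a # r)) w"
    by (simp only: pf.simps(2)[of A b] altsum.simps)
  ultimately show ?thesis
    using * skew[of a b] by (simp only:) (simp add: algebra_simps)
qed

lemma pf_swap: "pf A (u @ a # b # v) = - pf A (u @ b # a # v)"
proof (induction "length u" arbitrary: u v rule: less_induct)
  case less
  show ?case
  proof (cases u)
    case Nil
    then show ?thesis using pf_swap_head[of a b v] by simp
  next
    case (Cons c u')
    define X where "X a b = altsum (\<lambda>y r. A c y * pf A (r @ a # b # v)) u'" for a b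
    define Y where "Y a b = altsum (\<lambda>y r. A c y * pf A (u' @ a # b # r)) v" for a b
    have 1: "X a b = - X b a"
      unfolding X_def altsum_minus[symmetric]
    proof (rule altsum_cong[OF refl])
      fix y and r :: "'a list" assume "length r < length u'"
      then have "pf A (r @ a # b # v) = - pf A (r @ b # a # v)"
        by (intro less) (simp add: Cons)
      then show "A c y * pf A (r @ a # b # v) = - (A c y * pf A (r @ b # a # v))"
        by (simp only: mult_minus_right)
    qed
    have 2: "Y a b = - Y b a"
      unfolding Y_def altsum_minus[symmetric]
    proof (rule altsum_cong[OF refl])
      fix y r
      have "pf A (u' @ a # b # r) = - pf A (u' @ b # a # r)"
        by (intro less) (simp add: Cons)
      then show "A c y * pf A (u' @ a # b # r) = - (A c y * pf A (u' @ b # a # r))"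
        by (simp only: mult_minus_right)
    qed
    have 3: "pf A (u @ a # b # v) = X a b + (-1) ^ length u' *
        (A c a * pf A (u' @ b # v) - (A c b * pf A (u' @ a # v) - Y a b))" for a b
      by (simp only: Cons append_Cons pf.simps altsum_append altsum.simps X_def Y_def)
    show ?thesis
      unfolding 3 1 2 by (simp add: algebra_simps)
  qed
qed

lemma pf_move: "pf A (u @ a # v @ w) = (-1) ^ length v * pf A (u @ v @ a # w)"
proof (induction v arbitrary: u)
  case (Cons b v)
  show ?case
    using pf_swap[of u a b "v @ w"] Cons[of "u @ [b]"] by simp
qed simp

lemma pf_repeat:
  assumes "\<not> distinct w"
  shows "pf A w = 0"
proof -
  obtain xs ys zs y where w: "w = xs @ [y] @ ys @ [y] @ zs"
    using not_distinct_decomp[OF assms] by blast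
  have "pf A (xs @ ys @ y # y # zs) = - pf A (xs @ ys @ y # y # zs)"
    using pf_swap[of "xs @ ys" y y zs] by simp
  then have "pf A (xs @ ys @ y # y # zs) + pf A (xs @ ys @ y # y # zs) = 0"
    by (simp only: eq_neg_iff_add_eq_0)
  then have "pf A (xs @ ys @ y # y # zs) = 0"
    by (rule two_torsion_free)
  then show ?thesis
    using pf_move[of xs y ys "y # zs"] by (simp add: w)
qed

lemma pf_exchange: "pf A (u @ a # v @ b # w) = - pf A (u @ b # v @ a # w)"
proof -
  have "pf A (u @ a # v @ b # w) = (-1) ^ length v * pf A (u @ v @ a # b # w)"
    by (rule pf_move)
  also have "\<dots> = - ((-1) ^ length v * pf A (u @ v @ b # a # w))"
    using pf_swap[of "u @ v" a b w] by simp
  also have "(-1) ^ length v * pf A (u @ v @ b # a # w) = pf A (u @ b # v @ a # w)"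
    by (rule pf_move[symmetric])
  finally show ?thesis .
qed

text \<open>
  A relation of Pluecker type. The sum may be extended over the letters \<open>y\<close> of \<open>J\<close>, because
  the second factor then has a repeated letter. Expanding that factor along \<open>y\<close> leaves the
  term with \<open>A a y\<close>, which sums to the right-hand side, and for every letter \<open>z\<close> of \<open>J\<close> the
  expansion of the Pfaffian of \<open>z # w @ J\<close>, which has a repeated letter and vanishes.
\<close>

lemma pf_quadratic:
  "altsum (\<lambda>y r. pf A (r @ J) * pf A (a # y # J)) w = pf A (a # w @ J) * pf A J"
proof -
  let ?W = "w @ J"
  have exp: "pf A (a # y # J) = A a y * pf A J + altsum (\<lambda>z s. A y z * pf A (a # s)) J" for y
  proof -
    have "pf A (a # y # J) = - pf A (y # a # J)" by (rule pf_swap_head)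
    also have "pf A (y # a # J) = A y a * pf A J - altsum (\<lambda>z s. A y z * pf A (a # s)) J"
      by (simp only: pf.simps(2)[of A y] altsum.simps)
    finally show ?thesis using skew[of a y] by (simp only:) (simp add: algebra_simps)
  qed
  have "altsum (\<lambda>y r. pf A r * pf A (a # y # J)) ?W
      = altsum (\<lambda>y r. pf A (r @ J) * pf A (a # y # J)) w
        + (-1) ^ length w * altsum (\<lambda>y r. pf A (w @ r) * pf A (a # y # J)) J"
    by (rule altsum_append)
  also have "altsum (\<lambda>y r. pf A (w @ r) * pf A (a # y # J)) J = altsum (\<lambda>y r. 0) J"
    by (intro altsum_cong refl) (subst (2) pf_repeat, auto)
  finally have L: "altsum (\<lambda>y r. pf A r * pf A (a # y # J)) ?W
      = altsum (\<lambda>y r. pf A (r @ J) * pf A (a # y # J)) w" by simp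
  have swap: "altsum (\<lambda>y r. altsum (\<lambda>z s. G y r z s) J) V
            = altsum (\<lambda>z s. altsum (\<lambda>y r. G y r z s) V) J" for G :: "'a \<Rightarrow> 'a list \<Rightarrow> 'a \<Rightarrow> 'a list \<Rightarrow> 'r" and V
  proof (induction V arbitrary: G)
    case (Cons c V)
    show ?case
      using Cons[of "\<lambda>y r. G y (c # r)"]
      by (simp add: altsum_diff)
  qed simp
  have "altsum (\<lambda>y r. pf A r * pf A (a # y # J)) ?W
      = altsum (\<lambda>y r. A a y * pf A r) ?W * pf A J
        + altsum (\<lambda>y r. altsum (\<lambda>z s. A y z * pf A (a # s) * pf A r) J) ?W"
    unfolding exp distrib_left altsum_add altsum_mult_right altsum_mult
    by (simp add: mult_ac)
  also have "altsum (\<lambda>y r. altsum (\<lambda>z s. A y z * pf A (a # s) * pf A r) J) ?W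
      = altsum (\<lambda>z s. altsum (\<lambda>y r. A y z * pf A (a # s) * pf A r) ?W) J"
    by (rule swap)
  also have "\<dots> = altsum (\<lambda>z s. 0) J"
  proof (rule altsum_cong[OF refl])
    fix z s assume "z \<in> set J"
    then have "pf A (z # ?W) = 0" by (intro pf_repeat) auto
    moreover have "altsum (\<lambda>y r. A y z * pf A (a # s) * pf A r) ?W = - pf A (a # s) * pf A (z # ?W)"
      unfolding pf.simps(2)[of A z] altsum_mult
    proof (intro altsum_cong refl)
      fix y r
      show "A y z * pf A (a # s) * pf A r = - pf A (a # s) * (A z y * pf A r)"
        by (simp only: skew[of y z]) (simp only: algebra_simps minus_mult_left[symmetric] minus_mult_right[symmetric])
    qed
    ultimately show "altsum (\<lambda>y r. A y z * pf A (a # s) * pf A r) ?W = 0" by simp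
  qed
  finally show ?thesis unfolding L by simp
qed

end

section \<open>Cayley's identity for the Pfaffian\<close>

lemma altsum_conv_sum:
  "altsum F w = (\<Sum>i<length w. (-1) ^ i * F (w ! i) (take i w @ drop (Suc i) w))"
proof (induction w arbitrary: F)
  case (Cons c v)
  show ?case
    unfolding altsum.simps Cons length_Cons sum.lessThan_Suc_shift
    by (simp add: sum_negf)
qed simp

text \<open>
  The Pfaffian with every matrix entry replaced by the corresponding derivation \<open>D i j\<close>.
\<close>

fun pfop :: "('a \<Rightarrow> 'a \<Rightarrow> 'r \<Rightarrow> 'r::comm_ring_1) \<Rightarrow> 'a list \<Rightarrow> 'r \<Rightarrow> 'r" where
  "pfop D [] q = q"
| "pfop D (a # w) q = altsum (\<lambda>y r. D a y (pfop D r q)) w"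

locale skew_derivations = skew A
  for A :: "'a \<Rightarrow> 'a \<Rightarrow> 'r::comm_ring_1" +
  fixes D :: "'a \<Rightarrow> 'a \<Rightarrow> 'r \<Rightarrow> 'r"
  assumes D_add: "D a b (p + q) = D a b p + D a b q"
    and D_mult: "D a b (p * q) = D a b p * q + p * D a b q"
    and D_entry: "a \<noteq> b \<Longrightarrow> D a b (A c d) = (if c = a \<and> d = b then 1 else if c = b \<and> d = a then - 1 else 0)"
begin

lemma D_1 [simp]: "D a b 1 = 0"
  using D_mult[of a b 1 1] by simp

lemma D_0 [simp]: "D a b 0 = 0"
  using D_add[of a b 0 0] by simp

lemma D_uminus: "D a b (- p) = - D a b p"
  using D_add[of a b p "- p"] by (simp add: eq_neg_iff_add_eq_0 add.commute)

lemma D_power: "D a b (p ^ Suc n) = of_nat (Suc n) * p ^ n * D a b p"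
  by (induction n) (simp_all add: D_mult algebra_simps)

lemma D_of_nat [simp]: "D a b (of_nat n) = 0"
  by (induction n) (simp_all add: D_add)

lemma D_altsum: "D a b (altsum F w) = altsum (\<lambda>y r. D a b (F y r)) w"
  by (rule altsum_additive) (rule D_add)

lemma D_pf_eq_0:
  assumes "a \<noteq> b" "a \<notin> set w"
  shows "D a b (pf A w) = 0"
  using assms(2)
proof (induction "length w" arbitrary: w rule: less_induct)
  case less
  show ?case
  proof (cases w)
    case (Cons c v)
    have "altsum (\<lambda>y r. D a b (A c y * pf A r)) v = altsum (\<lambda>y r. 0) v"
    proof (rule altsum_cong[OF refl])
      fix y and r :: "'a list"
      assume *: "y \<in> set v" "set r \<subseteq> set v" "length r < length v"
      then have "D a b (pf A r) = 0" using less.prems Cons by (intro less.hyps) auto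
      moreover have "D a b (A c y) = 0" using * less.prems Cons assms(1) by (auto simp: D_entry)
      ultimately show "D a b (A c y * pf A r) = 0" by (simp add: D_mult)
    qed
    then show ?thesis by (simp add: Cons D_altsum)
  qed simp
qed

lemma D_pf:
  assumes "distinct (a # b # J)"
  shows "D a b (pf A (a # b # J)) = pf A J"
proof -
  have "altsum (\<lambda>y r. D a b (A a y * pf A (b # r))) J = altsum (\<lambda>y r. 0) J"
  proof (rule altsum_cong[OF refl])
    fix y and r :: "'a list"
    assume *: "y \<in> set J" "set r \<subseteq> set J"
    have "D a b (pf A (b # r)) = 0" using assms * by (intro D_pf_eq_0) auto
    moreover have "D a b (A a y) = 0" using * assms by (auto simp: D_entry)
    ultimately show "D a b (A a y * pf A (b # r)) = 0" by (simp only: D_mult) simp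
  qed
  moreover have "D a b (pf A (a # b # J)) = D a b (A a b * pf A J) - altsum (\<lambda>y r. D a b (A a y * pf A (b # r))) J"
    using D_add[of a b "A a b * pf A J" "- altsum (\<lambda>y r. A a y * pf A (b # r)) J"]
    by (simp only: pf.simps(2)[of A a] altsum.simps D_uminus D_altsum) simp
  ultimately show ?thesis
    using assms by (simp add: D_mult D_entry D_pf_eq_0)
qed

lemma pf_move_pair:
  assumes "even (length r)"
  shows "pf A (r @ a # y # J) = pf A (a # y # r @ J)"
proof -
  have "pf A (a # y # r @ J) = - pf A (y # r @ a # J)"
    using pf_move[of "[]" a "y # r" J] assms by simp
  also have "pf A (y # r @ a # J) = pf A (r @ y # a # J)"
    using pf_move[of "[]" y r "a # J"] assms by simp
  also have "\<dots> = - pf A (r @ a # y # J)"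
    by (rule pf_swap)
  finally show ?thesis by simp
qed

text \<open>
  Applying only the derivatives indexed by a part \<open>I\<close> of the word gives a statement that can be
  proved by induction on \<open>I\<close>. One more derivative, taken from the row expansion of the operator,
  hits either the factor \<open>pf A (a # y # J)\<close> left by the induction hypothesis, contributing the
  same term for each of the \<open>2 * k + 1\<close> letters \<open>y\<close>, or a factor of \<open>P ^ s\<close>, where the
  quadratic relation collects the terms into \<open>s\<close> times the same product.
  The sign \<open>e\<close> absorbs the reordering of the word when letters move between \<open>I\<close> and \<open>J\<close>.
\<close>

lemma cayley_partial:
  assumes "length I = 2 * k" "distinct (I @ J)" "P = e * pf A (I @ J)" "e * e = 1"
    and e: "\<And>a b p. D a b (e * p) = e * D a b p"
  shows "pfop D I (P ^ Suc s) = e * of_nat (\<Prod>j<k. Suc s + 2 * j) * P ^ s * pf A J"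
  using assms
proof (induction k arbitrary: I J e)
  case 0
  then have I: "I = []" and P: "P = e * pf A J" by simp_all
  have "pfop D I (P ^ Suc s) = P * P ^ s" by (simp add: I)
  also have "P * P ^ s = e * pf A J * P ^ s" by (simp only: P[symmetric])
  finally show ?case by (simp add: mult_ac)
next
  case (Suc k)
  then obtain a w where I: "I = a # w" and lw: "length w = Suc (2 * k)"
    by (cases I) auto
  have dist: "distinct (a # w @ J)" using Suc.prems(2) I by simp
  define C where "C = (of_nat (\<Prod>j<k. Suc s + 2 * j) :: 'r)"
  have DC: "D c d C = 0" for c d unfolding C_def by (rule D_of_nat)
  define del where "del i = take i w @ drop (Suc i) w" for i
  have summand: "(-1) ^ i * D a (w ! i) (pfop D (del i) (P ^ Suc s))
      = C * (of_nat s * P ^ (s - 1)) * ((-1) ^ i * (pf A (del i @ J) * pf A (a # w ! i # J)))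
        + e * C * P ^ s * pf A J" if i: "i < length w" for i
  proof -
    let ?y = "w ! i" and ?r = "del i"
    define e' where "e' = (-1) ^ i * e"
    have w: "w = take i w @ ?y # drop (Suc i) w" using i by (simp add: id_take_nth_drop)
    have lr: "length ?r = 2 * k" using lw i by (simp add: del_def)
    have "distinct (a # (take i w @ ?y # drop (Suc i) w) @ J)" using dist w by simp
    then have d: "distinct (?r @ a # ?y # J)" "distinct (a # ?y # ?r @ J)" "distinct (a # ?y # J)"
      unfolding del_def by auto
    have pm: "pf A (a # ?y # ?r @ J) = (-1) ^ i * pf A (a # w @ J)"
    proof -
      have "pf A (a # ?y # ?r @ J) = (-1) ^ length (take i w) * pf A (a # (take i w @ ?y # drop (Suc i) w) @ J)"
        using pf_move[of "[a]" ?y "take i w" "drop (Suc i) w @ J"] by (simp add: del_def)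
      then show ?thesis using i w by simp
    qed
    have pm': "pf A (a # w @ J) = (-1) ^ i * pf A (a # ?y # ?r @ J)"
      unfolding pm by (cases "even i") simp_all
    have P: "P = e' * pf A (a # ?y # ?r @ J)"
      using Suc.prems(3) pm' unfolding e'_def by (simp add: I mult_ac)
    have DeC: "D c d (e' * p) = e' * D c d p" for c d p
      using Suc.prems(5) unfolding e'_def by (cases "even i") (simp_all add: D_uminus)
    have ee: "e' * e' = 1" using Suc.prems(4) unfolding e'_def
      by (cases "even i") simp_all
    have "pfop D ?r (P ^ Suc s) = e' * C * P ^ s * pf A (a # ?y # J)"
      unfolding C_def
    proof (rule Suc.IH[OF lr d(1) _ ee DeC])
      show "P = e' * pf A (?r @ a # ?y # J)"
        using P pf_move_pair[of ?r a ?y J] lr by simp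
    qed
    then have "D a ?y (pfop D ?r (P ^ Suc s)) = e' * D a ?y (C * (P ^ s * pf A (a # ?y # J)))"
      by (simp only: DeC[symmetric] mult.assoc)
    also have "\<dots> = e' * C * (D a ?y (P ^ s) * pf A (a # ?y # J) + P ^ s * pf A J)"
      unfolding D_mult DC D_pf[OF d(3)] by (simp add: algebra_simps del: pf.simps)
    also have "D a ?y (P ^ s) = of_nat s * P ^ (s - 1) * (e' * pf A (?r @ J))"
    proof (cases s)
      case (Suc s')
      have "D a ?y P = e' * pf A (?r @ J)"
        unfolding P DeC using D_pf[OF d(2)] by simp
      then show ?thesis unfolding Suc D_power by simp
    qed simp
    finally have "D a ?y (pfop D ?r (P ^ Suc s)) =
        e' * C * (of_nat s * P ^ (s - 1) * (e' * pf A (?r @ J)) * pf A (a # ?y # J) + P ^ s * pf A J)" .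
    moreover have "(-1) ^ i * (e' * C * (of_nat s * P ^ (s - 1) * (e' * X) * Y + Z)) =
        (e' * e') * (C * (of_nat s * P ^ (s - 1)) * ((-1) ^ i * (X * Y))) + e * C * Z" for X Y Z
      unfolding e'_def by (cases "even i") (simp_all add: algebra_simps)
    ultimately show ?thesis unfolding ee by (simp add: mult.assoc)
  qed
  have PJ: "pf A (a # w @ J) = e * P"
    unfolding Suc.prems(3) mult.assoc[symmetric] Suc.prems(4) by (simp add: I)
  have "pfop D I (P ^ Suc s) = (\<Sum>i<length w. (-1) ^ i * D a (w ! i) (pfop D (del i) (P ^ Suc s)))"
    by (simp only: I pfop.simps altsum_conv_sum del_def)
  also have "\<dots> = C * (of_nat s * P ^ (s - 1)) *
      (\<Sum>i<length w. (-1) ^ i * (pf A (del i @ J) * pf A (a # w ! i # J)))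
      + of_nat (length w) * (e * C * P ^ s * pf A J)"
  proof -
    have "(\<Sum>i<length w. (-1) ^ i * D a (w ! i) (pfop D (del i) (P ^ Suc s))) =
      (\<Sum>i<length w. C * (of_nat s * P ^ (s - 1)) * ((-1) ^ i * (pf A (del i @ J) * pf A (a # w ! i # J)))
        + e * C * P ^ s * pf A J)"
      by (intro sum.cong refl summand) simp
    then show ?thesis
      by (simp only: sum.distrib sum_distrib_left sum_constant card_lessThan)
  qed
  also have "(\<Sum>i<length w. (-1) ^ i * (pf A (del i @ J) * pf A (a # w ! i # J)))
      = altsum (\<lambda>y r. pf A (r @ J) * pf A (a # y # J)) w"
    by (simp only: altsum_conv_sum del_def)
  also have "\<dots> = e * P * pf A J"
    by (simp only: pf_quadratic PJ)
  also have "C * (of_nat s * P ^ (s - 1)) * (e * P * pf A J) = of_nat s * (e * C * P ^ s * pf A J)"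
    by (cases s) (simp_all add: mult_ac)
  finally show ?case
    by (simp add: C_def lw algebra_simps)
qed

lemma cayley:
  assumes "length w = 2 * m" "distinct w"
  shows "pfop D w (pf A w ^ Suc s) = of_nat (\<Prod>j<m. Suc s + 2 * j) * pf A w ^ s"
  using cayley_partial[of w m "[]" "pf A w" 1 s] assms by simp

end

section \<open>Pfaffians as signed sums over permutations\<close>

definition antisym_sum :: "nat \<Rightarrow> ((nat \<Rightarrow> nat) \<Rightarrow> 'r::comm_ring_1) \<Rightarrow> 'r" where
  "antisym_sum L G = (\<Sum>\<sigma> | \<sigma> permutes {1..L}. of_int (sign \<sigma>) * G \<sigma>)"

lemma antisym_sum_transpose:
  fixes G :: "(nat \<Rightarrow> nat) \<Rightarrow> 'r::comm_ring_1"
  assumes "a \<in> {1..L}" "b \<in> {1..L}" "a \<noteq> b"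
  shows "antisym_sum L (\<lambda>\<sigma>. G (\<sigma> \<circ> transpose a b)) = - antisym_sum L G"
proof -
  have t: "transpose a b permutes {1..L}" using assms by (simp add: permutes_swap_id)
  have "antisym_sum L G = (\<Sum>\<sigma> | \<sigma> permutes {1..L}. of_int (sign (\<sigma> \<circ> transpose a b)) * G (\<sigma> \<circ> transpose a b))"
    unfolding antisym_sum_def by (rule sum_permutations_compose_right[OF t])
  also have "\<dots> = (\<Sum>\<sigma> | \<sigma> permutes {1..L}. - (of_int (sign \<sigma>) * G (\<sigma> \<circ> transpose a b)))"
  proof (intro sum.cong refl)
    fix \<sigma> :: "nat \<Rightarrow> nat" assume "\<sigma> \<in> {\<sigma>. \<sigma> permutes {1..L}}"
    then have "permutation \<sigma>" by (auto intro: permutes_imp_permutation[of "{1..L}"])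
    then have "sign (\<sigma> \<circ> transpose a b) = - sign \<sigma>"
      using assms by (simp add: sign_compose permutation_swap_id sign_swap_id)
    then show "of_int (sign (\<sigma> \<circ> transpose a b)) * G (\<sigma> \<circ> transpose a b)
        = - (of_int (sign \<sigma>) * G (\<sigma> \<circ> transpose a b))" by simp
  qed
  finally show ?thesis by (simp add: antisym_sum_def sum_negf)
qed

locale skew_nat = skew A for A :: "nat \<Rightarrow> nat \<Rightarrow> 'r::comm_ring_1"
begin

lemma pf_map_transpose:
  assumes "a \<in> {1..L}" "b \<in> {1..L}" "a < b"
  shows "pf A (map (p \<circ> transpose a b) [1..<Suc L]) = - pf A (map p [1..<Suc L])"
proof -
  have split: "[1..<Suc L] = [1..<a] @ a # [Suc a..<b] @ b # [Suc b..<Suc L]"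
  proof -
    have "[1..<Suc L] = [1..<a] @ [a..<Suc L]"
      using assms upt_add_eq_append[of 1 a "Suc L - a"] by simp
    also have "[a..<Suc L] = a # [Suc a..<Suc L]" using assms by (simp add: upt_conv_Cons)
    also have "[Suc a..<Suc L] = [Suc a..<b] @ [b..<Suc L]"
      using assms upt_add_eq_append[of "Suc a" b "Suc L - b"] by simp
    also have "[b..<Suc L] = b # [Suc b..<Suc L]" using assms by (simp add: upt_conv_Cons)
    finally show ?thesis .
  qed
  have eq: "map (p \<circ> transpose a b) l = map p l" if "a \<notin> set l" "b \<notin> set l" for l
    using that by (intro map_cong refl) (auto simp: transpose_def)
  have "map (p \<circ> transpose a b) [1..<Suc L]
      = map p [1..<a] @ p b # map p [Suc a..<b] @ p a # map p [Suc b..<Suc L]"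
  proof -
    have "map (p \<circ> transpose a b) [1..<a] = map p [1..<a]"
      by (rule eq) (use assms(3) in auto)
    moreover have "map (p \<circ> transpose a b) [Suc a..<b] = map p [Suc a..<b]"
      by (rule eq) auto
    moreover have "map (p \<circ> transpose a b) [Suc b..<Suc L] = map p [Suc b..<Suc L]"
      by (rule eq) (use assms(3) in auto)
    moreover have "(p \<circ> transpose a b) a = p b" "(p \<circ> transpose a b) b = p a" by simp_all
    ultimately show ?thesis by (simp only: split map_append list.map)
  qed
  moreover have "map p [1..<Suc L]
      = map p [1..<a] @ p a # map p [Suc a..<b] @ p b # map p [Suc b..<Suc L]"
    by (simp only: split map_append list.map)
  ultimately show ?thesis by (simp only:) (rule pf_exchange)
qed

lemma pf_map_permutes:
  assumes "\<sigma> permutes {1..L}"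
  shows "pf A (map \<sigma> [1..<Suc L]) = of_int (sign \<sigma>) * pf A [1..<Suc L]"
  using finite_atLeastAtMost assms
proof (induction \<sigma> rule: permutes_rev_induct)
  case (swap a b p)
  have "pf A (map (p \<circ> transpose a b) [1..<Suc L]) = - pf A (map p [1..<Suc L])"
  proof (cases "a < b")
    case True
    then show ?thesis using swap by (intro pf_map_transpose)
  next
    case False
    then show ?thesis using swap pf_map_transpose[of b L a p] by (simp add: transpose_commute)
  qed
  moreover have "sign (p \<circ> transpose a b) = - sign p"
    using swap permutes_imp_permutation[of "{1..L}" p]
    by (simp add: sign_compose permutation_swap_id sign_swap_id)
  ultimately show ?case using swap.IH by (simp only: of_int_minus mult_minus_left)
qed (simp_all del: upt_Suc)

text \<open>
  Neighbouring summands of a row expansion differ by a transposition of two positions, so under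
  antisymmetrisation all of them contribute equally. The recursion can therefore be unrolled
  inside one sum over permutations of fixed size.
\<close>

lemma antisym_sum_step:
  assumes j: "2 * j + 2 \<le> L"
  defines "G \<equiv> \<lambda>j \<sigma>. (\<Prod>i=1..j. A (\<sigma> (2*i-1)) (\<sigma> (2*i))) * pf A (map \<sigma> [2*j+1..<Suc L])"
  shows "antisym_sum L (G j) = of_nat (L - 2*j - 1) * antisym_sum L (G (Suc j))"
proof -
  define p where "p = 2 * j + 1"
  define pr where "pr = (\<lambda>\<sigma>::nat\<Rightarrow>nat. \<Prod>i=1..j. A (\<sigma> (2*i-1)) (\<sigma> (2*i)))"
  define H where "H = (\<lambda>l \<sigma>. pr \<sigma> * (A (\<sigma> p) (\<sigma> (p + 1 + l)) *
      pf A (map \<sigma> ([p+1..<p+1+l] @ [p+2+l..<Suc L]))))"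
  have exp: "G j \<sigma> = (\<Sum>l<L-p. (-1)^l * H l \<sigma>)" for \<sigma>
  proof -
    have "[2*j+1..<Suc L] = p # [p+1..<Suc L]"
      using j by (simp add: p_def upt_conv_Cons del: upt_Suc)
    then have "pf A (map \<sigma> [2*j+1..<Suc L]) = (\<Sum>l<L-p. (-1)^l * (A (\<sigma> p) (map \<sigma> [p+1..<Suc L] ! l) *
        pf A (take l (map \<sigma> [p+1..<Suc L]) @ drop (Suc l) (map \<sigma> [p+1..<Suc L]))))"
      by (simp add: altsum_conv_sum del: upt_Suc)
    also have "\<dots> = (\<Sum>l<L-p. (-1)^l * (A (\<sigma> p) (\<sigma> (p+1+l)) *
        pf A (map \<sigma> ([p+1..<p+1+l] @ [p+2+l..<Suc L]))))"
    proof (intro sum.cong refl)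
      fix l assume l: "l \<in> {..<L-p}"
      then have "map \<sigma> [p+1..<Suc L] ! l = \<sigma> (p+1+l)"
        by (simp del: upt_Suc)
      moreover have "take l (map \<sigma> [p+1..<Suc L]) @ drop (Suc l) (map \<sigma> [p+1..<Suc L])
          = map \<sigma> ([p+1..<p+1+l] @ [p+2+l..<Suc L])"
        using l by (simp add: take_map drop_map take_upt drop_upt del: upt_Suc)
      ultimately show "(-1)^l * (A (\<sigma> p) (map \<sigma> [p+1..<Suc L] ! l) *
        pf A (take l (map \<sigma> [p+1..<Suc L]) @ drop (Suc l) (map \<sigma> [p+1..<Suc L])))
        = (-1)^l * (A (\<sigma> p) (\<sigma> (p+1+l)) * pf A (map \<sigma> ([p+1..<p+1+l] @ [p+2+l..<Suc L])))"
        by (simp only:)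
    qed
    finally show ?thesis
      by (simp add: G_def H_def pr_def sum_distrib_left mult_ac del: upt_Suc)
  qed
  have H0: "H 0 = G (Suc j)"
    by (auto simp: fun_eq_iff H_def G_def pr_def p_def mult.assoc simp del: upt_Suc)
  have step: "antisym_sum L (H (Suc l)) = - antisym_sum L (H l)" if l: "Suc l < L - p" for l
  proof -
    define a b where "a = p + 1 + l" and "b = p + 2 + l"
    have "H (Suc l) \<sigma> = H l (\<sigma> \<circ> transpose a b)" for \<sigma>
    proof -
      have eq: "map (\<sigma> \<circ> transpose a b) k = map \<sigma> k" if "a \<notin> set k" "b \<notin> set k" for k
        using that by (intro map_cong refl) (auto simp: transpose_def)
      have "pr (\<sigma> \<circ> transpose a b) = pr \<sigma>"
        unfolding pr_def
        by (intro prod.cong refl) (auto simp: transpose_def a_def b_def p_def)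
      moreover have "(\<sigma> \<circ> transpose a b) p = \<sigma> p" "(\<sigma> \<circ> transpose a b) (p + 1 + l) = \<sigma> (p + 1 + Suc l)"
        by (simp_all add: transpose_def a_def b_def)
      moreover have "map (\<sigma> \<circ> transpose a b) ([p+1..<p+1+l] @ [p+2+l..<Suc L])
          = map \<sigma> ([p+1..<p+1+Suc l] @ [p+2+Suc l..<Suc L])"
      proof -
        have "[p+2+l..<Suc L] = b # [p+2+Suc l..<Suc L]"
          using l by (simp add: b_def upt_conv_Cons del: upt_Suc)
        moreover have "[p+1..<p+1+Suc l] = [p+1..<p+1+l] @ [a]"
          by (simp add: a_def)
        ultimately show ?thesis
          using eq[of "[p+1..<p+1+l]"] eq[of "[p+2+Suc l..<Suc L]"]
          by (simp add: a_def b_def del: upt_Suc)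
      qed
      ultimately show ?thesis by (simp only: H_def)
    qed
    then have "H (Suc l) = (\<lambda>\<sigma>. H l (\<sigma> \<circ> transpose a b))" by (rule ext)
    moreover have "a \<in> {1..L}" "b \<in> {1..L}" "a \<noteq> b" using l by (simp_all add: a_def b_def)
    ultimately show ?thesis
      using antisym_sum_transpose[of a L b "H l"] by metis
  qed
  have sgn: "antisym_sum L (H l) = (-1)^l * antisym_sum L (H 0)" if "l < L - p" for l
    using that
  proof (induction l)
    case (Suc l)
    then show ?case using step[of l] by (simp only:) simp
  qed simp
  have "(-1)^l * antisym_sum L (H l) = antisym_sum L (H 0)" if "l < L - p" for l
    by (cases "even l") (simp_all add: sgn[OF that])
  then have "(\<Sum>l<L-p. (-1)^l * antisym_sum L (H l)) = (\<Sum>l<L-p. antisym_sum L (H 0))"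
    by (intro sum.cong refl) (simp only: lessThan_iff)
  moreover have "antisym_sum L (G j) = (\<Sum>l<L-p. (-1)^l * antisym_sum L (H l))"
    unfolding antisym_sum_def exp sum_distrib_left
    by (subst sum.swap) (simp add: mult_ac)
  ultimately show ?thesis by (simp add: H0 p_def)
qed

text \<open>
  Antisymmetrising an antisymmetric function multiplies it by \<open>(2 m)!\<close>; unrolling the recursion
  instead produces the product of the entries, with factors \<open>2 m - 1, 2 m - 3, \<dots>, 1\<close>.
\<close>

lemma antisym_sum_pf:
  shows "of_nat (fact (2 * m)) * pf A [1..<Suc (2 * m)]
    = of_nat (\<Prod>j<m. 2 * m - 2 * j - 1) * antisym_sum (2 * m) (\<lambda>\<sigma>. \<Prod>i=1..m. A (\<sigma> (2*i-1)) (\<sigma> (2*i)))"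
proof -
  define L where "L = 2 * m"
  define G where "G = (\<lambda>j \<sigma>. (\<Prod>i=1..j. A (\<sigma> (2*i-1)) (\<sigma> (2*i))) * pf A (map \<sigma> [2*j+1..<Suc L]))"
  have "antisym_sum L (G 0) = of_nat (\<Prod>j<k. L - 2 * j - 1) * antisym_sum L (G k)" if "k \<le> m" for k
    using that
  proof (induction k)
    case (Suc k)
    then have "antisym_sum L (G k) = of_nat (L - 2*k - 1) * antisym_sum L (G (Suc k))"
      unfolding G_def by (intro antisym_sum_step) (auto simp: L_def)
    then show ?case using Suc by (simp add: mult_ac)
  qed simp
  from this[of m] have "antisym_sum L (G 0) = of_nat (\<Prod>j<m. L - 2 * j - 1) * antisym_sum L (G m)"
    by simp
  moreover have "antisym_sum L (G 0) = of_nat (fact L) * pf A [1..<Suc L]"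
  proof -
    have "of_int (sign \<sigma>) * G 0 \<sigma> = pf A [1..<Suc L]" if "\<sigma> permutes {1..L}" for \<sigma>
      using pf_map_permutes[OF that]
      by (simp add: G_def sign_idempotent del: upt_Suc flip: mult.assoc of_int_mult)
    then have "antisym_sum L (G 0) = (\<Sum>\<sigma> | \<sigma> permutes {1..L}. pf A [1..<Suc L])"
      unfolding antisym_sum_def by (intro sum.cong refl) auto
    also have "\<dots> = of_nat (fact L) * pf A [1..<Suc L]"
      by (simp add: card_permutations[of _ L] del: upt_Suc)
    finally show ?thesis .
  qed
  moreover have "G m = (\<lambda>\<sigma>. \<Prod>i=1..m. A (\<sigma> (2*i-1)) (\<sigma> (2*i)))"
    by (simp add: G_def L_def)
  ultimately show ?thesis by (simp only: L_def)
qed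

end

lemma fact_double_odd: "fact (2 * m) = (2 ^ m * fact m * (\<Prod>j<m. 2 * m - 2 * j - 1) :: nat)"
proof -
  have "(\<Prod>j<m. 2 * m - 2 * j - 1) = (\<Prod>j<m. 2 * j + 1 :: nat)"
    by (subst prod.nat_diff_reindex[symmetric]) (intro prod.cong refl, auto)
  moreover have "fact (2 * m) = (2 ^ m * fact m * (\<Prod>j<m. 2 * j + 1) :: nat)"
    by (induction m) (simp_all add: algebra_simps)
  ultimately show ?thesis by simp
qed

lemma single_0_mult: "single 0 a * single 0 b = (single 0 (a * b) :: 'v mpol)"
  by (simp add: mult_single)

lemma mpol_two_torsion_free:
  assumes "x + x = (0 :: 'v mpol)"
  shows "x = 0"
proof -
  from assms have "lookup x k + lookup x k = 0" for k
    by (metis lookup_add lookup_zero)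
  then show "x = 0" by (intro poly_mapping_eqI) (simp flip: mult_2)
qed

lemma pfaffian_eq_pf:
  fixes A :: "nat \<Rightarrow> nat \<Rightarrow> 'v mpol"
  assumes "\<And>i j. A i j = - A j i"
  shows "pfaffian m A = pf A [1..<Suc (2 * m)]"
proof -
  have "A i i = 0" for i
    using mpol_two_torsion_free[of "A i i"] assms[of i i] by (simp only: eq_neg_iff_add_eq_0)
  then interpret skew_nat A using assms by unfold_locales (assumption | rule mpol_two_torsion_free assms)+
  define c where "c = (\<Prod>j<m. 2 * m - 2 * j - 1)"
  have c: "c \<noteq> 0" by (auto simp: c_def)
  let ?S = "antisym_sum (2 * m) (\<lambda>\<sigma>. \<Prod>i=1..m. A (\<sigma> (2*i-1)) (\<sigma> (2*i)))"
  let ?s = "\<lambda>a::complex. single 0 a :: 'v mpol"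
  have "?s (of_nat (fact (2 * m))) * pf A [1..<Suc (2 * m)] = ?s (of_nat c) * ?S"
    using antisym_sum_pf[of m] by (simp only: single_of_nat c_def)
  then have eq: "?s (1 / of_nat (fact (2 * m))) * (?s (of_nat (fact (2 * m))) * pf A [1..<Suc (2 * m)])
    = ?s (1 / of_nat (fact (2 * m))) * (?s (of_nat c) * ?S)"
    by (simp only:)
  have "?s (1 / of_nat (fact (2 * m))) * ?s (of_nat (fact (2 * m))) = 1"
    unfolding single_0_mult by simp
  moreover have "?s (1 / of_nat (fact (2 * m))) * ?s (of_nat c) = ?s (of_nat c / of_nat (fact (2 * m)))"
    unfolding single_0_mult by simp
  ultimately have "pf A [1..<Suc (2 * m)] = ?s (of_nat c / of_nat (fact (2 * m))) * ?S"
    using eq by (simp only: mult.assoc[symmetric] mult_1)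
  also have "of_nat c / of_nat (fact (2 * m)) = (1 / (2 ^ m * fact m) :: complex)"
    using c unfolding fact_double_odd c_def[symmetric] by simp
  finally show ?thesis
    by (simp add: pfaffian_def antisym_sum_def del: upt_Suc)
qed

section \<open>Polynomials, divided powers and the Fischer pairing\<close>

abbreviation cst :: "'c::zero \<Rightarrow> ('w \<Rightarrow>\<^sub>0 nat) \<Rightarrow>\<^sub>0 'c" where
  "cst c \<equiv> single 0 c"

lemma cst_add: "cst (a + b) = cst a + (cst b :: ('w \<Rightarrow>\<^sub>0 nat) \<Rightarrow>\<^sub>0 'c::monoid_add)"
  by (rule single_add)

lemma cst_mult: "cst (a * b) = cst a * (cst b :: ('w \<Rightarrow>\<^sub>0 nat) \<Rightarrow>\<^sub>0 'c::comm_ring_1)"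
  by (simp add: mult_single)

lemma sum_monomials:
  "p = (\<Sum>m \<in> keys p. single m (lookup p m))"
proof (rule poly_mapping_eqI)
  fix k
  have "(\<Sum>m \<in> keys p. lookup p m when m = k) = lookup p k"
    by (simp add: when_def sum.delta' in_keys_iff)
  then show "lookup p k = lookup
    (\<Sum>m \<in> keys p. single m (lookup p m)) k"
    by (simp add: lookup_sum lookup_single)
qed

lemma additive_eqI:
  fixes p :: "'a \<Rightarrow>\<^sub>0 'c::comm_monoid_add" and f g :: "_ \<Rightarrow> 'r::ab_group_add"
  assumes "\<And>p q. f (p + q) = f p + f q" "\<And>p q. g (p + q) = g p + g q"
    and "\<And>m c. f (single m c) = g (single m c)"
  shows "f p = g p"
proof -
  have z: "f 0 = 0" "g 0 = 0" using assms(1)[of 0 0] assms(2)[of 0 0] by simp_all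
  have "f (\<Sum>m\<in>M. single m (c m)) = g (\<Sum>m\<in>M. single m (c m))" for M c
    by (induction M rule: infinite_finite_induct) (simp_all add: assms z)
  then show ?thesis using sum_monomials[of p] by metis
qed

lemma monomial_decomp:
  assumes "lookup m v \<noteq> 0"
  shows "m = single v 1 + (m - single v (1::nat))"
  by (rule poly_mapping_eqI) (use assms in \<open>auto simp: lookup_add lookup_minus lookup_single when_def\<close>)

lemma polynomial_induct [consumes 3, case_names const add var_mult]:
  fixes p :: "('w \<Rightarrow>\<^sub>0 nat) \<Rightarrow>\<^sub>0 'c::comm_ring_1"
  assumes zero: "0 \<in> R"
    and coeffs: "\<And>m. lookup p m \<in> R"
    and vars: "\<And>m. m \<in> keys p \<Longrightarrow> keys m \<subseteq> V"
    and const: "\<And>c. c \<in> R \<Longrightarrow> P (cst c)"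
    and add: "\<And>p q. P p \<Longrightarrow> P q \<Longrightarrow> P (p + q)"
    and var_mult: "\<And>v p. v \<in> V \<Longrightarrow> P p \<Longrightarrow> P (single (single v 1) 1 * p)"
  shows "P p"
proof -
  have mono: "P (single m c)" if "keys m \<subseteq> V" "c \<in> R" for m c
    using that(1)
  proof (induction "\<Sum>v\<in>keys m. lookup m v" arbitrary: m rule: less_induct)
    case less
    show ?case
    proof (cases "m = 0")
      case True
      then show ?thesis using const that by simp
    next
      case False
      then obtain v where v: "v \<in> keys m"
        by (metis all_not_in_conv keys_eq_empty)
      let ?n = "m - single v 1"
      have m: "m = single v 1 + ?n"
        using v by (intro monomial_decomp) (simp add: in_keys_iff)
      have sub: "keys ?n \<subseteq> keys m"
        by (auto simp: in_keys_iff lookup_minus)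
      have "(\<Sum>v\<in>keys ?n. lookup ?n v) = (\<Sum>v\<in>keys m. lookup ?n v)"
        using sub by (intro sum.mono_neutral_left) (auto simp: in_keys_iff)
      also have "\<dots> < (\<Sum>v\<in>keys m. lookup m v)"
      proof (rule sum_strict_mono_ex1)
        show "\<exists>a\<in>keys m. lookup ?n a < lookup m a"
          using v by (intro bexI[of _ v]) (auto simp: lookup_minus in_keys_iff)
      qed (auto simp: lookup_minus)
      finally have "P (single ?n c)"
        using less.prems sub by (intro less.hyps) auto
      then have "P (single (single v 1) 1 * single ?n c)"
        using v less.prems by (intro var_mult) auto
      then show ?thesis using m by (simp add: mult_single)
    qed
  qed
  have "P (\<Sum>m\<in>M. single m (lookup p m))"
    if "finite M" "M \<subseteq> keys p" for M
    using that
  proof (induction M rule: finite_induct)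
    case empty
    then show ?case using const[of 0] zero by simp
  next
    case (insert m M)
    then show ?case using mono[of m] coeffs vars by (auto intro!: add)
  qed
  then show ?thesis
    using sum_monomials[of p] by (metis finite_keys order_refl)
qed

lemma mvar_eq: "single (single v (Suc 0)) 1 = mvar v"
  by (simp add: mvar_def)

lemma mpol_induct [case_names const add var_mult]:
  fixes p :: "'w mpol"
  assumes "\<And>c. P (cst c)" "\<And>p q. P p \<Longrightarrow> P q \<Longrightarrow> P (p + q)" "\<And>v p. P p \<Longrightarrow> P (mvar v * p)"
  shows "P p"
  by (rule polynomial_induct[where R = UNIV and V = UNIV]) (auto simp: assms mvar_eq)

definition meval :: "('w \<Rightarrow> 'r::comm_ring_1) \<Rightarrow> ('w \<Rightarrow>\<^sub>0 nat) \<Rightarrow> 'r" where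
  "meval x m = (\<Prod>v\<in>keys m. x v ^ lookup m v)"

definition peval :: "('c::comm_ring_1 \<Rightarrow> 'r::comm_ring_1) \<Rightarrow> ('w \<Rightarrow> 'r) \<Rightarrow> (('w \<Rightarrow>\<^sub>0 nat) \<Rightarrow>\<^sub>0 'c) \<Rightarrow> 'r" where
  "peval h x p = (\<Sum>m\<in>keys p. h (lookup p m) * meval x m)"

lemma meval_superset:
  assumes "finite A" "keys m \<subseteq> A"
  shows "meval x m = (\<Prod>v\<in>A. x v ^ lookup m v)"
  unfolding meval_def using assms
  by (intro prod.mono_neutral_left) (auto simp: in_keys_iff)

lemma meval_0 [simp]: "meval x 0 = 1"
  by (simp add: meval_def)

lemma meval_single [simp]: "meval x (single v n) = x v ^ n"
  by (cases "n = 0") (simp_all add: meval_def)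

lemma meval_add: "meval x (m + k) = meval x m * meval x k"
proof -
  let ?A = "keys m \<union> keys k"
  have "keys (m + k) \<subseteq> ?A" by (rule keys_add)
  then have "meval x (m + k) = (\<Prod>v\<in>?A. x v ^ lookup (m + k) v)"
    by (intro meval_superset) auto
  also have "\<dots> = (\<Prod>v\<in>?A. x v ^ lookup m v) * (\<Prod>v\<in>?A. x v ^ lookup k v)"
    by (simp add: lookup_add power_add prod.distrib)
  also have "\<dots> = meval x m * meval x k"
    by (simp add: meval_superset[of ?A m] meval_superset[of ?A k])
  finally show ?thesis .
qed

locale coeff_hom =
  fixes h :: "'c::comm_ring_1 \<Rightarrow> 'r::comm_ring_1"
  assumes h_add: "h (a + b) = h a + h b"
    and h_mult: "h (a * b) = h a * h b"
    and h_1: "h 1 = 1"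
begin

lemma h_0: "h 0 = 0" using h_add[of 0 0] by simp

lemma peval_add: "peval h x (p + q) = peval h x p + peval h x q"
  unfolding peval_def
  by (rule setsum_keys_plus_distrib) (simp_all add: h_0 h_add algebra_simps)

lemma peval_single: "peval h x (single m c) = h c * meval x m"
  by (cases "c = 0") (simp_all add: peval_def h_0)

lemma peval_cst: "peval h x (cst c) = h c"
  by (simp add: peval_single)

lemma peval_var: "peval h x (single (single v 1) 1) = x v"
  by (simp add: peval_single h_1)

lemma peval_0: "peval h x 0 = 0" by (simp add: peval_def)

lemma peval_1: "peval h x 1 = 1"
  using peval_cst[of x 1] by (simp add: h_1)

lemma peval_mult: "peval h x (p * q) = peval h x p * peval h x q"
proof (rule additive_eqI[of "\<lambda>p. peval h x (p * q)" "\<lambda>p. peval h x p * peval h x q"])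
  fix m c
  show "peval h x (single m c * q) = peval h x (single m c) * peval h x q"
    by (rule additive_eqI[of "\<lambda>q. peval h x (single m c * q)"
          "\<lambda>q. peval h x (single m c) * peval h x q"])
      (simp_all add: peval_add mult_single peval_single h_mult meval_add algebra_simps)
qed (simp_all add: distrib_right peval_add)

lemma peval_uminus: "peval h x (- p) = - peval h x p"
  using peval_add[of x p "- p"] by (simp add: peval_0 eq_neg_iff_add_eq_0 add.commute)

lemma peval_diff: "peval h x (p - q) = peval h x p - peval h x q"
  using peval_add[of x p "- q"] by (simp add: peval_uminus)

lemma peval_power: "peval h x (p ^ n) = peval h x p ^ n"
  by (induction n) (simp_all add: peval_1 peval_mult)

lemma peval_sum: "peval h x (sum f A) = (\<Sum>a\<in>A. peval h x (f a))"
  by (induction A rule: infinite_finite_induct) (simp_all add: peval_0 peval_add)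

lemma peval_prod: "peval h x (prod f A) = (\<Prod>a\<in>A. peval h x (f a))"
  by (induction A rule: infinite_finite_induct) (simp_all add: peval_1 peval_mult)

lemma peval_of_nat: "peval h x (of_nat n) = of_nat n"
  by (induction n) (simp_all add: peval_0 peval_add peval_1)

lemmas peval_simps = peval_0 peval_1 peval_add peval_mult peval_uminus peval_diff peval_power
  peval_sum peval_prod peval_cst peval_of_nat

end

interpretation cst: coeff_hom "cst :: 'c::comm_ring_1 \<Rightarrow> ('w \<Rightarrow>\<^sub>0 nat) \<Rightarrow>\<^sub>0 'c"
  by unfold_locales (simp_all add: cst_add cst_mult)

lemma cst_peval_mvar [simp]: "peval cst x (mvar v) = x v"
  unfolding mvar_def by (rule cst.peval_var)

subsection \<open>Derivatives\<close>

lemma mpderiv_cst [simp]: "mpderiv v (cst c) = 0"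
  by (simp add: mpderiv_single)

lemma mpderiv_1 [simp]: "mpderiv v 1 = 0"
  using mpderiv_cst[of v 1] by simp

lemma mpderiv_mvar: "mpderiv v (mvar w) = (if v = w then 1 else 0)"
  by (auto simp: mvar_def mpderiv_single lookup_single when_def)

lemma mpderiv_uminus: "mpderiv v (- p) = - mpderiv v p"
  using mpderiv_add[of v p "- p"] by (simp add: eq_neg_iff_add_eq_0 add.commute)

lemma mpderiv_cst_mult: "mpderiv v (cst c * p) = cst c * mpderiv v p"
  by (simp add: mpderiv_mult)

lemma mpderiv_power: "mpderiv v (p ^ Suc n) = of_nat (Suc n) * p ^ n * mpderiv v p"
  by (induction n) (simp_all add: mpderiv_mult algebra_simps)

lemma mpderiv_commute: "mpderiv v (mpderiv w p) = mpderiv w (mpderiv v p)"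
  by (induction p rule: mpol_induct)
    (simp_all add: mpderiv_add mpderiv_mult mpderiv_mvar algebra_simps)

text \<open>
  Divided powers are indexed by integers, with value \<open>0\<close> at negative ones, so that the derivation
  rule below has no exceptional case.
\<close>

definition dpow :: "'w mpol \<Rightarrow> int \<Rightarrow> 'w mpol" where
  "dpow P e = (if e < 0 then 0 else cst (1 / fact (nat e)) * P ^ nat e)"

lemma dpow_neg: "e < 0 \<Longrightarrow> dpow P e = 0"
  by (simp add: dpow_def)

lemma dpow_0 [simp]: "dpow P 0 = 1"
  by (simp add: dpow_def)

lemma dpow_of_nat: "dpow P (int n) = cst (1 / fact n) * P ^ n"
  by (simp add: dpow_def)

lemma mult_dpow: "P * dpow P e = cst (of_int (e + 1)) * dpow P (e + 1)"
proof (cases "e < 0")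
  case True
  then show ?thesis by (cases "e = -1") (simp_all add: dpow_def)
next
  case False
  then obtain n where e: "e = int n" using nonneg_int_cases by (metis not_less)
  have "cst (of_nat (Suc n)) * (cst (1 / fact (Suc n)) * (P * P ^ n)) = cst (1 / fact n) * (P * P ^ n)"
    (is "?l = _")
  proof -
    have "?l = cst (of_nat (Suc n) * (1 / fact (Suc n))) * (P * P ^ n)"
      by (simp only: cst_mult mult.assoc)
    also have "of_nat (Suc n) * (1 / fact (Suc n)) = (1 / fact n :: complex)"
      by (simp del: of_nat_Suc)
    finally show ?thesis .
  qed
  moreover have "dpow P (e + 1) = cst (1 / fact (Suc n)) * (P * P ^ n)"
    using dpow_of_nat[of P "Suc n"] by (simp add: e add.commute)
  moreover have "of_int (e + 1) = (of_nat (Suc n) :: complex)" "dpow P e = cst (1 / fact n) * P ^ n"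
    by (simp_all add: e dpow_of_nat)
  ultimately show ?thesis
    by (simp only: mult.left_commute[of P])
qed

lemma mpderiv_dpow: "mpderiv v (dpow P e) = mpderiv v P * dpow P (e - 1)"
proof (cases "e \<le> 0")
  case True
  then show ?thesis by (cases "e = 0") (simp_all add: dpow_def)
next
  case False
  define n where "n = nat (e - 1)"
  have e: "e = int (Suc n)" "e - 1 = int n" using False by (auto simp: n_def)
  have c: "cst (1 / fact (Suc n)) * of_nat (Suc n) = (cst (1 / fact n) :: 'a mpol)"
  proof -
    have "of_nat (Suc n) = (cst (of_nat (Suc n)) :: 'a mpol)" by (rule single_of_nat[symmetric])
    then show ?thesis by (simp only: cst_mult[symmetric]) (simp del: of_nat_Suc)
  qed
  have "mpderiv v (dpow P e) = cst (1 / fact (Suc n)) * (of_nat (Suc n) * P ^ n * mpderiv v P)"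
    unfolding e dpow_of_nat mpderiv_cst_mult mpderiv_power ..
  also have "\<dots> = (cst (1 / fact (Suc n)) * of_nat (Suc n)) * P ^ n * mpderiv v P"
    by (simp only: mult.assoc)
  finally show ?thesis
    unfolding c e(2) dpow_of_nat by (simp only: mult_ac)
qed

subsection \<open>The Fischer pairing\<close>

text \<open>
  The pairing \<open>p(\<partial>) q\<close> evaluated at \<open>0\<close>. The factorials make multiplication by a variable
  adjoint to the partial derivative.
\<close>

definition mfact :: "('w \<Rightarrow>\<^sub>0 nat) \<Rightarrow> complex" where
  "mfact m = (\<Prod>v\<in>keys m. fact (lookup m v))"

definition fischer :: "'w mpol \<Rightarrow> 'w mpol \<Rightarrow> complex" where
  "fischer p q = (\<Sum>m\<in>keys p. mfact m * lookup p m * lookup q m)"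

lemma fischer_add_left: "fischer (p + q) u = fischer p u + fischer q u"
  unfolding fischer_def
  by (rule setsum_keys_plus_distrib[of "\<lambda>m c. mfact m * c * lookup u m"])
    (simp_all add: algebra_simps)

lemma fischer_add_right: "fischer u (p + q) = fischer u p + fischer u q"
  by (simp add: fischer_def lookup_add algebra_simps sum.distrib)

lemma fischer_0 [simp]: "fischer 0 u = 0" "fischer u 0 = 0"
  by (simp_all add: fischer_def)

lemma fischer_single:
  "fischer (single m a) (single k b) = (if m = k then mfact m * a * b else 0)"
  by (cases "a = 0") (auto simp: fischer_def lookup_single when_def)

lemma fischer_1 [simp]: "fischer 1 1 = 1"
  using fischer_single[of 0 1 0 1] by (simp add: mfact_def)

lemma fischer_commute: "fischer p q = fischer q p"
proof (rule additive_eqI[of "\<lambda>p. fischer p q" "\<lambda>p. fischer q p"])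
  fix m c
  show "fischer (single m c) q = fischer q (single m c)"
    by (rule additive_eqI[of "fischer (single m c)"])
      (auto simp: fischer_add_left fischer_add_right fischer_single)
qed (simp_all add: fischer_add_left fischer_add_right)

lemma fischer_cst_left: "fischer (cst a * p) q = a * fischer p q"
proof (rule additive_eqI[of "\<lambda>p. fischer (cst a * p) q" "\<lambda>p. a * fischer p q"])
  fix m c
  show "fischer (cst a * single m c) q = a * fischer (single m c) q"
    by (rule additive_eqI[of "\<lambda>q. fischer (cst a * single m c) q"])
      (auto simp: fischer_add_right fischer_single mult_single algebra_simps)
qed (simp_all add: fischer_add_left algebra_simps)

lemma fischer_cst_right: "fischer p (cst a * q) = a * fischer p q"
  by (metis fischer_commute fischer_cst_left)

lemma fischer_uminus_right: "fischer p (- q) = - fischer p q"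
  using fischer_cst_right[of p "-1" q] by (simp add: single_uminus)

lemma fischer_uminus_left: "fischer (- p) q = - fischer p q"
  using fischer_cst_left[of "-1" p q] by (simp add: single_uminus)

lemma mfact_add: "mfact (single v 1 + m) = of_nat (Suc (lookup m v)) * mfact m"
proof -
  let ?A = "insert v (keys m)" and ?n = "single v 1 + m"
  have sup: "mfact k = (\<Prod>w\<in>?A. fact (lookup k w))" if "keys k \<subseteq> ?A" for k
    unfolding mfact_def using that by (intro prod.mono_neutral_left) (auto simp: in_keys_iff)
  have k: "keys ?n \<subseteq> ?A" using keys_add[of "single v 1" m] by auto
  have "mfact ?n = fact (lookup ?n v) * (\<Prod>w\<in>?A - {v}. fact (lookup ?n w))"
    unfolding sup[OF k] by (subst prod.remove[of _ v]) auto
  also have "(\<Prod>w\<in>?A - {v}. fact (lookup ?n w)) = (\<Prod>w\<in>?A - {v}. fact (lookup m w) :: complex)"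
    by (intro prod.cong refl) (auto simp: lookup_add lookup_single)
  also have "fact (lookup ?n v) = of_nat (Suc (lookup m v)) * (fact (lookup m v) :: complex)"
    by (simp add: lookup_add)
  also have "\<dots> * (\<Prod>w\<in>?A - {v}. fact (lookup m w)) = of_nat (Suc (lookup m v)) * mfact m"
    unfolding sup[of m, OF subset_insertI] by (subst (2) prod.remove[of _ v]) (auto simp: mult_ac)
  finally show ?thesis .
qed

lemma fischer_mvar_left: "fischer (mvar v * p) q = fischer p (mpderiv v q)"
proof (rule additive_eqI[of "\<lambda>p. fischer (mvar v * p) q" "\<lambda>p. fischer p (mpderiv v q)"])
  fix m c
  show "fischer (mvar v * single m c) q = fischer (single m c) (mpderiv v q)"
  proof (rule additive_eqI[of "\<lambda>q. fischer (mvar v * single m c) q"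
        "\<lambda>q. fischer (single m c) (mpderiv v q)"])
    fix k d
    show "fischer (mvar v * single m c) (single k d)
        = fischer (single m c) (mpderiv v (single k d))"
    proof (cases "lookup k v = 0")
      case True
      then have "single v 1 + m \<noteq> k"
        by (metis lookup_add lookup_single_eq add_is_0 one_neq_zero)
      then show ?thesis
        using True by (simp add: mvar_def mult_single fischer_single mpderiv_single)
    next
      case False
      then have k: "k = single v 1 + (k - single v 1)"
        by (rule monomial_decomp)
      define n where "n = k - single v 1"
      have k: "k = single v 1 + n" using k by (simp add: n_def)
      have "lookup k v = Suc (lookup n v)" "k - single v 1 = n"
        unfolding k by (simp_all add: lookup_add)
      then have "mpderiv v (single k d) = single n (of_nat (Suc (lookup n v)) * d)"
        by (simp only: mpderiv_single)
      then show ?thesis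
        using mfact_add[of v m] unfolding k mvar_def mult_single
        by (cases "m = n") (simp_all add: fischer_single del: of_nat_Suc)
    qed
  qed (simp_all add: mpderiv_add fischer_add_right)
qed (simp_all add: distrib_left fischer_add_left)

lemma fischer_mvar_right: "fischer p (mvar v * q) = fischer (mpderiv v p) q"
  by (metis fischer_commute fischer_mvar_left)

section \<open>The V-filtration and change of generators\<close>

text \<open>
  Besides the variables \<open>Inl v\<close> of the given polynomial ring there is one variable \<open>Inr j\<close> for
  each generator \<open>f j\<close>. The exponent \<open>s j\<close> will act as the Euler operator of \<open>Inr j\<close>.
\<close>

definition xe :: "'v mpol \<Rightarrow> ('v + nat) mpol" where
  "xe = peval cst (mvar \<circ> Inl)"

abbreviation tv :: "nat \<Rightarrow> ('v + nat) mpol" where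
  "tv j \<equiv> mvar (Inr j)"

definition phase :: "nat \<Rightarrow> (nat \<Rightarrow> 'v mpol) \<Rightarrow> ('v + nat) mpol" where
  "phase r f = (\<Sum>j=1..r. tv j * xe (f j))"

lemma xe_simps [simp]:
  "xe 0 = 0" "xe 1 = 1" "xe (a + b) = xe a + xe b" "xe (a * b) = xe a * xe b" "xe (- a) = - xe a"
  "xe (cst c) = cst c" "xe (mvar v) = mvar (Inl v)" "xe (sum g A) = (\<Sum>i\<in>A. xe (g i))"
  by (simp_all add: xe_def cst.peval_simps)

lemma mpderiv_Inl_xe [simp]: "mpderiv (Inl v) (xe a) = xe (mpderiv v a)"
  by (induction a rule: mpol_induct) (simp_all add: mpderiv_add mpderiv_mult mpderiv_mvar)

lemma mpderiv_Inr_xe [simp]: "mpderiv (Inr j) (xe a) = 0"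
  by (induction a rule: mpol_induct) (simp_all add: mpderiv_add mpderiv_mult mpderiv_mvar)

lemma mpderiv_Inl_tv [simp]: "mpderiv (Inl v) (tv j) = 0"
  by (simp add: mpderiv_mvar)

lemma mpderiv_Inr_phase:
  assumes "j \<in> {1..r}"
  shows "mpderiv (Inr j) (phase r f) = xe (f j)"
proof -
  have "mpderiv (Inr j) (phase r f) = (\<Sum>i=1..r. if j = i then xe (f i) else 0)"
    unfolding phase_def mpderiv_sum
    by (intro sum.cong refl) (simp add: mpderiv_mult mpderiv_mvar)
  then show ?thesis using assms by simp
qed

text \<open>
  A formal series in the auxiliary variables is given by the family of its homogeneous
  components, so that \<open>dpow (phase r f)\<close> is the exponential of the phase. The predicate describes
  what differential operators of weight \<open>k\<close> make of this exponential, where an auxiliary variable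
  has weight \<open>- 1\<close> and its derivative has weight \<open>1\<close>; the original variables and their
  derivatives have weight \<open>0\<close>. In terms of the graph embedding by \<open>f\<close> this is the
  V-filtration, after a Fourier transform in the auxiliary variables.
\<close>

inductive vfil :: "'v set \<Rightarrow> nat \<Rightarrow> (nat \<Rightarrow> 'v mpol) \<Rightarrow> int \<Rightarrow> (int \<Rightarrow> ('v + nat) mpol) \<Rightarrow> bool"
  for V :: "'v set" and r :: nat and f :: "nat \<Rightarrow> 'v mpol" where
  base: "vfil V r f 0 (dpow (phase r f))"
| zero: "vfil V r f k (\<lambda>d. 0)"
| add: "vfil V r f k U \<Longrightarrow> vfil V r f k W \<Longrightarrow> vfil V r f k (\<lambda>d. U d + W d)"
| mult: "a \<in> poly_ring V \<Longrightarrow> vfil V r f k U \<Longrightarrow> vfil V r f k (\<lambda>d. xe a * U d)"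
| deriv: "v \<in> V \<Longrightarrow> vfil V r f k U \<Longrightarrow> vfil V r f k (\<lambda>d. mpderiv (Inl v) (U d))"
| tau: "j \<in> {1..r} \<Longrightarrow> vfil V r f k U \<Longrightarrow> vfil V r f (k - 1) (\<lambda>d. tv j * U (d - 1))"
| dtau: "j \<in> {1..r} \<Longrightarrow> vfil V r f k U \<Longrightarrow> vfil V r f (k + 1) (\<lambda>d. mpderiv (Inr j) (U (d + 1)))"

lemma cst_in_poly_ring: "cst c \<in> poly_ring V"
  by (auto simp: poly_ring_def)

lemma vfil_cst: "vfil V r f k U \<Longrightarrow> vfil V r f k (\<lambda>d. cst c * U d)"
  using vfil.mult[OF cst_in_poly_ring[of c V]] by simp

lemma vfil_uminus: "vfil V r f k U \<Longrightarrow> vfil V r f k (\<lambda>d. - U d)"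
  using vfil_cst[of V r f k U "-1"] by (simp add: single_uminus)

lemma vfil_diff: "vfil V r f k U \<Longrightarrow> vfil V r f k W \<Longrightarrow> vfil V r f k (\<lambda>d. U d - W d)"
  using vfil.add[OF _ vfil_uminus, of V r f k U W] by simp

lemma vfil_sum:
  assumes "\<And>i. i \<in> A \<Longrightarrow> vfil V r f k (U i)"
  shows "vfil V r f k (\<lambda>d. \<Sum>i\<in>A. U i d)"
  using assms
  by (induction A rule: infinite_finite_induct) (auto intro: vfil.zero vfil.add)

text \<open>The shift of the index compensates the drop in degree.\<close>

fun tderivs :: "nat list \<Rightarrow> (int \<Rightarrow> ('v + nat) mpol) \<Rightarrow> int \<Rightarrow> ('v + nat) mpol" where
  "tderivs [] U = U"
| "tderivs (l # ls) U = tderivs ls (\<lambda>d. mpderiv (Inr l) (U (d + 1)))"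

lemma tderivs_add: "tderivs ls (\<lambda>d. U d + W d) = (\<lambda>d. tderivs ls U d + tderivs ls W d)"
  by (induction ls arbitrary: U W) (simp_all add: mpderiv_add)

lemma tderivs_xe: "tderivs ls (\<lambda>d. xe a * U d) = (\<lambda>d. xe a * tderivs ls U d)"
  by (induction ls arbitrary: U) (simp_all add: mpderiv_mult)

lemma tderivs_mpderiv: "tderivs ls (\<lambda>d. mpderiv v (U d)) = (\<lambda>d. mpderiv v (tderivs ls U d))"
  by (induction ls arbitrary: U) (simp_all add: mpderiv_commute[of _ v])

lemma tderivs_snoc: "tderivs (ls @ [l]) U = (\<lambda>d. mpderiv (Inr l) (tderivs ls U (d + 1)))"
  by (induction ls arbitrary: U) simp_all

locale change_of_generators =
  fixes V :: "'v set" and rg :: nat and g :: "nat \<Rightarrow> 'v mpol" and rf :: nat and f :: "nat \<Rightarrow> 'v mpol"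
    and a c :: "nat \<Rightarrow> nat \<Rightarrow> 'v mpol"
  assumes a: "\<And>j k. a j k \<in> poly_ring V" and c: "\<And>j k. c j k \<in> poly_ring V"
    and g_eq: "\<And>j. j \<in> {1..rg} \<Longrightarrow> g j = (\<Sum>k=1..rf. a j k * f k)"
    and f_eq: "\<And>k. k \<in> {1..rf} \<Longrightarrow> f k = (\<Sum>j=1..rg. c j k * g j)"
begin

text \<open>
  Substituting these linear forms for the auxiliary variables of \<open>g\<close> turns the phase of \<open>g\<close>
  into that of \<open>f\<close>, because \<open>\<Sum>j. (\<Sum>k. c j k * t k) * g j = \<Sum>k. t k * f k\<close>.
\<close>

definition lin :: "nat \<Rightarrow> ('v + nat) mpol" where
  "lin j = (if j \<in> {1..rg} then \<Sum>k=1..rf. xe (c j k) * tv k else 0)"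

definition pull :: "('v + nat) mpol \<Rightarrow> ('v + nat) mpol" where
  "pull = peval cst (case_sum (mvar \<circ> Inl) lin)"

lemma pull_simps [simp]:
  "pull 0 = 0" "pull 1 = 1" "pull (p + q) = pull p + pull q" "pull (p * q) = pull p * pull q"
  "pull (cst z) = cst z" "pull (p ^ n) = pull p ^ n" "pull (sum h A) = (\<Sum>i\<in>A. pull (h i))"
  "pull (mvar (Inl v)) = mvar (Inl v)" "pull (tv j) = lin j"
  by (simp_all add: pull_def cst.peval_simps)

lemma pull_xe [simp]: "pull (xe p) = xe p"
  by (induction p rule: mpol_induct) simp_all

lemma pull_phase: "pull (phase rg g) = phase rf f"
proof -
  have "pull (phase rg g) = (\<Sum>j=1..rg. \<Sum>k=1..rf. tv k * (xe (c j k) * xe (g j)))"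
    by (simp add: phase_def lin_def sum_distrib_right sum_distrib_left mult_ac)
  also have "\<dots> = (\<Sum>k=1..rf. tv k * xe (\<Sum>j=1..rg. c j k * g j))"
    by (subst sum.swap) (simp add: sum_distrib_left)
  also have "\<dots> = phase rf f"
    unfolding phase_def by (intro sum.cong refl) (simp only: f_eq)
  finally show ?thesis .
qed

lemma pull_dpow: "pull (dpow (phase rg g) d) = dpow (phase rf f) d"
  by (simp add: dpow_def pull_phase)

lemma chain_rule:
  "mpderiv (Inl v) (pull p) = pull (mpderiv (Inl v) p)
     + (\<Sum>j=1..rg. mpderiv (Inl v) (lin j) * pull (mpderiv (Inr j) p))"
proof (induction p rule: mpol_induct)
  case (var_mult w p)
  have "mpderiv (Inl v) (pull (mvar w)) = pull (mpderiv (Inl v) (mvar w))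
     + (\<Sum>j=1..rg. mpderiv (Inl v) (lin j) * pull (mpderiv (Inr j) (mvar w)))"
  proof (cases w)
    case (Inl u)
    then show ?thesis by (simp add: mpderiv_mvar)
  next
    case (Inr i)
    have "(\<Sum>j=1..rg. mpderiv (Inl v) (lin j) * pull (mpderiv (Inr j) (mvar w)))
        = (\<Sum>j=1..rg. if j = i then mpderiv (Inl v) (lin j) else 0)"
      by (intro sum.cong refl) (simp add: Inr mpderiv_mvar)
    also have "\<dots> = mpderiv (Inl v) (lin i)"
      by (auto simp: lin_def)
    finally show ?thesis by (simp add: Inr)
  qed
  with var_mult show ?case
    by (simp add: mpderiv_mult algebra_simps sum.distrib sum_distrib_left)
qed (simp_all add: mpderiv_add algebra_simps sum.distrib)

text \<open>
  By the chain rule, a derivative of a pulled back component involves the derivatives in the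
  auxiliary variables, each multiplied by a linear form; the weights match. The statement that
  is stable under this step speaks about all mixed auxiliary derivatives at once.
\<close>

definition pulls :: "int \<Rightarrow> (int \<Rightarrow> ('v + nat) mpol) \<Rightarrow> bool" where
  "pulls k U \<longleftrightarrow> (\<forall>ls. set ls \<subseteq> {1..rg} \<longrightarrow> vfil V rf f (k + int (length ls)) (\<lambda>d. pull (tderivs ls U d)))"

lemma vfil_lin_mult:
  assumes "vfil V rf f (k + 1) U" "\<And>i. b i \<in> poly_ring V"
  shows "vfil V rf f k (\<lambda>d. (\<Sum>i=1..rf. xe (b i) * tv i) * U (d - 1))"
proof -
  have "vfil V rf f k (\<lambda>d. \<Sum>i=1..rf. xe (b i) * (tv i * U (d - 1)))"
    using vfil.mult[OF assms(2) vfil.tau[OF _ assms(1)]] by (intro vfil_sum) simp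
  then show ?thesis by (simp add: sum_distrib_right mult.assoc)
qed

lemma mpderiv_lin: "j \<in> {1..rg} \<Longrightarrow> mpderiv (Inl v) (lin j) = (\<Sum>k=1..rf. xe (mpderiv v (c j k)) * tv k)"
  by (simp add: lin_def mpderiv_sum mpderiv_mult)

text \<open>
  Multiplication by \<open>g l\<close> has weight \<open>1\<close> here: \<open>g l\<close> is a combination of the \<open>f k\<close>, and
  differentiating the exponential by \<open>Inr k\<close> multiplies it by \<open>f k\<close>.
\<close>

lemma vfil_generators: 
  assumes "set ls \<subseteq> {1..rg}"
  shows "vfil V rf f (int (length ls)) (\<lambda>d. xe (prod_list (map g ls)) * dpow (phase rf f) d)"
  using assms
proof (induction ls)
  case Nil
  then show ?case by (simp add: vfil.base)
next
  case (Cons l ls)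
  define p where "p = prod_list (map g ls)"
  have "vfil V rf f (int (length ls) + 1) (\<lambda>d. xe (a l k) * (mpderiv (Inr k) (xe p * dpow (phase rf f) (d + 1))))"
    if "k \<in> {1..rf}" for k
    using Cons vfil.mult[OF a vfil.dtau[OF that]] unfolding p_def by simp
  then have "vfil V rf f (int (length ls) + 1)
      (\<lambda>d. \<Sum>k=1..rf. xe (a l k) * (mpderiv (Inr k) (xe p * dpow (phase rf f) (d + 1))))"
    by (intro vfil_sum)
  moreover have "(\<Sum>k=1..rf. xe (a l k) * (mpderiv (Inr k) (xe p * dpow (phase rf f) (d + 1))))
      = xe (prod_list (map g (l # ls))) * dpow (phase rf f) d" for d
  proof -
    have "(\<Sum>k=1..rf. xe (a l k) * (mpderiv (Inr k) (xe p * dpow (phase rf f) (d + 1))))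
      = (\<Sum>k=1..rf. xe (a l k * f k) * (xe p * dpow (phase rf f) d))"
      by (intro sum.cong refl) (simp add: mpderiv_mult mpderiv_dpow mpderiv_Inr_phase mult_ac)
    then show ?thesis using Cons.prems
      by (simp add: p_def g_eq[of l] sum_distrib_right mult.assoc)
  qed
  ultimately show ?case by (simp add: add.commute)
qed

lemma tderivs_dpow:
  assumes "set ls \<subseteq> {1..rg}"
  shows "tderivs ls (dpow (phase rg g)) = (\<lambda>d. xe (prod_list (map g ls)) * dpow (phase rg g) d)"
  using assms
proof (induction ls)
  case (Cons l ls)
  have "(\<lambda>d. mpderiv (Inr l) (dpow (phase rg g) (d + 1))) = (\<lambda>d. xe (g l) * dpow (phase rg g) d)"
    using Cons.prems by (simp add: mpderiv_dpow mpderiv_Inr_phase)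
  then show ?case using Cons by (simp add: tderivs_xe mult.assoc)
qed simp

lemma pulls_tau:
  assumes "j \<in> {1..rg}" "pulls k U"
  shows "pulls (k - 1) (\<lambda>d. tv j * U (d - 1))"
proof -
  have "vfil V rf f (k - 1 + int (length ls)) (\<lambda>d. pull (tderivs ls (\<lambda>d. tv j * U (d - 1)) d))"
    if "set ls \<subseteq> {1..rg}" for ls
    using that assms(2)
  proof (induction ls arbitrary: k U)
    case Nil
    then have "vfil V rf f k (\<lambda>d. pull (U d))" by (auto simp: pulls_def dest: spec[of _ "[]"])
    then show ?case
      using vfil_lin_mult[of "k - 1" "\<lambda>d. pull (U d)" "c j"] assms(1) c by (simp add: lin_def)
  next
    case (Cons l ls)
    let ?W = "\<lambda>d. mpderiv (Inr l) (U (d + 1))"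
    have "pulls (k + 1) ?W"
      unfolding pulls_def
    proof (intro allI impI)
      fix ls' assume "set ls' \<subseteq> {1..rg}"
      then have "set (l # ls') \<subseteq> {1..rg}" using Cons.prems by simp
      then have "vfil V rf f (k + int (length (l # ls'))) (\<lambda>d. pull (tderivs (l # ls') U d))"
        using Cons.prems(2) unfolding pulls_def by blast
      then show "vfil V rf f (k + 1 + int (length ls')) (\<lambda>d. pull (tderivs ls' ?W d))"
        by (simp add: add_ac)
    qed
    then have "vfil V rf f (k + 1 - 1 + int (length ls)) (\<lambda>d. pull (tderivs ls (\<lambda>d. tv j * ?W (d - 1)) d))"
      using Cons by (intro Cons.IH) auto
    then have 1: "vfil V rf f (k + int (length ls)) (\<lambda>d. pull (tderivs ls (\<lambda>d. tv j * ?W (d - 1)) d))"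
      by simp
    have 2: "vfil V rf f (k + int (length ls)) (\<lambda>d. pull (tderivs ls U d))"
      using Cons.prems unfolding pulls_def by simp
    have "(\<lambda>d. mpderiv (Inr l) (tv j * U d)) = (\<lambda>d. tv j * mpderiv (Inr l) (U d) + (if l = j then U d else 0))"
      by (auto simp: mpderiv_mult mpderiv_mvar fun_eq_iff)
    then have "tderivs (l # ls) (\<lambda>d. tv j * U (d - 1))
        = (\<lambda>d. tderivs ls (\<lambda>d. tv j * ?W (d - 1)) d + (if l = j then tderivs ls U d else 0))"
      by (cases "l = j") (simp_all add: tderivs_add)
    then show ?case
      using vfil.add[OF 1 2] 1 by (cases "l = j") (simp_all add: algebra_simps)
  qed
  then show ?thesis by (simp add: pulls_def)
qed

lemma pulls_vfil: "vfil V rg g k U \<Longrightarrow> pulls k U"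
proof (induction rule: vfil.induct)
  case base
  show ?case
    unfolding pulls_def
    using vfil_generators by (auto simp: tderivs_dpow pull_dpow)
next
  case (zero k)
  have "tderivs ls (\<lambda>d. 0 :: ('v + nat) mpol) = (\<lambda>d. 0)" for ls by (induction ls) simp_all
  then show ?case by (simp add: pulls_def vfil.zero)
next
  case (add k U W)
  then show ?case by (simp add: pulls_def tderivs_add vfil.add)
next
  case (mult p k U)
  then show ?case by (simp add: pulls_def tderivs_xe vfil.mult)
next
  case (deriv v k U)
  show ?case
    unfolding pulls_def
  proof (intro allI impI)
    fix ls assume ls: "set ls \<subseteq> {1..rg}"
    let ?W = "tderivs ls U" and ?k = "k + int (length ls)"
    have "vfil V rf f ?k (\<lambda>d. mpderiv (Inl v) (lin j) * pull (mpderiv (Inr j) (?W d)))" if j: "j \<in> {1..rg}" for j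
    proof -
      have "set (ls @ [j]) \<subseteq> {1..rg}" using ls j by simp
      then have "vfil V rf f (k + int (length (ls @ [j]))) (\<lambda>d. pull (tderivs (ls @ [j]) U d))"
        using deriv.IH unfolding pulls_def by blast
      then have "vfil V rf f (?k + 1) (\<lambda>d. pull (mpderiv (Inr j) (?W (d + 1))))"
        by (simp add: tderivs_snoc add_ac)
      from vfil_lin_mult[OF this, of "\<lambda>i. mpderiv v (c j i)"] show ?thesis
        using c j by (simp add: mpderiv_lin poly_ring_mpderiv)
    qed
    then have "vfil V rf f ?k (\<lambda>d. \<Sum>j=1..rg. mpderiv (Inl v) (lin j) * pull (mpderiv (Inr j) (?W d)))"
      by (intro vfil_sum)
    moreover have "vfil V rf f ?k (\<lambda>d. mpderiv (Inl v) (pull (?W d)))"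
      using deriv ls unfolding pulls_def by (simp add: vfil.deriv)
    ultimately have "vfil V rf f ?k (\<lambda>d. mpderiv (Inl v) (pull (?W d))
        - (\<Sum>j=1..rg. mpderiv (Inl v) (lin j) * pull (mpderiv (Inr j) (?W d))))"
      by (rule vfil_diff[rotated])
    then show "vfil V rf f ?k (\<lambda>d. pull (tderivs ls (\<lambda>d. mpderiv (Inl v) (U d)) d))"
      by (simp add: tderivs_mpderiv chain_rule)
  qed
next
  case (tau j k U)
  then show ?case by (simp add: pulls_tau)
next
  case (dtau j k U)
  show ?case
    unfolding pulls_def
  proof (intro allI impI)
    fix ls assume "set ls \<subseteq> {1..rg}"
    then have "set (j # ls) \<subseteq> {1..rg}" using dtau by simp
    then have "vfil V rf f (k + int (length (j # ls))) (\<lambda>d. pull (tderivs (j # ls) U d))"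
      using dtau.IH unfolding pulls_def by blast
    then show "vfil V rf f (k + 1 + int (length ls)) (\<lambda>d. pull (tderivs ls (\<lambda>d. mpderiv (Inr j) (U (d + 1))) d))"
      by (simp add: add_ac)
  qed
qed

lemma vfil_pull:
  assumes "vfil V rg g k U"
  shows "vfil V rf f k (\<lambda>d. pull (U d))"
  using pulls_vfil[OF assms] unfolding pulls_def by (auto dest: spec[of _ "[]"])

end

text \<open>
  The ideal is generated by a set, in which equal entries of the tuple are identified; each
  generator is credited to one chosen index.
\<close>

lemma ideal_generated_coeffs:
  fixes r :: nat
  assumes "p \<in> ideal_generated V (f ` {1..r})"
  obtains b where "\<And>k. b k \<in> poly_ring V" "p = (\<Sum>k=1..r. b k * f k)"
proof -
  obtain A a where A: "finite A" "A \<subseteq> f ` {1..r}" "a \<in> A \<rightarrow> poly_ring V" and p: "p = (\<Sum>h\<in>A. a h * h)"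
    using assms unfolding ideal_generated_def by blast
  have "\<forall>h\<in>A. \<exists>k. k \<in> {1..r} \<and> f k = h" using A(2) by blast
  then obtain i where i: "\<And>h. h \<in> A \<Longrightarrow> i h \<in> {1..r} \<and> f (i h) = h" by metis
  define b where "b = (\<lambda>k. if k \<in> i ` A then a (f k) else 0)"
  have "inj_on i A" using i by (metis inj_onI)
  then have "p = (\<Sum>k\<in>i ` A. a (f k) * f k)"
    unfolding p using i by (subst sum.reindex) (auto intro!: sum.cong)
  also have "\<dots> = (\<Sum>k=1..r. b k * f k)"
    using i by (intro sum.mono_neutral_cong_left) (auto simp: b_def)
  finally have "p = (\<Sum>k=1..r. b k * f k)" .
  moreover have "b k \<in> poly_ring V" for k
    using A(3) i by (auto simp: b_def poly_ring_0)
  ultimately show ?thesis using that by blast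
qed

lemma generator_in_ideal: "k \<in> {1..r::nat} \<Longrightarrow> f k \<in> ideal_generated V (f ` {1..r})"
  unfolding ideal_generated_def
  by (intro CollectI exI[of _ "{f k}"] exI[of _ "\<lambda>_. 1"]) (auto simp: poly_ring_1)

lemma vfil_independent:
  assumes same: "ideal_generated V (f ` {1..r}) = ideal_generated V (g ` {1..r'})"
    and U: "vfil V r' g k (\<lambda>d. cst (z d) * dpow (phase r' g) d)"
  shows "vfil V r f k (\<lambda>d. cst (z d) * dpow (phase r f) d)"
proof -
  have "\<exists>b. (\<forall>k. b k \<in> poly_ring V) \<and> (j \<in> {1..r'} \<longrightarrow> g j = (\<Sum>k=1..r. b k * f k))" for j
  proof (cases "j \<in> {1..r'}")
    case True
    then have "g j \<in> ideal_generated V (f ` {1..r})" using same generator_in_ideal by metis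
    then show ?thesis by (metis ideal_generated_coeffs)
  qed (auto intro!: exI[of _ "\<lambda>_. 0"] simp: poly_ring_0)
  then obtain a where a: "\<And>j k. a j k \<in> poly_ring V"
      "\<And>j. j \<in> {1..r'} \<Longrightarrow> g j = (\<Sum>k=1..r. a j k * f k)"
    by metis
  have "\<exists>b. (\<forall>j. b j \<in> poly_ring V) \<and> (k \<in> {1..r} \<longrightarrow> f k = (\<Sum>j=1..r'. b j * g j))" for k
  proof (cases "k \<in> {1..r}")
    case True
    then have "f k \<in> ideal_generated V (g ` {1..r'})" using same generator_in_ideal by metis
    then show ?thesis by (metis ideal_generated_coeffs)
  qed (auto intro!: exI[of _ "\<lambda>_. 0"] simp: poly_ring_0)
  then obtain c where c: "\<And>j k. c j k \<in> poly_ring V"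
      "\<And>k. k \<in> {1..r} \<Longrightarrow> f k = (\<Sum>j=1..r'. c k j * g j)"
    by metis
  interpret change_of_generators V r' g r f a "\<lambda>j k. c k j"
    using a c by unfold_locales
  show ?thesis using vfil_pull[OF U] by (simp add: pull_dpow)
qed

section \<open>Divisibility by the Cayley polynomial\<close>

text \<open>
  The identity \<open>P(\<partial>) P ^ (e + 1) / (e + 1)! = b(e) P ^ e / e!\<close> in adjoint form: multiplication by
  \<open>P\<close> on the left argument of the pairing is moved to the right one.
\<close>

locale cayley_phase =
  fixes P :: "'w mpol" and b :: "complex poly"
  assumes adjoint: "fischer (z * P) (dpow P (e + 1)) = poly b (of_int e) * fischer z (dpow P e)"
    and b_nz: "e \<ge> 0 \<Longrightarrow> poly b (of_int e) \<noteq> 0"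
begin

definition Y :: "int \<Rightarrow> complex" where
  "Y e = fischer (dpow P e) (dpow P e)"

lemma recursion:
  "of_int (e + 1) * fischer (z * dpow P (e + 1)) (dpow P (e' + 1))
     = poly b (of_int e') * fischer (z * dpow P e) (dpow P e')"
proof -
  have "of_int (e + 1) * fischer (z * dpow P (e + 1)) (dpow P (e' + 1))
      = fischer (cst (of_int (e + 1)) * (z * dpow P (e + 1))) (dpow P (e' + 1))"
    by (rule fischer_cst_left[symmetric])
  also have "cst (of_int (e + 1)) * (z * dpow P (e + 1)) = (z * dpow P e) * P"
    by (subst mult.left_commute) (simp only: mult_dpow[symmetric], simp only: mult_ac)
  finally show ?thesis by (simp only: adjoint)
qed

text \<open>
  The numbers \<open>Y e\<close> play the role of a product of Gamma functions: passing from \<open>e\<close> to \<open>e + 1\<close>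
  multiplies them by \<open>b(e)\<close>, up to the harmless factor \<open>e + 1\<close>.
\<close>

lemma Y_recursion: "of_int (e + 1) * Y (e + 1) = poly b (of_int e) * Y e"
  using recursion[of e 1 e] by (simp add: Y_def)

lemma Y_nz: "e \<ge> 0 \<Longrightarrow> Y e \<noteq> 0"
proof (induction e rule: int_ge_induct)
  case base
  then show ?case by (simp add: Y_def)
next
  case (step e)
  then show ?case using Y_recursion[of e] b_nz[of e] by auto
qed

lemma fischer_dpow_higher:
  assumes "p > 0"
  shows "e \<ge> 0 \<Longrightarrow> fischer (z * dpow P (e + p)) (dpow P e) = 0"
proof (induction e rule: int_ge_induct)
  case base
  \<comment> \<open>At \<open>e' = - 1\<close> the divided power on the right of the recursion is \<open>0\<close>.\<close>
  show ?case using recursion[of "p - 1" z "-1"] assms by (simp add: dpow_neg)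
next
  case (step e)
  have "of_int (e + p + 1) * fischer (z * dpow P (e + p + 1)) (dpow P (e + 1)) = 0"
    using recursion[of "e + p" z e] step by simp
  moreover have "of_int (e + p + 1) \<noteq> (0 :: complex)"
    using step assms by (simp only: of_int_eq_0_iff)
  ultimately have "fischer (z * dpow P (e + p + 1)) (dpow P (e + 1)) = 0" by simp
  moreover have "e + p + 1 = e + 1 + p" by simp
  ultimately show ?case by simp
qed

text \<open>
  Moving powers of \<open>P\<close> from one argument to the other lowers the left power to \<open>0\<close>, and every step
  changes the pairing by the same factor as \<open>Y\<close>, except that the factorials have different
  arguments. Their quotient is the falling factorial \<open>Q\<close> in the larger exponent \<open>e + l\<close>.
\<close>

lemma fischer_dpow_lower:
  fixes l :: nat and z :: "'w mpol"
  defines "Q \<equiv> \<Prod>i<l. [:- of_nat i, 1 :: complex:]"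
  defines "\<kappa> \<equiv> fischer z (dpow P (int l)) / (Y (int l) * poly Q (of_nat l))"
  shows "e \<ge> 0 \<Longrightarrow> fischer (z * dpow P e) (dpow P (e + int l)) = Y (e + int l) * (\<kappa> * poly Q (of_int (e + int l)))"
proof (induction e rule: int_ge_induct)
  case base
  have "poly Q (of_nat l) \<noteq> 0"
    by (auto simp: Q_def poly_prod)
  then show ?case using Y_nz[of "int l"] by (simp add: \<kappa>_def)
next
  case (step e)
  let ?d = "e + int l"
  have Q: "of_int (e + 1) * poly Q (of_int ?d + 1) = of_int (?d + 1) * poly Q (of_int ?d)"
  proof -
    have "poly Q (x + 1) * (x + 1 - of_nat l) = (x + 1) * poly Q x" for x :: complex
      unfolding Q_def by (induction l) (simp_all add: poly_prod algebra_simps)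
    from this[of "of_int ?d"] show ?thesis by (simp add: algebra_simps)
  qed
  have "of_int (e + 1) * fischer (z * dpow P (e + 1)) (dpow P (?d + 1))
      = poly b (of_int ?d) * (Y ?d * (\<kappa> * poly Q (of_int ?d)))"
    using recursion[of e z ?d] step by simp
  also have "\<dots> = (of_int (?d + 1) * poly Q (of_int ?d)) * Y (?d + 1) * \<kappa>"
    using Y_recursion[of ?d] by (simp only: mult_ac) (simp add: mult_ac)
  also have "\<dots> = of_int (e + 1) * (Y (?d + 1) * (\<kappa> * poly Q (of_int ?d + 1)))"
    unfolding Q[symmetric] by (simp only: mult_ac)
  finally have "of_int (e + 1) * fischer (z * dpow P (e + 1)) (dpow P (?d + 1))
      = of_int (e + 1) * (Y (?d + 1) * (\<kappa> * poly Q (of_int ?d + 1)))" .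
  moreover have "of_int (e + 1) \<noteq> (0 :: complex)"
    using step by (simp only: of_int_eq_0_iff)
  ultimately have "fischer (z * dpow P (e + 1)) (dpow P (?d + 1))
      = Y (?d + 1) * (\<kappa> * poly Q (of_int (?d + 1)))"
    by simp
  moreover have "e + 1 + int l = ?d + 1" by simp
  ultimately show ?case by (simp only:)
qed

text \<open>
  All pairings of the family with the exponential, multiplied by a fixed polynomial and shifted by
  a fixed amount, equal \<open>Y (d + k)\<close> up to a factor that is polynomial in \<open>d\<close>. Large \<open>d\<close> suffice,
  since polynomials are determined by them; allowing every \<open>z\<close> and \<open>l\<close> makes the notion stable
  under adjoints of variables and derivatives.
\<close>

definition tame :: "int \<Rightarrow> (int \<Rightarrow> 'w mpol) \<Rightarrow> bool" where
  "tame k U \<longleftrightarrow> (\<forall>z l. \<exists>R D. \<forall>d\<ge>D. fischer (z * dpow P (d - l)) (U d) = Y (d + k) * poly R (of_int d))"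

lemma tameI:
  assumes "\<And>z l. \<exists>R D. \<forall>d\<ge>D. fischer (z * dpow P (d - l)) (U d) = Y (d + k) * poly R (of_int d)"
  shows "tame k U"
  using assms unfolding tame_def by blast

lemma tameD:
  assumes "tame k U"
  obtains R D where "\<And>d. d \<ge> D \<Longrightarrow> fischer (z * dpow P (d - l)) (U d) = Y (d + k) * poly R (of_int d)"
  using assms unfolding tame_def by meson

lemma tame_dpow: "tame 0 (dpow P)"
proof (rule tameI)
  fix z and l :: int
  show "\<exists>R D. \<forall>d\<ge>D. fischer (z * dpow P (d - l)) (dpow P d) = Y (d + 0) * poly R (of_int d)"
  proof (cases "l < 0")
    case True
    then have "fischer (z * dpow P (d - l)) (dpow P d) = 0" if "d \<ge> 0" for d
      using fischer_dpow_higher[of "- l" d z] that by simp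
    then show ?thesis by (intro exI[of _ 0]) auto
  next
    case False
    then obtain l' where l: "l = int l'" using nonneg_int_cases by (metis not_less)
    show ?thesis
    proof (intro exI allI impI)
      fix d assume "d \<ge> l"
      then show "fischer (z * dpow P (d - l)) (dpow P d) = Y (d + 0) * poly
          (smult (fischer z (dpow P (int l')) / (Y (int l') * poly (\<Prod>i<l'. [:- of_nat i, 1:]) (of_nat l')))
            (\<Prod>i<l'. [:- of_nat i, 1:])) (of_int d)"
        using fischer_dpow_lower[of "d - l" z l'] by (simp add: l)
    qed
  qed
qed

lemma tame_zero: "tame k (\<lambda>d. 0)"
  by (rule tameI) (auto intro!: exI[of _ 0])

lemma tame_add:
  assumes "tame k U" "tame k W"
  shows "tame k (\<lambda>d. U d + W d)"
proof (rule tameI)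
  fix z l
  obtain R D where R: "\<And>d. d \<ge> D \<Longrightarrow> fischer (z * dpow P (d - l)) (U d) = Y (d + k) * poly R (of_int d)"
    using assms(1) unfolding tame_def by meson
  obtain R' D' where R': "\<And>d. d \<ge> D' \<Longrightarrow> fischer (z * dpow P (d - l)) (W d) = Y (d + k) * poly R' (of_int d)"
    using assms(2) unfolding tame_def by meson
  show "\<exists>R D. \<forall>d\<ge>D. fischer (z * dpow P (d - l)) (U d + W d) = Y (d + k) * poly R (of_int d)"
    by (intro exI[of _ "R + R'"] exI[of _ "max D D'"]) (simp add: fischer_add_right R R' distrib_left)
qed

lemma tame_cst:
  assumes "tame k U"
  shows "tame k (\<lambda>d. cst c * U d)"
proof (rule tameI)
  fix z l
  obtain R D where R: "\<And>d. d \<ge> D \<Longrightarrow> fischer (z * dpow P (d - l)) (U d) = Y (d + k) * poly R (of_int d)"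
    using assms unfolding tame_def by meson
  show "\<exists>R D. \<forall>d\<ge>D. fischer (z * dpow P (d - l)) (cst c * U d) = Y (d + k) * poly R (of_int d)"
    by (intro exI[of _ "smult c R"] exI[of _ D]) (simp add: fischer_cst_right R)
qed

lemma tame_mpderiv:
  assumes "tame k U"
  shows "tame k (\<lambda>d. mpderiv v (U d))"
proof (rule tameI)
  fix z l
  show "\<exists>R D. \<forall>d\<ge>D. fischer (z * dpow P (d - l)) (mpderiv v (U d)) = Y (d + k) * poly R (of_int d)"
    using tameD[OF assms, of "mvar v * z" l] by (metis fischer_mvar_left mult.assoc)
qed

lemma tame_mvar:
  assumes "tame k U"
  shows "tame k (\<lambda>d. mvar v * U d)"
proof (rule tameI)
  fix z l
  obtain R D where R: "\<And>d. d \<ge> D \<Longrightarrow> fischer (mpderiv v z * dpow P (d - l)) (U d) = Y (d + k) * poly R (of_int d)"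
    using assms unfolding tame_def by meson
  obtain R' D' where R': "\<And>d. d \<ge> D' \<Longrightarrow> fischer ((z * mpderiv v P) * dpow P (d - (l + 1))) (U d) = Y (d + k) * poly R' (of_int d)"
    using assms unfolding tame_def by meson
  have "fischer (z * dpow P (d - l)) (mvar v * U d)
      = fischer (mpderiv v z * dpow P (d - l)) (U d) + fischer ((z * mpderiv v P) * dpow P (d - (l + 1))) (U d)" for d
    by (simp add: fischer_mvar_right mpderiv_mult mpderiv_dpow fischer_add_left mult.assoc diff_diff_add)
  then show "\<exists>R D. \<forall>d\<ge>D. fischer (z * dpow P (d - l)) (mvar v * U d) = Y (d + k) * poly R (of_int d)"
    by (intro exI[of _ "R + R'"] exI[of _ "max D D'"]) (simp add: R R' distrib_left)
qed

lemma tame_shift: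
  assumes "tame k U"
  shows "tame (k + i) (\<lambda>d. U (d + i))"
proof (rule tameI)
  fix z l
  obtain R D where R: "\<And>d. d \<ge> D \<Longrightarrow> fischer (z * dpow P (d - (l + i))) (U d) = Y (d + k) * poly R (of_int d)"
    using assms unfolding tame_def by meson
  have "fischer (z * dpow P (d - l)) (U (d + i)) = Y (d + (k + i)) * poly (R \<circ>\<^sub>p [:of_int i, 1:]) (of_int d)"
    if "d \<ge> D - i" for d
    using R[of "d + i"] that by (simp add: poly_pcompose add_ac)
  then show "\<exists>R D. \<forall>d\<ge>D. fischer (z * dpow P (d - l)) (U (d + i)) = Y (d + (k + i)) * poly R (of_int d)"
    by blast
qed

text \<open>
  Pairing with the exponential itself gives \<open>b'(d) Y d = R(d) Y (d + 1)\<close>, and \<open>Y\<close> cancels by its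
  recursion.
\<close>

lemma tame_dpow_dvd:
  assumes "tame 1 (\<lambda>d. cst (poly b' (of_int d)) * dpow P d)"
  shows "b dvd [:1, 1:] * b'"
proof -
  obtain R D where R: "\<And>d. d \<ge> D \<Longrightarrow> fischer (1 * dpow P (d - 0)) (cst (poly b' (of_int d)) * dpow P d)
      = Y (d + 1) * poly R (of_int d)"
    using assms unfolding tame_def by meson
  have eq: "poly ([:1, 1:] * b') (of_int d) = poly (b * R) (of_int d)" if "d \<ge> max D 0" for d
  proof -
    have "of_int (d + 1) * (poly b' (of_int d) * Y d) = of_int (d + 1) * (Y (d + 1) * poly R (of_int d))"
      using R[of d] that by (simp add: fischer_cst_right Y_def)
    also have "\<dots> = (of_int (d + 1) * Y (d + 1)) * poly R (of_int d)" by (simp only: mult.assoc)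
    also have "\<dots> = poly b (of_int d) * Y d * poly R (of_int d)" by (simp only: Y_recursion)
    finally have "Y d * (of_int (d + 1) * poly b' (of_int d)) = Y d * (poly b (of_int d) * poly R (of_int d))"
      by (simp only: mult_ac)
    then have "of_int (d + 1) * poly b' (of_int d) = poly b (of_int d) * poly R (of_int d)"
      using Y_nz[of d] that by simp
    then show ?thesis by (simp add: algebra_simps)
  qed
  have "infinite {x. poly ([:1, 1:] * b' - b * R) x = 0}"
  proof
    assume "finite {x. poly ([:1, 1:] * b' - b * R) x = 0}"
    moreover have "of_int ` {max D 0..} \<subseteq> {x :: complex. poly ([:1, 1:] * b' - b * R) x = 0}"
      using eq by (auto simp: algebra_simps)
    ultimately have "finite (of_int ` {max D 0..} :: complex set)" by (rule finite_subset[rotated])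
    then have "finite {max D 0..}" by (rule finite_imageD) (auto intro: inj_onI)
    then show False by (simp add: infinite_Ici)
  qed
  then have "[:1, 1:] * b' = b * R"
    using poly_roots_finite by (metis right_minus_eq)
  then show ?thesis by simp
qed

end

lemma vfil_tame:
  assumes "cayley_phase (phase r f) b"
  shows "vfil V r f k U \<Longrightarrow> cayley_phase.tame (phase r f) k U"
proof -
  interpret cayley_phase "phase r f" b by fact
  have xe: "tame k (\<lambda>d. xe a * U d)" if "tame k U" for a k U
    using that
  proof (induction a arbitrary: U rule: mpol_induct)
    case (var_mult v p)
    then show ?case
      using tame_mvar[of k "\<lambda>d. xe p * U d" "Inl v"] by (simp add: mult.assoc)
  qed (simp_all add: tame_cst tame_add distrib_right)
  show "vfil V r f k U \<Longrightarrow> tame k U"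
  proof (induction rule: vfil.induct)
    case (tau j k U)
    then have "tame (k - 1) (\<lambda>d. U (d - 1))" using tame_shift[of k U "-1"] by simp
    then show ?case by (rule tame_mvar)
  next
    case (dtau j k U)
    then show ?case by (intro tame_mpderiv tame_shift)
  qed (auto intro: tame_dpow tame_zero tame_add xe tame_mpderiv)
qed

section \<open>Collecting the auxiliary variables\<close>

lemma emb_conv: "emb p = cst (to_fract p)"
  by (simp add: emb_def scoeff_def to_fract_def)

lemma emb_simps [simp]:
  "emb 0 = 0" "emb 1 = 1" "emb (p + q) = emb p + emb q" "emb (p * q) = emb p * emb q"
  by (simp_all add: emb_conv cst_add cst_mult)

lemma fderiv_to_fract: "fderiv v (to_fract a) = to_fract (mpderiv v a)"
  by (simp add: to_fract_def fderiv_Fract)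

lemma fderiv_add: "fderiv v (x + y) = fderiv v x + fderiv v y"
proof (cases x; cases y)
  fix a b c d assume x: "x = Fract a b" "b \<noteq> 0" and y: "y = Fract c d" "d \<noteq> 0"
  then show ?thesis
    by (simp add: fderiv_Fract mpderiv_add mpderiv_mult eq_fract algebra_simps)
qed

lemma fderiv_mult: "fderiv v (x * y) = fderiv v x * y + x * fderiv v y"
proof (cases x; cases y)
  fix a b c d assume x: "x = Fract a b" "b \<noteq> 0" and y: "y = Fract c d" "d \<noteq> 0"
  then show ?thesis
    by (simp add: fderiv_Fract mpderiv_add mpderiv_mult eq_fract algebra_simps)
qed

lemma fderiv_1 [simp]: "fderiv v 1 = 0"
  using fderiv_to_fract[of v 1] by simp

lemma fderiv_of_nat [simp]: "fderiv v (of_nat n) = 0"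
  by (induction n) (simp_all add: fderiv_add)

lemma of_nat_fract_nz: "n \<noteq> 0 \<Longrightarrow> of_nat n \<noteq> (0 :: 'v::linorder mpol fract)"
  by (simp add: of_nat_fract to_fract_def[symmetric])

lemma fderiv_inverse_of_nat [simp]:
  fixes v :: "'v::linorder"
  shows "fderiv v (inverse (of_nat n)) = 0"
proof (cases "n = 0")
  case False
  note nz = of_nat_fract_nz[where 'v = 'v, OF False]
  have "fderiv v (inverse (of_nat n) * of_nat n) = 0" by (simp only: left_inverse[OF nz] fderiv_1)
  then have "fderiv v (inverse (of_nat n)) * of_nat n = 0"
    by (simp only: fderiv_mult fderiv_of_nat mult_zero_right add_0_right)
  then show ?thesis using nz by simp
qed simp

lemma fderiv_prod_power:
  fixes f :: "nat \<Rightarrow> 'v::linorder mpol"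
  assumes "finite J" "\<And>j. j \<in> J \<Longrightarrow> f j \<noteq> 0"
  shows "fderiv v (\<Prod>j\<in>J. to_fract (f j) ^ e j)
    = (\<Prod>j\<in>J. to_fract (f j) ^ e j) * (\<Sum>j\<in>J. of_nat (e j) * Fract (mpderiv v (f j)) (f j))"
proof -
  have pow: "fderiv v (to_fract p ^ n) = to_fract p ^ n * (of_nat n * Fract (mpderiv v p) p)"
    if "p \<noteq> 0" for p :: "'v mpol" and n
  proof (induction n)
    case (Suc n)
    have "to_fract p * Fract (mpderiv v p) p = to_fract (mpderiv v p)"
      using that by (simp add: to_fract_def eq_fract)
    then show ?case by (simp add: fderiv_mult fderiv_to_fract Suc algebra_simps)
  qed simp
  show ?thesis
    using assms by (induction J rule: finite_induct) (simp_all add: fderiv_mult pow algebra_simps)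
qed

text \<open>
  Polynomials in both kinds of variables become polynomials in the auxiliary ones, with fractions
  as coefficients. The target reuses the type of polynomials in the exponents \<open>s j\<close>, with
  \<open>svar j\<close> in the role of the auxiliary variable \<open>Inr j\<close>.
\<close>

definition theta :: "('v::linorder + nat) mpol \<Rightarrow> 'v spoly" where
  "theta = peval (\<lambda>c. emb (cst c)) (case_sum (\<lambda>v. emb (mvar v)) svar)"

interpretation emb_cst: coeff_hom "\<lambda>c. emb (cst c :: 'v::linorder mpol)"
  by unfold_locales (simp_all add: cst_add cst_mult)

lemma theta_mvar: "theta (mvar w) = (case w of Inl v \<Rightarrow> emb (mvar v) | Inr j \<Rightarrow> svar j)"
  unfolding theta_def mvar_def by (subst emb_cst.peval_var) simp

lemma theta_simps [simp]:
  "theta 0 = 0" "theta 1 = 1" "theta (p + q) = theta p + theta q" "theta (p * q) = theta p * theta q"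
  "theta (cst c) = emb (cst c)" "theta (tv j) = svar j" "theta (mvar (Inl v)) = emb (mvar v)"
  by (simp_all add: theta_mvar) (simp_all add: theta_def emb_cst.peval_simps)

lemma theta_sum [simp]: "theta (sum h A) = (\<Sum>i\<in>A. theta (h i))"
  by (simp add: theta_def emb_cst.peval_simps)

lemma theta_xe [simp]: "theta (xe a) = emb a"
  by (induction a rule: mpol_induct) simp_all

lemma lookup_cst_mult: "lookup (cst c * q) m = c * lookup q (m :: 'a \<Rightarrow>\<^sub>0 nat)"
  for q :: "('a \<Rightarrow>\<^sub>0 nat) \<Rightarrow>\<^sub>0 'c::comm_ring_1"
  by (rule additive_eqI[of "\<lambda>q. lookup (cst c * q) m" "\<lambda>q. c * lookup q m"])
    (simp_all add: algebra_simps lookup_add mult_single lookup_single when_def)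

lemma lookup_var_mult:
  fixes q :: "('a \<Rightarrow>\<^sub>0 nat) \<Rightarrow>\<^sub>0 'c::comm_ring_1"
  shows "lookup (single (single j 1) 1 * q) m =
    (if lookup m j = 0 then 0 else lookup q (m - single j 1))"
proof (rule additive_eqI[of "\<lambda>q. lookup (single (single j 1) 1 * q) m"
      "\<lambda>q. if lookup m j = 0 then 0 else lookup q (m - single j 1)"])
  fix k :: "'a \<Rightarrow>\<^sub>0 nat" and c :: 'c
  show "lookup (single (single j 1) 1 * single k c) m =
    (if lookup m j = 0 then 0 else lookup (single k c) (m - single j 1))"
  proof (cases "lookup m j = 0")
    case True
    then have "single j 1 + k \<noteq> m"
      by (metis lookup_add lookup_single_eq add_is_0 one_neq_zero)
    then show ?thesis using True by (simp add: mult_single lookup_single)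
  next
    case False
    have "single j 1 + k = m \<longleftrightarrow> k = m - single j 1"
      using monomial_decomp[OF False] by (metis add_left_cancel)
    then show ?thesis using False by (auto simp: mult_single lookup_single when_def)
  qed
qed (simp_all add: algebra_simps lookup_add)

lemma lookup_svar_mult:
  "lookup (svar j * q) m =
    (if lookup m j = 0 then 0 else lookup q (m - single j 1))"
  unfolding svar_def by (rule lookup_var_mult)

lemma lookup_theta_mpderiv:
  "lookup (theta (mpderiv (Inl v) p)) m = fderiv v (lookup (theta p) m)"
proof (induction p arbitrary: m rule: mpol_induct)
  case (const c)
  show ?case
    by (simp add: emb_conv lookup_single when_def fderiv_to_fract)
next
  case (var_mult w p)
  show ?case
  proof (cases w)
    case (Inl u)
    then show ?thesis
      by (simp add: mpderiv_mult mpderiv_mvar emb_conv lookup_add lookup_cst_mult fderiv_mult fderiv_to_fract var_mult)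
  next
    case (Inr j)
    then show ?thesis
      by (simp add: mpderiv_mult lookup_svar_mult var_mult)
  qed
qed (simp_all add: mpderiv_add lookup_add fderiv_add)

lemma lookup_theta_euler:
  "lookup (theta (tv j * mpderiv (Inr j) p)) m
     = of_nat (lookup m j) * lookup (theta p) m"
proof (induction p arbitrary: m rule: mpol_induct)
  case (const c)
  show ?case
    by (simp add: emb_conv lookup_single when_def)
next
  case (var_mult w p)
  show ?case
  proof (cases w)
    case (Inl u)
    have "theta (tv j * mpderiv (Inr j) (mvar w * p)) = emb (mvar u) * theta (tv j * mpderiv (Inr j) p)"
      by (simp add: Inl mpderiv_mult mpderiv_mvar mult_ac)
    then show ?thesis
      by (simp only: emb_conv lookup_cst_mult var_mult) (simp add: Inl emb_conv lookup_cst_mult)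
  next
    case (Inr i)
    define E where "E = theta (tv j * mpderiv (Inr j) p)"
    have E: "lookup E m = of_nat (lookup m j) * lookup (theta p) m" for m
      unfolding E_def by (rule var_mult)
    have "theta (tv j * mpderiv (Inr j) (mvar w * p)) = (if i = j then svar j * theta p else 0) + svar i * E"
      by (simp add: E_def Inr mpderiv_mult mpderiv_mvar algebra_simps)
    then have "lookup (theta (tv j * mpderiv (Inr j) (mvar w * p))) m
        = (if i = j \<and> lookup m i \<noteq> 0 then lookup (theta p) (m - single i 1) else 0)
          + (if lookup m i = 0 then 0 else
              of_nat (lookup (m - single i 1) j) * lookup (theta p) (m - single i 1))"
      by (simp add: lookup_add lookup_svar_mult E)
    moreover have "theta (mvar w * p) = svar i * theta p" by (simp add: Inr)
    ultimately show ?thesis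
      by (simp only: lookup_svar_mult)
        (cases "i = j"; cases "lookup m i"; simp add: lookup_minus lookup_single when_def algebra_simps)
  qed
qed (simp_all add: mpderiv_add lookup_add algebra_simps)

text \<open>
  Grouping the auxiliary variables first factors \<open>theta\<close> through polynomials over polynomials,
  where collecting variables is invertible.
\<close>

lemma theta_eq_iff: "theta p = theta q \<longleftrightarrow> p = (q :: ('v::linorder + nat) mpol)"
proof
  let ?h = "\<lambda>c. cst (cst c) :: (nat \<Rightarrow>\<^sub>0 nat) \<Rightarrow>\<^sub>0 'v mpol"
  interpret H: coeff_hom ?h by unfold_locales (simp_all add: cst_add cst_mult)
  interpret X: coeff_hom "xe :: 'v mpol \<Rightarrow> _" by unfold_locales simp_all
  define t where "t = peval ?h (case_sum (\<lambda>v. cst (mvar v)) (\<lambda>j. single (single j 1) 1))"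
  have t: "t (p + q) = t p + t q" "t (p * q) = t p * t q" "t (cst c) = cst (cst c)"
    "t (mvar (Inl v)) = cst (mvar v)" "t (tv j) = single (single j 1) 1" for p q c v j
    unfolding t_def mvar_def H.peval_var by (simp_all add: H.peval_simps)
  have inv: "peval xe tv (t p) = p" for p
  proof (induction p rule: mpol_induct)
    case (var_mult w p)
    have "peval xe tv (t (mvar w)) = mvar w"
      by (cases w) (simp_all add: t X.peval_cst X.peval_var[unfolded One_nat_def])
    then show ?case using var_mult by (simp add: t X.peval_mult)
  qed (simp_all add: t X.peval_add X.peval_cst)
  have "lookup (theta p) m = to_fract (lookup (t p) m)" for p m
  proof (induction p arbitrary: m rule: mpol_induct)
    case (const c)
    then show ?case by (simp add: t emb_conv lookup_single when_def)
  next
    case (add p q)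
    then show ?case by (simp add: t lookup_add)
  next
    case (var_mult w p)
    then show ?case
      by (cases w) (simp_all add: t emb_conv lookup_cst_mult lookup_svar_mult lookup_var_mult[unfolded One_nat_def])
  qed
  moreover assume "theta p = theta q"
  ultimately have "t p = t q" by (intro poly_mapping_eqI) (metis to_fract_eq_iff)
  then show "p = q" using inv by metis
qed simp

lemma to_fract_of_nat: "to_fract (of_nat n) = of_nat n"
  by (induction n) simp_all

lemma to_fract_prod: "to_fract (prod h A) = (\<Prod>i\<in>A. to_fract (h i))"
  by (induction A rule: infinite_finite_induct) simp_all

lemma to_fract_power: "to_fract (p ^ n) = to_fract p ^ n"
  by (induction n) simp_all

section \<open>Evaluation of the exponents at natural numbers\<close>

interpretation idhom: coeff_hom "\<lambda>x :: 'c::comm_ring_1. x"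
  by unfold_locales simp_all

definition sval :: "(nat \<Rightarrow>\<^sub>0 nat) \<Rightarrow> 'v::linorder spoly \<Rightarrow> 'v mpol fract" where
  "sval m = peval (\<lambda>x. x) (\<lambda>j. of_nat (lookup m j))"

lemma sval_simps [simp]:
  "sval m 0 = 0" "sval m 1 = 1" "sval m (u + w) = sval m u + sval m w" "sval m (u * w) = sval m u * sval m w"
  "sval m (u - w) = sval m u - sval m w"
  "sval m (cst x) = x" "sval m (of_nat n) = of_nat n" "sval m (sum h A) = (\<Sum>i\<in>A. sval m (h i))"
  "sval m (prod h A) = (\<Prod>i\<in>A. sval m (h i))" "sval m (u ^ n) = sval m u ^ n"
  by (simp_all add: sval_def idhom.peval_simps)

lemma sval_svar [simp]: "sval m (svar j) = of_nat (lookup m j)"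
  unfolding sval_def svar_def by (rule idhom.peval_var)

lemma sval_emb [simp]: "sval m (emb a) = to_fract a"
  by (simp add: emb_conv)

lemma lookup_map_fderiv: "lookup (Poly_Mapping.map (fderiv v) u) m = fderiv v (lookup u m)"
  by (simp add: Poly_Mapping.map.rep_eq when_def)

lemma sval_map_fderiv: "sval m (Poly_Mapping.map (fderiv v) u) = fderiv v (sval m u)"
proof (rule additive_eqI[of "\<lambda>u. sval m (Poly_Mapping.map (fderiv v) u)" "\<lambda>u. fderiv v (sval m u)"])
  fix p q :: "'a spoly"
  have "Poly_Mapping.map (fderiv v) (p + q) = Poly_Mapping.map (fderiv v) p + Poly_Mapping.map (fderiv v) q"
    by (rule poly_mapping_eqI) (simp only: lookup_map_fderiv lookup_add fderiv_add)
  then show "sval m (Poly_Mapping.map (fderiv v) (p + q))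
      = sval m (Poly_Mapping.map (fderiv v) p) + sval m (Poly_Mapping.map (fderiv v) q)"
    by simp
next
  fix k :: "nat \<Rightarrow>\<^sub>0 nat" and c :: "'a mpol fract"
  have "meval (\<lambda>j. of_nat (lookup m j)) k
      = (of_nat (\<Prod>j\<in>keys k. lookup m j ^ lookup k j) :: 'a mpol fract)"
    by (simp add: meval_def)
  then show "sval m (Poly_Mapping.map (fderiv v) (single k c)) = fderiv v (sval m (single k c))"
    unfolding sval_def by (simp add: idhom.peval_single fderiv_mult del: of_nat_prod)
qed (simp_all add: fderiv_add)

lemma sval_add_single:
  assumes "lookup m j = 0"
  shows "meval (\<lambda>i. of_nat (lookup (m + single j t) i)) k
    = of_nat t ^ lookup k j *
      (meval (\<lambda>i. of_nat (lookup m i)) (k - single j (lookup k j)) :: 'r::comm_ring_1)"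
proof -
  let ?e = "single j (lookup k j)"
  have k: "k = ?e + (k - ?e)"
    by (rule poly_mapping_eqI) (auto simp: lookup_add lookup_minus lookup_single when_def)
  have "meval (\<lambda>i. of_nat (lookup (m + single j t) i)) k
      = meval (\<lambda>i. of_nat (lookup (m + single j t) i)) ?e *
        (meval (\<lambda>i. of_nat (lookup (m + single j t) i)) (k - ?e) :: 'r)"
    by (subst k) (rule meval_add)
  also have "meval (\<lambda>i. of_nat (lookup (m + single j t) i)) (k - ?e)
      = (meval (\<lambda>i. of_nat (lookup m i)) (k - ?e) :: 'r)"
    unfolding meval_def
    by (intro prod.cong refl) (auto simp: lookup_add lookup_single when_def lookup_minus in_keys_iff split: if_splits)
  finally show ?thesis using assms by (simp add: lookup_add)
qed

text \<open>
  In the induction step, the values of \<open>u\<close> on a line parallel to one axis are those of a univariate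
  polynomial with infinitely many zeros. So the coefficient of each power of that variable
  vanishes at all natural points of the other axes, and is \<open>0\<close> by induction.
\<close>

lemma spoly_eq_0I:
  fixes u :: "'v::linorder spoly"
  assumes "finite J" "\<And>k. lookup u k \<noteq> 0 \<Longrightarrow> keys k \<subseteq> J"
    and "\<And>m. keys m \<subseteq> J \<Longrightarrow> sval m u = 0"
  shows "u = 0"
  using assms
proof (induction J arbitrary: u rule: finite_induct)
  case empty
  have "u = cst (lookup u 0)"
    by (rule poly_mapping_eqI) (use empty(1) in \<open>force simp: lookup_single when_def\<close>)
  moreover have "sval 0 u = 0" by (rule empty(2)) simp
  ultimately show ?case by (metis sval_simps(6) single_zero)
next
  case (insert j J)
  let ?K = "\<lambda>i. {k \<in> keys u. lookup k j = i}"
  define c where "c = (\<lambda>i. \<Sum>k\<in>?K i. single (k - single j i) (lookup u k))"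
  have lc: "lookup (c i) k' = (\<Sum>k\<in>?K i. if k - single j i = k' then lookup u k else 0)" for i k'
    by (simp add: c_def lookup_sum lookup_single when_def)
  have c0: "c i = 0" for i
  proof (rule insert.IH)
    fix k' assume "lookup (c i) k' \<noteq> 0"
    then obtain k where "k \<in> ?K i"
      and "(if k - single j i = k' then lookup u k else 0) \<noteq> 0"
      unfolding lc by (rule sum.not_neutral_contains_not_neutral)
    then have k: "k \<in> ?K i" "k' = k - single j i" by (auto split: if_splits)
    have sub: "keys k \<subseteq> insert j J"
      using k by (intro insert.prems(1)) (simp add: in_keys_iff)
    show "keys k' \<subseteq> J"
    proof
      fix i assume i: "i \<in> keys k'"
      then have "lookup k i - lookup (single j (lookup k j)) i \<noteq> 0"
        using k by (simp add: in_keys_iff lookup_minus)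
      then have "i \<noteq> j" "i \<in> keys k" by (auto simp: in_keys_iff)
      then show "i \<in> J" using sub by blast
    qed
  next
    fix m :: "nat \<Rightarrow>\<^sub>0 nat" assume m: "keys m \<subseteq> J"
    then have mj: "lookup m j = 0" using insert.hyps by (auto simp: in_keys_iff)
    define x where "x = (\<lambda>i. of_nat (lookup m i) :: 'v mpol fract)"
    define p where "p = (\<Sum>k\<in>keys u. monom (lookup u k *
        meval x (k - single j (lookup k j))) (lookup k j))"
    have "poly p (of_nat t) = 0" for t
    proof -
      have "sval (m + single j t) u = poly p (of_nat t)"
        unfolding sval_def peval_def p_def poly_sum poly_monom x_def
        by (intro sum.cong refl) (simp only: sval_add_single[OF mj] mult_ac)
      moreover have "keys (m + single j t) \<subseteq> insert j J"
        using m keys_add[of m "single j t"] by (auto split: if_splits)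
      ultimately show ?thesis using insert.prems(2) by simp
    qed
    then have "range of_nat \<subseteq> {x. poly p x = 0}" by auto
    moreover have "infinite (range (of_nat :: nat \<Rightarrow> 'v mpol fract))"
    proof (rule range_inj_infinite)
      show "inj (of_nat :: nat \<Rightarrow> 'v mpol fract)"
        by (rule injI) (metis of_nat_fract to_fract_def to_fract_eq_iff of_nat_eq_iff)
    qed
    ultimately have "p = 0" using poly_roots_finite finite_subset by metis
    then have "coeff p i = 0" by simp
    moreover have "coeff p i = (\<Sum>k\<in>?K i. lookup u k * meval x (k - single j i))"
    proof -
      have "coeff p i = (\<Sum>k\<in>keys u. if lookup k j = i
          then lookup u k * meval x (k - single j i) else 0)"
        unfolding p_def coeff_sum by (intro sum.cong refl) simp
      then show ?thesis by (simp add: sum.inter_filter)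
    qed
    moreover have "sval m (c i) = (\<Sum>k\<in>?K i. lookup u k * meval x (k - single j i))"
      unfolding c_def sval_def x_def by (simp only: idhom.peval_sum idhom.peval_single)
    ultimately show "sval m (c i) = 0" by simp
  qed
  show ?case
  proof (rule poly_mapping_eqI)
    fix k :: "nat \<Rightarrow>\<^sub>0 nat"
    let ?i = "lookup k j"
    have inj: "k' = k" if "lookup k' j = ?i" "k' - single j ?i = k - single j ?i" for k' :: "nat \<Rightarrow>\<^sub>0 nat"
    proof (rule poly_mapping_eqI)
      fix i
      show "lookup k' i = lookup k i"
        using that(1) arg_cong[OF that(2), of "\<lambda>q. lookup q i"]
        by (cases "i = j") (simp_all add: lookup_minus lookup_single)
    qed
    have "0 = lookup (c ?i) (k - single j ?i)" by (simp add: c0)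
    also have "\<dots> = (\<Sum>k'\<in>?K ?i. if k' = k then lookup u k' else 0)"
      unfolding lc by (intro sum.cong refl if_cong) (auto dest: inj)
    also have "\<dots> = lookup u k"
      by (auto simp: in_keys_iff)
    finally show "lookup u k = lookup 0 k" by simp
  qed
qed

lemma exponent_induct:
  fixes \<mu> :: "nat \<Rightarrow> nat"
  assumes zero: "\<And>\<mu>. (\<And>j. j \<in> {1..r} \<Longrightarrow> \<mu> j = 0) \<Longrightarrow> Q \<mu>"
    and step: "\<And>\<mu> j. j \<in> {1..r} \<Longrightarrow> Q \<mu> \<Longrightarrow> Q (\<mu>(j := Suc (\<mu> j)))"
  shows "Q \<mu>"
proof (induction "\<Sum>j=1..r. \<mu> j" arbitrary: \<mu>)
  case 0
  then show ?case by (intro zero) auto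
next
  case (Suc n)
  then obtain j where j: "j \<in> {1..r}" "\<mu> j \<noteq> 0"
    by (metis sum.neutral nat.distinct(1))
  let ?\<nu> = "\<mu>(j := \<mu> j - 1)"
  have "(\<Sum>i=1..r. \<mu> i) = \<mu> j + (\<Sum>i\<in>{1..r}-{j}. \<mu> i)" "(\<Sum>i=1..r. ?\<nu> i) = \<mu> j - 1 + (\<Sum>i\<in>{1..r}-{j}. \<mu> i)"
    using j by (simp_all add: sum.remove[of _ j])
  then have "Q ?\<nu>" using Suc j by (intro Suc) simp
  then have "Q (?\<nu>(j := Suc (?\<nu> j)))" using j by (intro step)
  then show ?case using j by (simp add: fun_upd_idem)
qed

lemma prod_fun_upd:
  assumes "j \<in> {1..r::nat}"
  shows "(\<Prod>i=1..r. F i ((\<mu>(j := x)) i)) = F j x * (\<Prod>i\<in>{1..r}-{j}. F i (\<mu> i))"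
  using assms by (subst prod.remove[of _ j]) (auto intro!: prod.cong)

lemma sum_fun_upd:
  assumes "j \<in> {1..r::nat}"
  shows "(\<Sum>i=1..r. (\<mu>(j := x)) i) = x + (\<Sum>i\<in>{1..r}-{j}. \<mu> i)"
  using assms by (subst sum.remove[of _ j]) (auto intro!: sum.cong)

text \<open>
  The operator \<open>t\<^sup>\<mu> \<partial>\<^sub>t\<^sup>\<kappa>\<close> applied to the exponential of the phase.
\<close>

definition fam :: "nat \<Rightarrow> (nat \<Rightarrow> 'v mpol) \<Rightarrow> (nat \<Rightarrow> nat) \<Rightarrow> (nat \<Rightarrow> nat) \<Rightarrow> int \<Rightarrow> ('v + nat) mpol" where
  "fam r f \<mu> \<kappa> d = (\<Prod>j=1..r. tv j ^ \<mu> j) * xe (\<Prod>j=1..r. f j ^ \<kappa> j) * dpow (phase r f) (d - int (\<Sum>j=1..r. \<mu> j))"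

lemma fam_tau:
  fixes f :: "nat \<Rightarrow> 'v mpol"
  assumes "j \<in> {1..r}"
  shows "tv j * fam r f \<mu> \<kappa> (d - 1) = fam r f (\<mu>(j := Suc (\<mu> j))) \<kappa> d"
proof -
  have "(\<Prod>i=1..r. tv i ^ (\<mu>(j := Suc (\<mu> j))) i) = tv j * (\<Prod>i=1..r. tv i ^ \<mu> i :: ('v + nat) mpol)"
    using assms by (simp add: prod_fun_upd[of j r "\<lambda>i e. tv i ^ e"] prod.remove[of _ j] mult.assoc)
  moreover have "(\<Sum>i=1..r. (\<mu>(j := Suc (\<mu> j))) i) = Suc (\<Sum>i=1..r. \<mu> i)"
    using assms by (simp only: sum_fun_upd) (simp add: sum.remove[of _ j])
  ultimately show ?thesis
    by (simp add: fam_def mult.assoc diff_diff_add)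
qed

lemma fam_dtau:
  fixes f :: "nat \<Rightarrow> 'v mpol"
  assumes j: "j \<in> {1..r}"
  shows "mpderiv (Inr j) (fam r f \<mu> \<kappa> (d + 1)) =
    cst (of_nat (\<mu> j)) * fam r f (\<mu>(j := \<mu> j - 1)) \<kappa> d + fam r f \<mu> (\<kappa>(j := Suc (\<kappa> j))) d"
proof -
  let ?T = "\<lambda>\<mu>. \<Prod>i=1..r. tv i ^ \<mu> i :: ('v + nat) mpol"
  let ?s = "\<lambda>\<mu>. int (\<Sum>i=1..r. \<mu> i)"
  have dT: "mpderiv (Inr j) (?T \<mu>) = cst (of_nat (\<mu> j)) * ?T (\<mu>(j := \<mu> j - 1))"
  proof -
    have other: "mpderiv (Inr j) (\<Prod>i\<in>{1..r}-{j}. tv i ^ \<mu> i :: ('v + nat) mpol) = 0"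
    proof -
      have "mpderiv (Inr j) (\<Prod>i\<in>I. tv i ^ \<mu> i :: ('v + nat) mpol) = 0" if "finite I" "j \<notin> I" for I
        using that
      proof (induction I rule: finite_induct)
        case (insert i I)
        have "mpderiv (Inr j) (tv i ^ \<mu> i :: ('v + nat) mpol) = 0"
          using insert by (cases "\<mu> i") (simp_all add: mpderiv_power mpderiv_mvar del: power_Suc)
        then show ?case using insert by (simp add: mpderiv_mult)
      qed simp
      then show ?thesis by simp
    qed
    have "mpderiv (Inr j) (tv j ^ \<mu> j :: ('v + nat) mpol) = cst (of_nat (\<mu> j)) * tv j ^ (\<mu> j - 1)"
      by (cases "\<mu> j") (simp_all only: mpderiv_power mpderiv_mvar single_of_nat, simp_all)
    moreover have "?T \<mu> = tv j ^ \<mu> j * (\<Prod>i\<in>{1..r}-{j}. tv i ^ \<mu> i)"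
      using j by (simp add: prod.remove)
    ultimately show ?thesis
      using j other by (simp only: mpderiv_mult prod_fun_upd[of j r "\<lambda>i e. tv i ^ e"]) (simp add: mult.assoc)
  qed
  have F: "xe (\<Prod>i=1..r. f i ^ (\<kappa>(j := Suc (\<kappa> j))) i) = xe (f j) * xe (\<Prod>i=1..r. f i ^ \<kappa> i)"
    using j by (simp add: prod_fun_upd[of j r "\<lambda>i e. f i ^ e"] prod.remove[of _ j] mult.assoc)
  have s: "cst (of_nat (\<mu> j)) * dpow (phase r f) (d + 1 - ?s \<mu>)
      = cst (of_nat (\<mu> j)) * dpow (phase r f) (d - ?s (\<mu>(j := \<mu> j - 1)))"
  proof (cases "\<mu> j")
    case (Suc a)
    then have "?s \<mu> = ?s (\<mu>(j := \<mu> j - 1)) + 1"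
      using j by (simp only: sum_fun_upd) (simp add: sum.remove[of _ j])
    then show ?thesis by simp
  qed simp
  have "mpderiv (Inr j) (fam r f \<mu> \<kappa> (d + 1))
      = ?T (\<mu>(j := \<mu> j - 1)) * xe (\<Prod>i=1..r. f i ^ \<kappa> i) * (cst (of_nat (\<mu> j)) * dpow (phase r f) (d + 1 - ?s \<mu>))
        + ?T \<mu> * xe (\<Prod>i=1..r. f i ^ \<kappa> i) * (xe (f j) * dpow (phase r f) (d + 1 - ?s \<mu> - 1))"
    using j by (simp only: fam_def mpderiv_mult mpderiv_Inr_xe mpderiv_dpow mpderiv_Inr_phase dT)
      (simp only: mult_zero_left mult_zero_right add_0_right, simp only: mult_ac)
  also have "d + 1 - ?s \<mu> - 1 = d - ?s \<mu>" by simp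
  finally show ?thesis
    unfolding s fam_def F by (simp only: mult_ac)
qed

lemma vfil_fam: "vfil V r f (int (\<Sum>j=1..r. \<kappa> j) - int (\<Sum>j=1..r. \<mu> j)) (fam r f \<mu> \<kappa>)"
proof (induction \<mu> rule: exponent_induct[where r = r])
  case (1 \<mu>)
  show ?case
  proof (induction \<kappa> rule: exponent_induct[where r = r])
    case (1 \<kappa>)
    have "fam r f \<mu> \<kappa> = dpow (phase r f)"
      using 1 \<open>\<And>j. j \<in> {1..r} \<Longrightarrow> \<mu> j = 0\<close> by (simp add: fam_def fun_eq_iff)
    then show ?case
      using 1 \<open>\<And>j. j \<in> {1..r} \<Longrightarrow> \<mu> j = 0\<close> vfil.base[of V r f] by simp
  next
    case (2 \<kappa> j)
    have "fam r f \<mu> (\<kappa>(j := Suc (\<kappa> j))) = (\<lambda>d. mpderiv (Inr j) (fam r f \<mu> \<kappa> (d + 1)))"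
      using 1[OF 2(1)] by (simp add: fun_eq_iff fam_dtau[OF 2(1)])
    moreover have "int (\<Sum>i=1..r. (\<kappa>(j := Suc (\<kappa> j))) i) = int (\<Sum>i=1..r. \<kappa> i) + 1"
      using 2 by (simp only: sum_fun_upd) (simp add: sum.remove[of _ j])
    ultimately show ?case
      using vfil.dtau[OF 2] by (simp only: diff_add_eq)
  qed
next
  case (2 \<mu> j)
  have "fam r f (\<mu>(j := Suc (\<mu> j))) \<kappa> = (\<lambda>d. tv j * fam r f \<mu> \<kappa> (d - 1))"
    by (simp add: fun_eq_iff fam_tau[OF 2(1)])
  moreover have "int (\<Sum>i=1..r. (\<mu>(j := Suc (\<mu> j))) i) = int (\<Sum>i=1..r. \<mu> i) + 1"
    using 2 by (simp only: sum_fun_upd) (simp add: sum.remove[of _ j])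
  ultimately show ?case
    using vfil.tau[OF 2] by (simp only: diff_diff_add)
qed

text \<open>
  The two kinds of operators commute, so those in the auxiliary variables can be applied first.
  In this normal form the elements of the V-filtration can be read as operators from
  \<open>weyl_ops\<close> applied to shifted powers of the generators.
\<close>

inductive vfil_normal :: "'v set \<Rightarrow> nat \<Rightarrow> (nat \<Rightarrow> 'v mpol) \<Rightarrow> int \<Rightarrow> (int \<Rightarrow> ('v + nat) mpol) \<Rightarrow> bool"
  for V :: "'v set" and r :: nat and f :: "nat \<Rightarrow> 'v mpol" where
  base: "k = int (\<Sum>j=1..r. \<kappa> j) - int (\<Sum>j=1..r. \<mu> j) \<Longrightarrow> vfil_normal V r f k (fam r f \<mu> \<kappa>)"
| zero: "vfil_normal V r f k (\<lambda>d. 0)"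
| add: "vfil_normal V r f k U \<Longrightarrow> vfil_normal V r f k W \<Longrightarrow> vfil_normal V r f k (\<lambda>d. U d + W d)"
| mult: "a \<in> poly_ring V \<Longrightarrow> vfil_normal V r f k U \<Longrightarrow> vfil_normal V r f k (\<lambda>d. xe a * U d)"
| deriv: "v \<in> V \<Longrightarrow> vfil_normal V r f k U \<Longrightarrow> vfil_normal V r f k (\<lambda>d. mpderiv (Inl v) (U d))"

lemma vfil_normal_tau:
  assumes j: "j \<in> {1..r}"
  shows "vfil_normal V r f k U \<Longrightarrow> vfil_normal V r f (k - 1) (\<lambda>d. tv j * U (d - 1))"
proof (induction rule: vfil_normal.induct)
  case (base k \<kappa> \<mu>)
  have "int (\<Sum>i=1..r. (\<mu>(j := Suc (\<mu> j))) i) = int (\<Sum>i=1..r. \<mu> i) + 1"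
    using j by (simp only: sum_fun_upd) (simp add: sum.remove[of _ j])
  then have "vfil_normal V r f (k - 1) (fam r f (\<mu>(j := Suc (\<mu> j))) \<kappa>)"
    using base by (intro vfil_normal.base) linarith
  then show ?case by (simp add: fam_tau[OF j])
next
  case (zero k)
  then show ?case by (simp add: vfil_normal.zero)
next
  case (add k U W)
  then show ?case using vfil_normal.add by (simp add: distrib_left)
next
  case (mult a k U)
  then show ?case using vfil_normal.mult[OF mult(1) mult(3)] by (simp add: mult.left_commute)
next
  case (deriv v k U)
  then show ?case using vfil_normal.deriv[OF deriv(1) deriv(3)] by (simp add: mpderiv_mult)
qed

lemma vfil_normal_cst: "vfil_normal V r f k U \<Longrightarrow> vfil_normal V r f k (\<lambda>d. cst c * U d)"
  using vfil_normal.mult[OF cst_in_poly_ring[of c V]] by simp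

lemma vfil_normal_dtau:
  assumes j: "j \<in> {1..r}"
  shows "vfil_normal V r f k U \<Longrightarrow> vfil_normal V r f (k + 1) (\<lambda>d. mpderiv (Inr j) (U (d + 1)))"
proof (induction rule: vfil_normal.induct)
  case (base k \<kappa> \<mu>)
  have "int (\<Sum>i=1..r. (\<kappa>(j := Suc (\<kappa> j))) i) = int (\<Sum>i=1..r. \<kappa> i) + 1"
    using j by (simp only: sum_fun_upd) (simp add: sum.remove[of _ j])
  then have 1: "vfil_normal V r f (k + 1) (fam r f \<mu> (\<kappa>(j := Suc (\<kappa> j))))"
    using base by (intro vfil_normal.base) linarith
  have "vfil_normal V r f (k + 1) (\<lambda>d. cst (of_nat (\<mu> j)) * fam r f (\<mu>(j := \<mu> j - 1)) \<kappa> d)"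
  proof (cases "\<mu> j")
    case (Suc a)
    then have "int (\<Sum>i=1..r. \<mu> i) = int (\<Sum>i=1..r. (\<mu>(j := \<mu> j - 1)) i) + 1"
      using j by (simp only: sum_fun_upd) (simp add: sum.remove[of _ j])
    then show ?thesis using base by (intro vfil_normal_cst vfil_normal.base) linarith
  qed (simp add: vfil_normal.zero)
  from vfil_normal.add[OF this 1] show ?case by (simp only: fam_dtau[OF j])
next
  case (zero k)
  then show ?case by (simp add: vfil_normal.zero)
next
  case (add k U W)
  then show ?case using vfil_normal.add by (simp add: mpderiv_add)
next
  case (mult a k U)
  then show ?case using vfil_normal.mult[OF mult(1) mult(3)] by (simp add: mpderiv_mult)
next
  case (deriv v k U)
  then show ?case using vfil_normal.deriv[OF deriv(1) deriv(3)] by (simp add: mpderiv_commute[of _ "Inl v"])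
qed

lemma vfil_imp_normal: "vfil V r f k U \<Longrightarrow> vfil_normal V r f k U"
proof (induction rule: vfil.induct)
  case base
  have "fam r f (\<lambda>_. 0) (\<lambda>_. 0) = dpow (phase r f)" by (simp add: fam_def fun_eq_iff)
  then show ?case using vfil_normal.base[of 0 "\<lambda>_. 0" r "\<lambda>_. 0" V f] by simp
qed (auto intro: vfil_normal.zero vfil_normal.add vfil_normal.mult vfil_normal.deriv vfil_normal_tau vfil_normal_dtau)

section \<open>The b-function equation in terms of the V-filtration\<close>

definition degree_ok :: "nat \<Rightarrow> (nat \<Rightarrow>\<^sub>0 nat) \<Rightarrow> int \<Rightarrow> bool" where
  "degree_ok r m d \<longleftrightarrow> keys m \<subseteq> {1..r} \<and> int (\<Sum>j=1..r. lookup m j) = d"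

definition weight :: "nat \<Rightarrow> (nat \<Rightarrow> 'v::linorder mpol) \<Rightarrow> (nat \<Rightarrow>\<^sub>0 nat) \<Rightarrow> 'v mpol fract" where
  "weight r f m = (\<Prod>j=1..r. to_fract (f j) ^ lookup m j) *
     inverse (of_nat (\<Prod>j=1..r. fact (lookup m j)))"

text \<open>
  The element \<open>u \<cdot> f\<^sup>s\<close> corresponds to the series \<open>\<Sum>\<^sub>m u(m) f\<^sup>m t\<^sup>m / m!\<close>, where \<open>m\<close> runs through the
  natural values of the exponents; \<open>U d\<close> is its component of degree \<open>d\<close>.
\<close>

definition represents :: "nat \<Rightarrow> (nat \<Rightarrow> 'v::linorder mpol) \<Rightarrow> 'v spoly \<Rightarrow> (int \<Rightarrow> ('v + nat) mpol) \<Rightarrow> bool" where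
  "represents r f u U \<longleftrightarrow> (\<forall>d m. lookup (theta (U d)) m =
     (if degree_ok r m d then sval m u * weight r f m else 0))"

locale generators =
  fixes V :: "'v::linorder set" and r :: nat and f :: "nat \<Rightarrow> 'v mpol"
  assumes f_ring: "\<And>j. j \<in> {1..r} \<Longrightarrow> f j \<in> poly_ring V"
    and f_nz: "\<And>j. j \<in> {1..r} \<Longrightarrow> f j \<noteq> 0"
begin

abbreviation "rel \<equiv> represents r f"
abbreviation "wt \<equiv> weight r f"

lemma wt_nz: "wt m \<noteq> 0"
proof -
  have "(\<Prod>j=1..r. fact (lookup m j)) \<noteq> (0::nat)" by simp
  then have "inverse (of_nat (\<Prod>j=1..r. fact (lookup m j))) \<noteq> (0 :: 'v mpol fract)"
    by (metis of_nat_fract_nz inverse_nonzero_iff_nonzero)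
  then show ?thesis using f_nz by (simp add: weight_def del: of_nat_prod of_nat_fact)
qed

lemma wt_add_single:
  assumes "j \<in> {1..r}"
  shows "of_nat (Suc (lookup n j)) * wt (single j 1 + n) = to_fract (f j) * wt n"
proof -
  let ?m = "single j 1 + n"
  let ?c = "\<lambda>m. \<Prod>j=1..r. fact (lookup m j) :: nat"
  have lm: "lookup ?m i = (if i = j then Suc (lookup n i) else lookup n i)" for i
    by (simp add: lookup_add lookup_single)
  note lm' = lm[unfolded One_nat_def]
  have "(\<Prod>i=1..r. to_fract (f i) ^ lookup ?m i)
      = to_fract (f j) ^ lookup ?m j * (\<Prod>i\<in>{1..r}-{j}. to_fract (f i) ^ lookup ?m i)"
    by (rule prod.remove) (use assms in auto)
  also have "(\<Prod>i\<in>{1..r}-{j}. to_fract (f i) ^ lookup ?m i) = (\<Prod>i\<in>{1..r}-{j}. to_fract (f i) ^ lookup n i)"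
    by (intro prod.cong refl) (simp add: lm')
  also have "to_fract (f j) ^ lookup ?m j * \<dots> = to_fract (f j) * (\<Prod>i=1..r. to_fract (f i) ^ lookup n i)"
    using assms by (subst (2) prod.remove[of _ j]) (simp_all add: lm' mult.assoc)
  finally have A: "(\<Prod>i=1..r. to_fract (f i) ^ lookup ?m i) = to_fract (f j) * (\<Prod>i=1..r. to_fract (f i) ^ lookup n i)" .
  have "?c ?m = fact (lookup ?m j) * (\<Prod>i\<in>{1..r}-{j}. fact (lookup ?m i))"
    by (rule prod.remove) (use assms in auto)
  also have "(\<Prod>i\<in>{1..r}-{j}. fact (lookup ?m i)) = (\<Prod>i\<in>{1..r}-{j}. fact (lookup n i) :: nat)"
    by (intro prod.cong refl) (simp add: lm')
  also have "fact (lookup ?m j) * \<dots> = Suc (lookup n j) * ?c n"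
    using assms by (subst (2) prod.remove[of _ j]) (simp_all add: lm' distrib_right mult.assoc)
  finally have B: "?c ?m = Suc (lookup n j) * ?c n" .
  have nz: "of_nat (Suc (lookup n j)) \<noteq> (0 :: 'v mpol fract)"
    by (rule of_nat_fract_nz) simp
  show ?thesis
    unfolding weight_def A B of_nat_mult inverse_mult_distrib
    using nz by (simp add: field_simps del: of_nat_Suc of_nat_prod of_nat_fact)
qed

lemma degree_ok_add_single:
  assumes "j \<in> {1..r}"
  shows "degree_ok r (single j 1 + n) (d + 1) \<longleftrightarrow> degree_ok r n d"
proof -
  have "(\<Sum>i=1..r. lookup (single j 1 + n) i) = Suc (\<Sum>i=1..r. lookup n i)"
    using assms by (simp add: lookup_add lookup_single when_def sum.distrib)
  moreover have "keys (single j 1 + n) = insert j (keys n)"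
    by (auto simp: in_keys_iff lookup_add lookup_single when_def split: if_splits)
  ultimately show ?thesis using assms unfolding degree_ok_def by simp
qed

lemma fract_divide_nat_cancel: "of_nat (Suc n) * x = of_nat (Suc n) * y \<Longrightarrow> x = (y :: 'v mpol fract)"
  using of_nat_fract_nz[where 'v = 'v, of "Suc n"] by (simp del: of_nat_Suc)

text \<open>
  The multinomial expansion of the powers of the phase, by recursion: each summand of the phase
  contributes the fraction \<open>m j / (d + 1)\<close> of the coefficient at \<open>m\<close>.
\<close>

lemma rel_dpow: "rel 1 (dpow (phase r f))"
  unfolding represents_def
proof (intro allI)
  fix d m
  have pos: "lookup (theta (dpow (phase r f) (int n))) m = (if degree_ok r m (int n) then wt m else 0)" for n
  proof (induction n arbitrary: m)
    case 0
    have "degree_ok r m 0 \<longleftrightarrow> m = 0"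
    proof
      assume "degree_ok r m 0"
      then have "keys m \<subseteq> {1..r}" "(\<Sum>j=1..r. lookup m j) = 0"
        by (simp_all only: degree_ok_def of_nat_eq_0_iff)
      then have "keys m \<subseteq> {1..r}" "\<forall>j\<in>{1..r}. lookup m j = 0"
        by (simp_all only: sum_eq_0_iff finite_atLeastAtMost)
      then show "m = 0" by (intro poly_mapping_eqI) (metis in_keys_iff lookup_zero subsetD)
    qed (simp add: degree_ok_def)
    then show ?case by (auto simp: lookup_one weight_def)
  next
    case (Suc n)
    let ?P = "phase r f"
    have summand: "lookup (svar j * theta (dpow ?P (int n))) m * to_fract (f j)
        = (if degree_ok r m (int (Suc n)) then of_nat (lookup m j) * wt m else 0)"
      if j: "j \<in> {1..r}" for j
    proof (cases "lookup m j = 0")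
      case False
      define n' where "n' = m - single j 1"
      have m: "m = single j 1 + n'" unfolding n'_def by (rule monomial_decomp[OF False])
      have lk: "lookup m j = Suc (lookup n' j)" unfolding m by (simp add: lookup_add)
      have "degree_ok r m (int (Suc n)) \<longleftrightarrow> degree_ok r n' (int n)"
        unfolding m using degree_ok_add_single[OF j, of n' "int n"] by (simp add: add.commute)
      moreover have "lookup (svar j * theta (dpow ?P (int n))) m = lookup (theta (dpow ?P (int n))) n'"
        using False by (simp add: lookup_svar_mult n'_def)
      ultimately show ?thesis
        using wt_add_single[OF j, of n'] unfolding Suc lk m[symmetric] by (simp add: mult.commute del: of_nat_Suc)
    qed (simp add: lookup_svar_mult)
    have "of_nat (Suc n) * lookup (theta (dpow ?P (int (Suc n)))) m
        = lookup (theta (cst (of_int (int n + 1)) * dpow ?P (int n + 1))) m"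
    proof -
      have "theta (cst (of_int (int n + 1))) = (cst (to_fract (of_nat (Suc n))) :: 'v spoly)"
      proof -
        have "of_int (int n + 1) = (of_nat (Suc n) :: complex)" by simp
        then show ?thesis by (simp only: theta_simps emb_conv) (simp only: single_of_nat)
      qed
      moreover have "int (Suc n) = int n + 1" by simp
      ultimately show ?thesis
        by (simp only: theta_simps(4) lookup_cst_mult to_fract_of_nat)
    qed
    also have "\<dots> = lookup (theta (?P * dpow ?P (int n))) m"
      by (simp only: mult_dpow)
    also have "theta (?P * dpow ?P (int n)) = (\<Sum>j=1..r. cst (to_fract (f j)) * (svar j * theta (dpow ?P (int n))))"
      by (simp add: phase_def[of r f] sum_distrib_right emb_conv mult_ac)
    also have "lookup \<dots> m = (\<Sum>j=1..r. lookup (svar j * theta (dpow ?P (int n))) m * to_fract (f j))"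
      by (simp add: lookup_sum lookup_cst_mult mult.commute)
    also have "\<dots> = (\<Sum>j=1..r. if degree_ok r m (int (Suc n)) then of_nat (lookup m j) * wt m else 0)"
      by (intro sum.cong refl summand)
    also have "\<dots> = of_nat (Suc n) * (if degree_ok r m (int (Suc n)) then wt m else 0)"
    proof (cases "degree_ok r m (int (Suc n))")
      case True
      then have "(\<Sum>j=1..r. lookup m j) = Suc n" by (simp only: degree_ok_def of_nat_eq_iff)
      then show ?thesis using True by (simp only: if_True sum_distrib_right[symmetric] of_nat_sum[symmetric])
    qed simp
    finally show ?case by (rule fract_divide_nat_cancel)
  qed
  show "lookup (theta (dpow (phase r f) d)) m = (if degree_ok r m d then sval m 1 * wt m else 0)"
  proof (cases "d < 0")
    case True
    then have "\<not> degree_ok r m d" by (auto simp: degree_ok_def simp del: of_nat_sum)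
    then show ?thesis using True by (simp add: dpow_neg)
  next
    case False
    then show ?thesis using pos[of "nat d"] by simp
  qed
qed

lemma rel_zero: "rel 0 (\<lambda>d. 0)"
  by (simp add: represents_def)

lemma rel_add: "rel u U \<Longrightarrow> rel w W \<Longrightarrow> rel (u + w) (\<lambda>d. U d + W d)"
  by (simp add: represents_def lookup_add distrib_right)

lemma rel_emb: "rel u U \<Longrightarrow> rel (emb a * u) (\<lambda>d. xe a * U d)"
  by (simp add: represents_def emb_conv lookup_cst_mult mult.assoc)

lemma rel_euler: "rel u U \<Longrightarrow> rel (svar j * u) (\<lambda>d. tv j * mpderiv (Inr j) (U d))"
  unfolding represents_def lookup_theta_euler by (simp add: mult.assoc)

text \<open>
  The extra term in \<open>Bderiv\<close> is the logarithmic derivative of \<open>f\<^sup>m\<close>.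
\<close>

lemma rel_deriv:
  assumes "rel u U"
  shows "rel (Bderiv r f v u) (\<lambda>d. mpderiv (Inl v) (U d))"
proof -
  have "fderiv v (sval m u * wt m) = sval m (Bderiv r f v u) * wt m" for m
  proof -
    have "fderiv v (wt m) = wt m * (\<Sum>j=1..r. of_nat (lookup m j) * Fract (mpderiv v (f j)) (f j))"
      using f_nz unfolding weight_def fderiv_mult fderiv_inverse_of_nat
      by (subst fderiv_prod_power) (auto simp: mult_ac)
    then show ?thesis
      by (simp add: Bderiv_def sval_map_fderiv scoeff_def fderiv_mult algebra_simps)
  qed
  then show ?thesis
    using assms unfolding represents_def lookup_theta_mpderiv by simp
qed

definition base_elem :: "(nat \<Rightarrow> nat) \<Rightarrow> (nat \<Rightarrow> nat) \<Rightarrow> 'v spoly" where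
  "base_elem \<mu> \<kappa> = (\<Prod>j=1..r. \<Prod>i<\<mu> j. svar j - of_nat i) *
     scoeff (\<Prod>j=1..r. to_fract (f j) powi (int (\<kappa> j) - int (\<mu> j)))"

lemma sval_base_elem:
  "sval m (base_elem \<mu> \<kappa>) = (\<Prod>j=1..r. (\<Prod>i<\<mu> j. of_nat (lookup m j) - of_nat i) *
     to_fract (f j) powi (int (\<kappa> j) - int (\<mu> j)))"
  by (simp add: base_elem_def scoeff_def prod.distrib)

text \<open>
  The falling factorials appear because multiplication by \<open>t\<^sup>\<mu>\<close> moves the coefficient at \<open>m - \<mu>\<close>
  to \<open>m\<close>, and \<open>1 / (m - \<mu>)!\<close> is the falling factorial times \<open>1 / m!\<close>. They vanish where \<open>m - \<mu>\<close>
  would be negative, so the negative powers of \<open>f\<close> do no harm.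
\<close>

lemma rel_fam: "rel (base_elem \<mu> \<kappa>) (fam r f \<mu> \<kappa>)"
proof (induction \<mu> rule: exponent_induct[where r = r])
  case (1 \<mu>)
  have "fam r f \<mu> \<kappa> = (\<lambda>d. xe (\<Prod>j=1..r. f j ^ \<kappa> j) * dpow (phase r f) d)"
    using 1 by (simp add: fam_def fun_eq_iff)
  moreover have "base_elem \<mu> \<kappa> = emb (\<Prod>j=1..r. f j ^ \<kappa> j) * 1"
    using 1 by (simp add: base_elem_def emb_conv scoeff_def to_fract_prod to_fract_power)
  ultimately show ?case using rel_emb[OF rel_dpow] by simp
next
  case (2 \<mu> j)
  let ?\<mu>' = "\<mu>(j := Suc (\<mu> j))"
  show ?case
    unfolding represents_def
  proof (intro allI)
    fix d m
    define H where "H = (\<lambda>i a b. (\<Prod>l<b. of_nat a - of_nat l) * to_fract (f i) powi (int (\<kappa> i) - int b))"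
    have eq: "lookup (theta (fam r f ?\<mu>' \<kappa> d)) m
        = lookup (svar j * theta (fam r f \<mu> \<kappa> (d - 1))) m"
      by (simp add: fam_tau[OF 2(1), symmetric])
    have val: "sval m (base_elem ?\<mu>' \<kappa>)
        = H j (lookup m j) (Suc (\<mu> j)) * (\<Prod>i\<in>{1..r}-{j}. H i (lookup m i) (\<mu> i))"
      unfolding sval_base_elem H_def
      by (rule prod_fun_upd[OF 2(1), of "\<lambda>i b. (\<Prod>l<b. of_nat (lookup m i) - of_nat l) * to_fract (f i) powi (int (\<kappa> i) - int b)"])
    show "lookup (theta (fam r f ?\<mu>' \<kappa> d)) m
        = (if degree_ok r m d then sval m (base_elem ?\<mu>' \<kappa>) * wt m else 0)"
    proof (cases "lookup m j = 0")
      case True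
      have "H j 0 (Suc (\<mu> j)) = 0" unfolding H_def prod.lessThan_Suc_shift by simp
      then show ?thesis unfolding eq val by (simp add: lookup_svar_mult True)
    next
      case False
      define n where "n = m - single j 1"
      have m: "m = single j 1 + n" unfolding n_def by (rule monomial_decomp[OF False])
      have lk: "lookup m i = (if i = j then Suc (lookup n i) else lookup n i)" for i
        unfolding m by (simp add: lookup_add lookup_single)
      have ok: "degree_ok r m d \<longleftrightarrow> degree_ok r n (d - 1)"
        unfolding m using degree_ok_add_single[OF 2(1), of n "d - 1"] by simp
      have e1: "sval n (base_elem \<mu> \<kappa>)
          = H j (lookup n j) (\<mu> j) * (\<Prod>i\<in>{1..r}-{j}. H i (lookup n i) (\<mu> i))"
        unfolding sval_base_elem H_def using 2(1) by (intro prod.remove) auto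
      have e2: "(\<Prod>i\<in>{1..r}-{j}. H i (lookup m i) (\<mu> i)) = (\<Prod>i\<in>{1..r}-{j}. H i (lookup n i) (\<mu> i))"
        by (intro prod.cong refl) (simp add: lk)
      have e3: "H j (lookup m j) (Suc (\<mu> j)) * to_fract (f j)
          = of_nat (Suc (lookup n j)) * H j (lookup n j) (\<mu> j)"
      proof -
        have "to_fract (f j) powi (int (\<kappa> j) - int (Suc (\<mu> j))) * to_fract (f j) = to_fract (f j) powi (int (\<kappa> j) - int (\<mu> j))"
        proof -
          have "to_fract (f j) \<noteq> 0" using f_nz[OF 2(1)] by simp
          moreover have "int (\<kappa> j) - int (Suc (\<mu> j)) + 1 = int (\<kappa> j) - int (\<mu> j)" by simp
          ultimately show ?thesis
            using power_int_add_1[of "to_fract (f j)" "int (\<kappa> j) - int (Suc (\<mu> j))"] by metis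
        qed
        then show ?thesis
          unfolding H_def prod.lessThan_Suc_shift lk by (simp add: mult.assoc)
      qed
      have e4: "a * R * t = c * (h * R)" if "a * t = c * h" for a R t c h :: "'v mpol fract"
      proof -
        have "a * R * t = (a * t) * R" by (simp only: mult_ac)
        then show ?thesis by (simp only: that mult.assoc)
      qed
      have "sval m (base_elem ?\<mu>' \<kappa>) * to_fract (f j) = of_nat (Suc (lookup n j)) * sval n (base_elem \<mu> \<kappa>)"
        unfolding val e1 e2 by (rule e4[OF e3])
      have "to_fract (f j) * (sval m (base_elem ?\<mu>' \<kappa>) * wt m) = to_fract (f j) * (sval n (base_elem \<mu> \<kappa>) * wt n)"
      proof -
        have "t * (X * x) = t * (Y * y)" if "X * t = c * Y" "c * x = t * y" for t X x Y y c :: "'v mpol fract"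
        proof -
          have "t * (X * x) = (X * t) * x" by (simp only: mult_ac)
          also have "\<dots> = Y * (c * x)" unfolding that(1) by (simp only: mult_ac)
          finally show ?thesis unfolding that(2) by (simp only: mult_ac)
        qed
        from this[OF _ wt_add_single[OF 2(1), of n, folded m]] show ?thesis
          using \<open>sval m (base_elem ?\<mu>' \<kappa>) * to_fract (f j) = of_nat (Suc (lookup n j)) * sval n (base_elem \<mu> \<kappa>)\<close>
          by blast
      qed
      then have "sval m (base_elem ?\<mu>' \<kappa>) * wt m = sval n (base_elem \<mu> \<kappa>) * wt n"
        using f_nz[OF 2(1)] by simp
      moreover have "lookup (theta (fam r f \<mu> \<kappa> (d - 1))) n
          = (if degree_ok r n (d - 1) then sval n (base_elem \<mu> \<kappa>) * wt n else 0)"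
        using 2(2) unfolding represents_def by blast
      ultimately show ?thesis
        unfolding eq lookup_svar_mult ok using False by (simp add: n_def)
    qed
  qed
qed

end

lemma poly_fracts_conv: "poly_fracts V = to_fract ` poly_ring V"
  by (auto simp: poly_fracts_def to_fract_def)

lemma cst_spoly_over: "x \<in> R \<Longrightarrow> 0 \<in> R \<Longrightarrow> cst x \<in> spoly_over R r"
  by (auto simp: spoly_over_def lookup_single when_def split: if_splits)

lemma svar_spoly_over: "j \<in> {1..r} \<Longrightarrow> 0 \<in> R \<Longrightarrow> 1 \<in> R \<Longrightarrow> svar j \<in> spoly_over R r"
  by (auto simp: spoly_over_def svar_def lookup_single when_def)

lemma poly_fracts_closed:
  "0 \<in> poly_fracts V" "1 \<in> poly_fracts V"
  "x \<in> poly_fracts V \<Longrightarrow> y \<in> poly_fracts V \<Longrightarrow> x + y \<in> poly_fracts V"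
  "x \<in> poly_fracts V \<Longrightarrow> y \<in> poly_fracts V \<Longrightarrow> x * y \<in> poly_fracts V"
  unfolding poly_fracts_conv
  by (metis imageI poly_ring_0 to_fract_0, metis imageI poly_ring_1 to_fract_1)
    (auto simp: image_iff, metis poly_ring_add to_fract_add, metis poly_ring_mult to_fract_mult)

lemma spoly_over_prod:
  assumes "0 \<in> R" "1 \<in> R" "\<And>a b. a \<in> R \<Longrightarrow> b \<in> R \<Longrightarrow> a + b \<in> R" "\<And>a b. a \<in> R \<Longrightarrow> b \<in> R \<Longrightarrow> a * b \<in> R"
    and "\<And>i. i \<in> I \<Longrightarrow> g i \<in> spoly_over R r"
  shows "prod g I \<in> spoly_over R r"
proof -
  have 1: "1 \<in> spoly_over R r" using cst_spoly_over[OF assms(2,1), of r] by simp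
  show ?thesis
    using assms(5)
    by (induction I rule: infinite_finite_induct) (auto intro!: 1 spoly_over_mult assms(1,3,4))
qed

lemma weyl_ops_additive:
  assumes "P \<in> weyl_ops V r f"
  shows "P (u + w) = P u + P w"
  using assms
proof (induction arbitrary: u w rule: weyl_ops.induct)
  case (deriv v)
  have "Poly_Mapping.map (fderiv v) (u + w) = Poly_Mapping.map (fderiv v) u + Poly_Mapping.map (fderiv v) w"
    by (rule poly_mapping_eqI) (simp only: lookup_map_fderiv lookup_add fderiv_add)
  then show ?case by (simp add: Bderiv_def algebra_simps)
qed (simp_all add: algebra_simps)

lemma weyl_ops_zero: "P \<in> weyl_ops V r f \<Longrightarrow> P 0 = 0"
  using weyl_ops_additive[of P V r f 0 0] by (metis add_0 add_cancel_right_right)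

lemma weyl_ops_sum: "P \<in> weyl_ops V r f \<Longrightarrow> P (\<Sum>i\<in>I. h i) = (\<Sum>i\<in>I. P (h i))"
  by (induction I rule: infinite_finite_induct) (simp_all add: weyl_ops_zero weyl_ops_additive)

context generators
begin

text \<open>
  The elements that may stand on the left-hand side of the b-function equation, for tuples \<open>c\<close> of
  arbitrary sum \<open>k\<close>.
\<close>

definition reached :: "int \<Rightarrow> 'v spoly set" where
  "reached k = {u. \<exists>C P. finite C \<and> C \<subseteq> {c \<in> {1..r} \<rightarrow>\<^sub>E UNIV. (\<Sum>j=1..r. c j) = k} \<and>
     (\<forall>c\<in>C. P c \<in> weyl_ops V r f) \<and> u = (\<Sum>c\<in>C. P c (c_under_s r c * f_shift r f c))}"

lemma reached_0: "0 \<in> reached k"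
  unfolding reached_def by (auto intro!: exI[of _ "{}"])

lemma zero_op: "(\<lambda>u. 0) \<in> weyl_ops V r f"
proof -
  have "((*) 0) = (\<lambda>u :: 'v spoly. 0)" by (rule ext) simp
  then show ?thesis
    using weyl_ops.mult[of 0 V r f] cst_spoly_over[of 0 "poly_fracts V" r] poly_fracts_closed(1)[of V] by simp
qed

lemma reached_add:
  assumes "u \<in> reached k" "w \<in> reached k"
  shows "u + w \<in> reached k"
proof -
  let ?b = "\<lambda>c. c_under_s r c * f_shift r f c"
  obtain C P where C: "finite C" "C \<subseteq> {c \<in> {1..r} \<rightarrow>\<^sub>E UNIV. (\<Sum>j=1..r. c j) = k}"
      "\<forall>c\<in>C. P c \<in> weyl_ops V r f" "u = (\<Sum>c\<in>C. P c (?b c))"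
    using assms(1) unfolding reached_def by blast
  obtain C' P' where C': "finite C'" "C' \<subseteq> {c \<in> {1..r} \<rightarrow>\<^sub>E UNIV. (\<Sum>j=1..r. c j) = k}"
      "\<forall>c\<in>C'. P' c \<in> weyl_ops V r f" "w = (\<Sum>c\<in>C'. P' c (?b c))"
    using assms(2) unfolding reached_def by blast
  define Q where "Q = (\<lambda>c. if c \<in> C then P c else (\<lambda>u. 0))"
  define Q' where "Q' = (\<lambda>c. if c \<in> C' then P' c else (\<lambda>u. 0))"
  have "u = (\<Sum>c\<in>C \<union> C'. Q c (?b c))"
    unfolding C(4) using C(1) C'(1) by (intro sum.mono_neutral_cong_left) (auto simp: Q_def)
  moreover have "w = (\<Sum>c\<in>C \<union> C'. Q' c (?b c))"
    unfolding C'(4) using C(1) C'(1) by (intro sum.mono_neutral_cong_left) (auto simp: Q'_def)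
  ultimately have "u + w = (\<Sum>c\<in>C \<union> C'. (\<lambda>u. Q c u + Q' c u) (?b c))"
    by (simp add: sum.distrib)
  moreover have "(\<lambda>u. Q c u + Q' c u) \<in> weyl_ops V r f" for c
    using C(3) C'(3) zero_op by (intro weyl_ops.add) (auto simp: Q_def Q'_def)
  moreover have "finite (C \<union> C')" using C(1) C'(1) by simp
  moreover have "C \<union> C' \<subseteq> {c \<in> {1..r} \<rightarrow>\<^sub>E UNIV. (\<Sum>j=1..r. c j) = k}" using C(2) C'(2) by blast
  ultimately show ?thesis unfolding reached_def
    by (intro CollectI exI[of _ "C \<union> C'"] exI[of _ "\<lambda>c u. Q c u + Q' c u"]) blast
qed

lemma reached_weyl:
  assumes Q: "Q \<in> weyl_ops V r f" and "u \<in> reached k"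
  shows "Q u \<in> reached k"
proof -
  obtain C P where C: "finite C" "C \<subseteq> {c \<in> {1..r} \<rightarrow>\<^sub>E UNIV. (\<Sum>j=1..r. c j) = k}"
      "\<forall>c\<in>C. P c \<in> weyl_ops V r f" "u = (\<Sum>c\<in>C. P c (c_under_s r c * f_shift r f c))"
    using assms(2) unfolding reached_def by blast
  then have "Q u = (\<Sum>c\<in>C. (Q \<circ> P c) (c_under_s r c * f_shift r f c))"
    by (simp add: weyl_ops_sum[OF Q])
  then show ?thesis
    using C weyl_ops.comp[OF Q] unfolding reached_def
    by (intro CollectI exI[of _ C] exI[of _ "\<lambda>c. Q \<circ> P c"]) blast
qed

text \<open>
  The falling factorials of length \<open>\<mu> j\<close> begin with those of length \<open>- c j\<close> from \<open>c_under_s\<close>, and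
  the remaining factors are polynomials in the exponents.
\<close>

lemma base_elem_split:
  fixes c :: "nat \<Rightarrow> int"
  assumes "\<And>j. j \<in> {1..r} \<Longrightarrow> c j = int (\<kappa> j) - int (\<mu> j)"
  shows "base_elem \<mu> \<kappa> = (\<Prod>j=1..r. \<Prod>i=nat (- c j)..<\<mu> j. svar j - of_nat i) * (c_under_s r c * f_shift r f c)"
proof -
  have "(\<Prod>i<\<mu> j. svar j - of_nat i) = (\<Prod>i<nat (- c j). svar j - of_nat i) * (\<Prod>i=nat (- c j)..<\<mu> j. svar j - of_nat i :: 'v spoly)"
    if "j \<in> {1..r}" for j
    using prod.atLeastLessThan_concat[of 0 "nat (- c j)" "\<mu> j" "\<lambda>i. svar j - of_nat i :: 'v spoly"] assms[OF that]
    by (simp add: lessThan_atLeast0)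
  then have "(\<Prod>j=1..r. \<Prod>i<\<mu> j. svar j - of_nat i) = (\<Prod>j=1..r. \<Prod>i<nat (- c j). svar j - of_nat i) *
      (\<Prod>j=1..r. \<Prod>i=nat (- c j)..<\<mu> j. svar j - of_nat i :: 'v spoly)"
    unfolding prod.distrib[symmetric] by (intro prod.cong refl)
  moreover have "(\<Prod>j=1..r. \<Prod>i<nat (- c j). svar j - of_nat i :: 'v spoly) = c_under_s r c"
    unfolding c_under_s_def
  proof (intro prod.mono_neutral_right ballI)
    fix j assume "j \<in> {1..r} - {j \<in> {1..r}. c j < 0}"
    then have "nat (- c j) = 0" by auto
    then show "(\<Prod>i<nat (- c j). svar j - of_nat i :: 'v spoly) = 1" by (simp only: lessThan_0 prod.empty)
  qed auto
  moreover have "scoeff (\<Prod>j=1..r. to_fract (f j) powi (int (\<kappa> j) - int (\<mu> j))) = f_shift r f c"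
    unfolding f_shift_def to_fract_def using assms by (intro arg_cong[of _ _ scoeff] prod.cong refl) simp
  ultimately show ?thesis by (simp only: base_elem_def mult_ac)
qed

lemma base_elem_reached: "base_elem \<mu> \<kappa> \<in> reached (int (\<Sum>j=1..r. \<kappa> j) - int (\<Sum>j=1..r. \<mu> j))"
proof -
  define c where "c = restrict (\<lambda>j. int (\<kappa> j) - int (\<mu> j)) {1..r}"
  define q where "q = (\<Prod>j=1..r. \<Prod>i=nat (- c j)..<\<mu> j. svar j - of_nat i :: 'v spoly)"
  have diff: "svar j - of_nat i \<in> spoly_over (poly_fracts V) r" if "j \<in> {1..r}" for j i
  proof -
    have "cst (- of_nat i :: 'v mpol fract) \<in> spoly_over (poly_fracts V) r"
    proof (rule cst_spoly_over)
      have "- of_nat i = to_fract (- cst (of_nat i) :: 'v mpol)" by (simp add: to_fract_of_nat)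
      then show "- of_nat i \<in> poly_fracts V"
        unfolding poly_fracts_conv by (metis imageI poly_ring_uminus cst_in_poly_ring)
    qed (rule poly_fracts_closed)
    from spoly_over_add[OF poly_fracts_closed(3) svar_spoly_over[OF that poly_fracts_closed(1,2)] this]
    show ?thesis by (simp add: single_uminus)
  qed
  have "q \<in> spoly_over (poly_fracts V) r"
    unfolding q_def by (intro spoly_over_prod poly_fracts_closed diff)
  then have "(\<lambda>u. q * u) \<in> weyl_ops V r f" by (rule weyl_ops.mult)
  moreover have "base_elem \<mu> \<kappa> = (\<lambda>u. q * u) (c_under_s r c * f_shift r f c)"
    unfolding q_def by (rule base_elem_split) (simp add: c_def)
  moreover have "(\<Sum>j=1..r. c j) = int (\<Sum>j=1..r. \<kappa> j) - int (\<Sum>j=1..r. \<mu> j)"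
    by (simp add: c_def sum_subtractf)
  ultimately show ?thesis
    unfolding reached_def
    by (intro CollectI exI[of _ "{c}"] exI[of _ "\<lambda>_ u. q * u"]) (simp add: c_def)
qed

lemma vfil_normal_reached: "vfil_normal V r f k U \<Longrightarrow> \<exists>u\<in>reached k. rel u U"
proof (induction rule: vfil_normal.induct)
  case (base k \<kappa> \<mu>)
  then show ?case using base_elem_reached rel_fam by blast
next
  case (zero k)
  then show ?case using reached_0 rel_zero by blast
next
  case (add k U W)
  then show ?case using reached_add rel_add by blast
next
  case (mult a k U)
  have "emb a \<in> spoly_over (poly_fracts V) r"
    unfolding emb_conv using mult poly_fracts_closed(1)
    by (intro cst_spoly_over) (auto simp: poly_fracts_conv)
  then show ?case using mult reached_weyl[OF weyl_ops.mult] rel_emb by blast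
next
  case (deriv v k U)
  then show ?case using reached_weyl[OF weyl_ops.deriv] rel_deriv by blast
qed

lemma weyl_ops_vfil:
  assumes "P \<in> weyl_ops V r f"
  shows "\<exists>U. vfil V r f k U \<and> rel u U \<Longrightarrow> \<exists>U. vfil V r f k U \<and> rel (P u) U"
  using assms
proof (induction arbitrary: u rule: weyl_ops.induct)
  case (mult q)
  show ?case
  proof (rule polynomial_induct[of "poly_fracts V" q "{1..r}" "\<lambda>q. \<exists>U. vfil V r f k U \<and> rel (q * u) U"])
    show "lookup q m \<in> poly_fracts V" for m using mult(1) by (simp add: spoly_over_def)
    show "keys m \<subseteq> {1..r}" if "m \<in> keys q" for m
      using mult(1) that unfolding spoly_over_def by blast
  next
    fix x assume "x \<in> poly_fracts V"
    then obtain a where a: "a \<in> poly_ring V" "cst x = emb a" by (auto simp: poly_fracts_conv emb_conv)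
    obtain U where "vfil V r f k U" "rel u U" using mult(2) by blast
    then show "\<exists>U. vfil V r f k U \<and> rel (cst x * u) U"
      using vfil.mult[OF a(1)] rel_emb unfolding a(2) by blast
  next
    fix p q
    assume "\<exists>U. vfil V r f k U \<and> rel (p * u) U" "\<exists>U. vfil V r f k U \<and> rel (q * u) U"
    then obtain U W where "vfil V r f k U" "rel (p * u) U" "vfil V r f k W" "rel (q * u) W" by blast
    then have "vfil V r f k (\<lambda>d. U d + W d) \<and> rel ((p + q) * u) (\<lambda>d. U d + W d)"
      unfolding distrib_right by (intro conjI vfil.add rel_add)
    then show "\<exists>U. vfil V r f k U \<and> rel ((p + q) * u) U" by blast
  next
    fix j p
    assume j: "j \<in> {1..r}" and "\<exists>U. vfil V r f k U \<and> rel (p * u) U"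
    then obtain U where U: "vfil V r f k U" "rel (p * u) U" by blast
    have "vfil V r f k (\<lambda>d. tv j * mpderiv (Inr j) (U d))"
      using vfil.tau[OF j vfil.dtau[OF j U(1)]] by simp
    moreover have "rel (single (single j 1) 1 * p * u) (\<lambda>d. tv j * mpderiv (Inr j) (U d))"
      using rel_euler[OF U(2), of j] by (simp add: svar_def mult.assoc)
    ultimately show "\<exists>U. vfil V r f k U \<and> rel (single (single j 1) 1 * p * u) U" by blast
  qed (rule poly_fracts_closed)
next
  case (deriv v)
  obtain U where "vfil V r f k U" "rel u U" using deriv.prems by blast
  then have "vfil V r f k (\<lambda>d. mpderiv (Inl v) (U d)) \<and> rel (Bderiv r f v u) (\<lambda>d. mpderiv (Inl v) (U d))"
    using deriv.hyps by (intro conjI vfil.deriv rel_deriv)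
  then show ?case by blast
next
  case (add P Q)
  obtain U W where "vfil V r f k U" "rel (P u) U" "vfil V r f k W" "rel (Q u) W"
    using add.IH(1)[OF add.prems] add.IH(2)[OF add.prems] by blast
  then have "vfil V r f k (\<lambda>d. U d + W d) \<and> rel (P u + Q u) (\<lambda>d. U d + W d)"
    by (intro conjI vfil.add rel_add)
  then show ?case by blast
next
  case (comp P Q)
  then show ?case by (metis comp_apply)
qed

lemma reached_vfil:
  assumes "u \<in> reached k"
  shows "\<exists>U. vfil V r f k U \<and> rel u U"
proof -
  obtain C P where C: "finite C" "C \<subseteq> {c \<in> {1..r} \<rightarrow>\<^sub>E UNIV. (\<Sum>j=1..r. c j) = k}"
      "\<forall>c\<in>C. P c \<in> weyl_ops V r f" "u = (\<Sum>c\<in>C. P c (c_under_s r c * f_shift r f c))"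
    using assms unfolding reached_def by blast
  have base: "\<exists>U. vfil V r f k U \<and> rel (c_under_s r c * f_shift r f c) U" if "c \<in> C" for c
  proof -
    let ?\<kappa> = "\<lambda>j. nat (c j)" and ?\<mu> = "\<lambda>j. nat (- c j)"
    have "base_elem ?\<mu> ?\<kappa> = (\<Prod>j=1..r. \<Prod>i=nat (- c j)..<nat (- c j). svar j - of_nat i) * (c_under_s r c * f_shift r f c)"
      by (rule base_elem_split) simp
    then have "base_elem ?\<mu> ?\<kappa> = c_under_s r c * f_shift r f c" by simp
    moreover have "int (\<Sum>j=1..r. ?\<kappa> j) - int (\<Sum>j=1..r. ?\<mu> j) = k"
    proof -
      have "int (\<Sum>j=1..r. ?\<kappa> j) - int (\<Sum>j=1..r. ?\<mu> j) = (\<Sum>j=1..r. c j)"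
        unfolding of_nat_sum sum_subtractf[symmetric] by (intro sum.cong refl) simp
      then show ?thesis using C(2) that by auto
    qed
    ultimately show ?thesis using rel_fam[of ?\<mu> ?\<kappa>] vfil_fam[of V r f ?\<kappa> ?\<mu>] by metis
  qed
  have "\<exists>U. vfil V r f k U \<and> rel (\<Sum>c\<in>C'. P c (c_under_s r c * f_shift r f c)) U" if "C' \<subseteq> C" for C'
    using finite_subset[OF that C(1)] that
  proof (induction C' rule: finite_induct)
    case empty
    then show ?case by (intro exI[of _ "\<lambda>d. 0"]) (simp add: vfil.zero rel_zero)
  next
    case (insert c C')
    then obtain U where U: "vfil V r f k U" "rel (\<Sum>c\<in>C'. P c (c_under_s r c * f_shift r f c)) U" by blast
    obtain W where W: "vfil V r f k W" "rel (P c (c_under_s r c * f_shift r f c)) W"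
      using weyl_ops_vfil[OF _ base[of c], of "P c"] C(3) insert.prems by blast
    show ?case
      using vfil.add[OF W(1) U(1)] rel_add[OF W(2) U(2)] insert.hyps
      by (intro exI[of _ "\<lambda>d. W d + U d"]) simp
  qed
  then show ?thesis using C(4) by blast
qed

lemma sval_eval_at_s:
  assumes "degree_ok r m d"
  shows "sval m (eval_at_s r b :: 'v spoly) = to_fract (cst (poly b (of_int d)))"
proof -
  have s: "sval m (\<Sum>j=1..r. svar j :: 'v spoly) = to_fract (cst (of_int d))"
  proof -
    have "sval m (\<Sum>j=1..r. svar j :: 'v spoly) = (of_nat (\<Sum>j=1..r. lookup m j) :: 'v mpol fract)"
      by simp
    also have "\<dots> = to_fract (cst (of_nat (\<Sum>j=1..r. lookup m j)))"
      by (simp only: single_of_nat to_fract_of_nat)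
    also have "of_nat (\<Sum>j=1..r. lookup m j) = (of_int d :: complex)"
      using assms unfolding degree_ok_def by (metis of_int_of_nat_eq)
    finally show ?thesis .
  qed
  have "sval m (poly (map_poly (\<lambda>z. emb (cst z)) b) x) = to_fract (cst (poly b y))"
    if "sval m x = to_fract (cst y)" for x :: "'v spoly" and y
    using that by (induction b) (simp_all add: map_poly_pCons cst_add cst_mult)
  from this[OF s] show ?thesis unfolding eval_at_s_def .
qed

lemma rel_eval_at_s: "rel (eval_at_s r b) (\<lambda>d. cst (poly b (of_int d)) * dpow (phase r f) d)"
  unfolding represents_def
proof (intro allI)
  fix d m
  have "lookup (theta (cst (poly b (of_int d)) * dpow (phase r f) d)) m
      = to_fract (cst (poly b (of_int d))) * (if degree_ok r m d then sval m 1 * wt m else 0)"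
    using rel_dpow by (simp add: represents_def emb_conv lookup_cst_mult)
  then show "lookup (theta (cst (poly b (of_int d)) * dpow (phase r f) d)) m
      = (if degree_ok r m d then sval m (eval_at_s r b) * wt m else 0)"
    using sval_eval_at_s[of m d b] by (cases "degree_ok r m d") simp_all
qed

lemma rel_unique: "rel u U \<Longrightarrow> rel u W \<Longrightarrow> U = W"
proof
  fix d assume "rel u U" "rel u W"
  then have "theta (U d) = theta (W d)"
    by (intro poly_mapping_eqI) (simp add: represents_def)
  then show "U d = W d" by (simp add: theta_eq_iff)
qed

lemma f_shift_Bmod: "f_shift r f c \<in> Bmod V r f"
proof -
  define h where "h = (\<Prod>j=1..r. f j)"
  have h: "h \<in> poly_ring V" "h \<noteq> 0" using f_nz by (auto simp: h_def intro!: poly_ring_prod f_ring)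
  have Bmod: "Bmod V r f = spoly_over (localization V h) r" by (simp add: Bmod_def h_def)
  have one: "1 \<in> localization V h" using localization_poly[OF h] poly_fracts_closed(2) by blast
  have pow: "x ^ n \<in> localization V h" if "x \<in> localization V h" for x n
    by (induction n) (simp_all add: one that localization_mult[OF h])
  have loc: "Fract (f j) 1 powi c j \<in> localization V h" if j: "j \<in> {1..r}" for j
  proof (cases "c j \<ge> 0")
    case True
    have "Fract (f j) 1 \<in> localization V h"
      using localization_poly[OF h] f_ring[OF j] by (auto simp: poly_fracts_def)
    then show ?thesis using True pow by (simp add: power_int_def)
  next
    case False
    have "inverse (Fract (f j) 1) \<in> localization V h"
      using Fract_over_prod[of r f V j 1] j f_ring f_nz by (simp add: poly_ring_1 h_def)
    then show ?thesis using False pow by (simp add: power_int_def)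
  qed
  have "(\<Prod>j\<in>J. Fract (f j) 1 powi c j) \<in> localization V h" if "J \<subseteq> {1..r}" for J
    using finite_subset[OF that finite_atLeastAtMost] that
    by (induction J rule: finite_induct) (auto simp: one intro!: localization_mult[OF h] loc)
  then show ?thesis
    unfolding f_shift_def scoeff_def Bmod
    by (intro cst_spoly_over localization_0[OF h]) simp
qed

lemma reached_supported:
  assumes "u \<in> reached k" "lookup u m \<noteq> 0"
  shows "keys m \<subseteq> {1..r}"
proof -
  define h where "h = (\<Prod>j=1..r. f j)"
  have h: "h \<in> poly_ring V" "h \<noteq> 0" using f_nz by (auto simp: h_def intro!: poly_ring_prod f_ring)
  have Bmod: "Bmod V r f = spoly_over (localization V h) r" by (simp add: Bmod_def h_def)
  note L = localization_0[OF h] localization_add[OF h] localization_mult[OF h]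
  obtain C P where C: "finite C" "\<forall>c\<in>C. P c \<in> weyl_ops V r f"
      "u = (\<Sum>c\<in>C. P c (c_under_s r c * f_shift r f c))"
    using assms unfolding reached_def by blast
  have one: "1 \<in> localization V h" using localization_poly[OF h] poly_fracts_closed(2) by blast
  have "c_under_s r c \<in> Bmod V r f" for c
  proof -
    have "svar j - of_nat i \<in> Bmod V r f" if "j \<in> {1..r}" for j i
    proof -
      have "- of_nat i = to_fract (- cst (of_nat i) :: 'v mpol)" by (simp add: to_fract_of_nat)
      then have "- of_nat i \<in> poly_fracts V"
        unfolding poly_fracts_conv by (metis imageI poly_ring_uminus cst_in_poly_ring)
      then have "cst (- of_nat i) \<in> Bmod V r f"
        unfolding Bmod using localization_poly[OF h] by (intro cst_spoly_over L) blast
      from spoly_over_add[OF L(2) svar_spoly_over[OF that L(1) one] this[unfolded Bmod]]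
      show ?thesis by (simp add: Bmod single_uminus)
    qed
    then show ?thesis
      unfolding c_under_s_def Bmod by (intro spoly_over_prod L one) auto
  qed
  then have "c_under_s r c * f_shift r f c \<in> Bmod V r f" for c
    using f_shift_Bmod[of c] unfolding Bmod by (intro spoly_over_mult L)
  then have "P c (c_under_s r c * f_shift r f c) \<in> Bmod V r f" if "c \<in> C" for c
    using weyl_ops_Bmod[of r f V "P c"] that C(2) f_ring f_nz by blast
  moreover have "0 \<in> Bmod V r f" by (simp add: Bmod spoly_over_def L)
  ultimately have "u \<in> Bmod V r f"
    unfolding C(3) by (intro sum_closed) (auto simp only: Bmod intro!: spoly_over_add L)
  then show ?thesis using assms(2) by (simp add: Bmod spoly_over_def in_keys_iff)
qed

lemma eval_at_s_supported:
  "eval_at_s r b \<in> spoly_over (UNIV :: 'v mpol fract set) r"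
proof -
  have "(\<Sum>j=1..r. svar j) \<in> spoly_over (UNIV :: 'v mpol fract set) r"
  proof (intro sum_closed)
    show "0 \<in> spoly_over (UNIV :: 'v mpol fract set) r" by (simp add: spoly_over_def)
  qed (auto intro: spoly_over_add svar_spoly_over)
  moreover have "poly (map_poly (\<lambda>z. emb (cst z)) b) x \<in> spoly_over (UNIV :: 'v mpol fract set) r"
    if "x \<in> spoly_over UNIV r" for x
  proof (induction b)
    case 0
    then show ?case by (simp add: spoly_over_def)
  next
    case (pCons a b)
    have "emb (cst a) + x * poly (map_poly (\<lambda>z. emb (cst z)) b) x \<in> spoly_over (UNIV :: 'v mpol fract set) r"
      unfolding emb_conv using pCons that
      by (intro spoly_over_add spoly_over_mult cst_spoly_over) (simp_all add: emb_conv)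
    then show ?case using pCons by (simp add: map_poly_pCons)
  qed
  ultimately show ?thesis unfolding eval_at_s_def by blast
qed

lemma bfun_equation_iff_reached: "bfun_equation V r f b \<longleftrightarrow> eval_at_s r b \<in> reached 1"
  unfolding bfun_equation_def reached_def mem_Collect_eq by (simp only: eq_commute[of "eval_at_s r b"])

text \<open>
  One direction reads operators on the module as operators on series; the other one uses the normal
  form of the V-filtration, and the fact that an element of the module is determined by its values.
\<close>

lemma bfun_equation_iff_vfil:
  "bfun_equation V r f b \<longleftrightarrow> vfil V r f 1 (\<lambda>d. cst (poly b (of_int d)) * dpow (phase r f) d)"
    (is "_ \<longleftrightarrow> vfil V r f 1 ?U")
proof
  assume "bfun_equation V r f b"
  then have "eval_at_s r b \<in> reached 1" by (simp only: bfun_equation_iff_reached)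
  then obtain U where "vfil V r f 1 U" "rel (eval_at_s r b) U" using reached_vfil by blast
  then show "vfil V r f 1 ?U" using rel_unique[OF rel_eval_at_s] by metis
next
  assume "vfil V r f 1 ?U"
  then obtain u where u: "u \<in> reached 1" "rel u ?U"
    using vfil_normal_reached vfil_imp_normal by blast
  have "u - eval_at_s r b = 0"
  proof (rule spoly_eq_0I[of "{1..r}"])
    fix m :: "nat \<Rightarrow>\<^sub>0 nat" assume m: "keys m \<subseteq> {1..r}"
    then have ok: "degree_ok r m (int (\<Sum>j=1..r. lookup m j))" by (simp add: degree_ok_def)
    then have "sval m u * wt m = sval m (eval_at_s r b) * wt m"
      using u(2) rel_eval_at_s[of b] unfolding represents_def by metis
    then show "sval m (u - eval_at_s r b) = 0" using wt_nz[of m] by simp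
  next
    fix m assume "lookup (u - eval_at_s r b) m \<noteq> 0"
    then have "lookup u m \<noteq> 0 \<or> lookup (eval_at_s r b :: 'v spoly) m \<noteq> 0"
      by (auto simp: lookup_minus)
    then show "keys m \<subseteq> {1..r}"
      using reached_supported[OF u(1)] eval_at_s_supported[of b] by (auto simp: spoly_over_def in_keys_iff)
  qed simp
  then have "eval_at_s r b \<in> reached 1" using u(1) by simp
  then show "bfun_equation V r f b" by (simp only: bfun_equation_iff_reached)
qed

end

section \<open>The Pfaffians as coefficients of a larger Pfaffian\<close>

type_synonym big_mpol = "((nat \<times> nat) + nat) mpol"

text \<open>
  The generic skew-symmetric matrix with rows \<open>0, 1, \<dots>, 2 n + 1\<close>, whose row \<open>0\<close> consists of the
  auxiliary variables.
\<close>

definition big_var :: "nat \<Rightarrow> nat \<Rightarrow> (nat \<times> nat) + nat" where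
  "big_var i j = (if i = 0 then Inr j else Inl (i, j))"

definition big_entry :: "nat \<Rightarrow> nat \<Rightarrow> big_mpol" where
  "big_entry i j = (if i < j then mvar (big_var i j) else if j < i then - mvar (big_var j i) else 0)"

definition big_deriv :: "nat \<Rightarrow> nat \<Rightarrow> big_mpol \<Rightarrow> big_mpol" where
  "big_deriv i j q = (if i < j then mpderiv (big_var i j) q else if j < i then - mpderiv (big_var j i) q else 0)"

lemma big_var_eq_iff: "i < j \<Longrightarrow> k < l \<Longrightarrow> big_var i j = big_var k l \<longleftrightarrow> i = k \<and> j = l"
  by (auto simp: big_var_def)

interpretation big: skew_derivations big_entry big_deriv
proof
  show "big_entry i j = - big_entry j i" for i j by (simp add: big_entry_def)
  show "big_entry i i = 0" for i by (simp add: big_entry_def)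
  show "x + x = 0 \<Longrightarrow> x = 0" for x :: "big_mpol" by (rule mpol_two_torsion_free)
  show "big_deriv a b (p + q) = big_deriv a b p + big_deriv a b q" for a b p q by (simp add: big_deriv_def mpderiv_add)
  show "big_deriv a b (p * q) = big_deriv a b p * q + p * big_deriv a b q" for a b p q by (simp add: big_deriv_def mpderiv_mult)
  show "big_deriv a b (big_entry c d) = (if c = a \<and> d = b then 1 else if c = b \<and> d = a then - 1 else 0)"
    if "a \<noteq> b" for a b c d
    using that unfolding big_deriv_def big_entry_def
    by (cases "a < b"; cases "c < d"; cases "d < c") (auto simp: mpderiv_uminus mpderiv_mvar big_var_eq_iff)
qed

definition word :: "nat \<Rightarrow> nat list" where
  "word n = [1..<Suc (2 * n + 1)]"

definition bigpf :: "nat \<Rightarrow> big_mpol" where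
  "bigpf n = pf big_entry (0 # word n)"

definition bpoly :: "nat \<Rightarrow> complex poly" where
  "bpoly n = (\<Prod>i<n. [:of_nat (2 * i + 3), 1:])"

lemma pfop_add: "pfop big_deriv w (p + q) = pfop big_deriv w p + pfop big_deriv w q"
proof (induction "length w" arbitrary: w rule: less_induct)
  case less
  show ?case
  proof (cases w)
    case (Cons a v)
    have "altsum (\<lambda>y r. big_deriv a y (pfop big_deriv r (p + q))) v
        = altsum (\<lambda>y r. big_deriv a y (pfop big_deriv r p) + big_deriv a y (pfop big_deriv r q)) v"
      using less Cons by (intro altsum_cong refl) (simp add: big.D_add)
    then show ?thesis by (simp add: Cons altsum_add)
  qed simp
qed

lemma pfop_0: "pfop big_deriv w 0 = 0"
  using pfop_add[of w 0 0] by simp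

lemma pfop_cst: "pfop big_deriv w (cst c * q) = cst c * pfop big_deriv w q"
proof (induction "length w" arbitrary: w rule: less_induct)
  case less
  show ?case
  proof (cases w)
    case (Cons a v)
    have "altsum (\<lambda>y r. big_deriv a y (pfop big_deriv r (cst c * q))) v = altsum (\<lambda>y r. cst c * big_deriv a y (pfop big_deriv r q)) v"
      using less Cons by (intro altsum_cong refl) (simp add: big_deriv_def mpderiv_cst_mult)
    then show ?thesis by (simp add: Cons altsum_mult)
  qed simp
qed

lemma pfop_1: "w \<noteq> [] \<Longrightarrow> pfop big_deriv w 1 = 0"
proof (induction "length w" arbitrary: w rule: less_induct)
  case less
  then obtain a v where w: "w = a # v" by (cases w) auto
  have "altsum (\<lambda>y r. big_deriv a y (pfop big_deriv r 1)) v = altsum (\<lambda>y r. 0) v"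
  proof (rule altsum_cong[OF refl])
    fix y and r :: "nat list" assume "length r < length v"
    then show "big_deriv a y (pfop big_deriv r 1) = 0"
      using less.hyps[of r] w by (cases "r = []") simp_all
  qed
  then show ?case by (simp add: w)
qed

lemma poly_bpoly: "poly (bpoly n) x = (\<Prod>i<n. x + of_nat (2 * i + 3))"
  by (simp add: bpoly_def poly_prod add.commute)

text \<open>
  The first factor \<open>e + 1\<close> in Cayley's identity is absorbed by the divided power.
\<close>

lemma pfop_dpow:
  "pfop big_deriv (0 # word n) (dpow (bigpf n) (e + 1)) = cst (poly (bpoly n) (of_int e)) * dpow (bigpf n) e"
proof (cases "e < 0")
  case True
  then show ?thesis
    by (cases "e = -1") (simp_all add: dpow_neg pfop_0 pfop_1 del: pfop.simps)
next
  case False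
  define s where "s = nat e"
  have e: "e = int s" "e + 1 = int (Suc s)" using False by (simp_all add: s_def)
  have "length (0 # word n) = 2 * Suc n" "distinct (0 # word n)"
    by (simp_all add: word_def del: upt_Suc)
  then have "pfop big_deriv (0 # word n) (bigpf n ^ Suc s) = of_nat (\<Prod>j<Suc n. Suc s + 2 * j) * bigpf n ^ s"
    unfolding bigpf_def by (rule big.cayley)
  then have "pfop big_deriv (0 # word n) (dpow (bigpf n) (e + 1))
      = cst (1 / fact (Suc s)) * (cst (of_nat (\<Prod>j<Suc n. Suc s + 2 * j)) * bigpf n ^ s)"
    unfolding e(2) dpow_of_nat pfop_cst by (simp only: single_of_nat)
  also have "\<dots> = cst (1 / fact (Suc s) * of_nat (\<Prod>j<Suc n. Suc s + 2 * j)) * bigpf n ^ s"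
    by (simp only: cst_mult mult.assoc)
  also have "1 / fact (Suc s) * of_nat (\<Prod>j<Suc n. Suc s + 2 * j)
      = poly (bpoly n) (of_int e) * (1 / fact s :: complex)"
  proof -
    have p1: "(\<Prod>j<Suc n. Suc s + 2 * j) = Suc s * (\<Prod>j<n. Suc s + 2 * Suc j)"
      by (simp only: prod.lessThan_Suc_shift) simp
    have p2: "of_nat (\<Prod>j<n. Suc s + 2 * Suc j) = poly (bpoly n) (of_int e)"
      unfolding poly_bpoly of_nat_prod e by (intro prod.cong refl) (simp add: algebra_simps)
    show ?thesis unfolding p1 of_nat_mult p2 by (simp del: of_nat_Suc)
  qed
  finally show ?thesis
    by (simp only: cst_mult mult.assoc e(1) dpow_of_nat)
qed

lemma fischer_big_entry: "fischer (big_entry i j * p) q = fischer p (big_deriv i j q)"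
  by (simp add: big_entry_def big_deriv_def fischer_mvar_left fischer_uminus_left fischer_uminus_right)

lemma fischer_pf: "fischer (pf big_entry w * p) q = fischer p (pfop big_deriv w q)"
proof (induction "length w" arbitrary: w p q rule: less_induct)
  case less
  show ?case
  proof (cases w)
    case (Cons a v)
    have "fischer (pf big_entry w * p) q = fischer (altsum (\<lambda>y r. big_entry a y * pf big_entry r * p) v) q"
      by (simp add: Cons altsum_mult_right)
    also have "\<dots> = altsum (\<lambda>y r. fischer (big_entry a y * pf big_entry r * p) q) v"
      by (rule altsum_additive) (rule fischer_add_left)
    also have "\<dots> = altsum (\<lambda>y r. fischer p (big_deriv a y (pfop big_deriv r q))) v"
    proof (rule altsum_cong[OF refl])
      fix y and r :: "nat list" assume r: "length r < length v"
      have "fischer (big_entry a y * pf big_entry r * p) q = fischer (pf big_entry r * (big_entry a y * p)) q"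
        by (simp only: mult_ac)
      also have "\<dots> = fischer (big_entry a y * p) (pfop big_deriv r q)"
        using r Cons by (intro less) simp
      finally show "fischer (big_entry a y * pf big_entry r * p) q = fischer p (big_deriv a y (pfop big_deriv r q))"
        by (simp only: fischer_big_entry)
    qed
    also have "\<dots> = fischer p (altsum (\<lambda>y r. big_deriv a y (pfop big_deriv r q)) v)"
      by (rule altsum_additive[symmetric]) (rule fischer_add_right)
    finally show ?thesis by (simp add: Cons)
  qed simp
qed

lemma bpoly_nz: "e \<ge> 0 \<Longrightarrow> poly (bpoly n) (of_int e) \<noteq> 0"
proof -
  assume "e \<ge> 0"
  then have "e + int (2 * i + 3) \<noteq> 0" for i by simp
  then have "of_int (e + int (2 * i + 3)) \<noteq> (0 :: complex)" for i by (simp only: of_int_eq_0_iff not_False_eq_True)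
  then show ?thesis by (simp add: poly_bpoly)
qed

lemma cayley_phase_bigpf: "cayley_phase (bigpf n) (bpoly n)"
proof
  show "fischer (z * bigpf n) (dpow (bigpf n) (e + 1)) = poly (bpoly n) (of_int e) * fischer z (dpow (bigpf n) e)" for z e
  proof -
    have "fischer (z * bigpf n) (dpow (bigpf n) (e + 1)) = fischer z (pfop big_deriv (0 # word n) (dpow (bigpf n) (e + 1)))"
      using fischer_pf[of "0 # word n" z "dpow (bigpf n) (e + 1)"] by (simp only: bigpf_def mult.commute)
    then show ?thesis by (simp only: pfop_dpow fischer_cst_right)
  qed
qed (rule bpoly_nz)

subsection \<open>The generators\<close>

lemma altsum_map: "altsum F (map h w) = altsum (\<lambda>y r. F (h y) (map h r)) w"
  by (induction w arbitrary: F) simp_all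

lemma pf_map: "pf A (map h w) = pf (\<lambda>i j. A (h i) (h j)) w"
proof (induction "length w" arbitrary: w rule: less_induct)
  case less
  show ?case
  proof (cases w)
    case (Cons a v)
    have "altsum (\<lambda>y r. A (h a) (h y) * pf A (map h r)) v = altsum (\<lambda>y r. A (h a) (h y) * pf (\<lambda>i j. A (h i) (h j)) r) v"
      using less Cons by (intro altsum_cong refl) simp
    then show ?thesis by (simp add: Cons altsum_map)
  qed simp
qed

lemma xe_pf:
  assumes "\<And>i j. i \<in> set w \<Longrightarrow> j \<in> set w \<Longrightarrow> xe (A i j) = B i j"
  shows "xe (pf A w) = pf B w"
  using assms
proof (induction "length w" arbitrary: w rule: less_induct)
  case less
  show ?case
  proof (cases w)
    case (Cons a v)
    have "xe (pf A w) = altsum (\<lambda>y r. xe (A a y * pf A r)) v"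
      unfolding Cons pf.simps by (rule altsum_additive) simp
    also have "\<dots> = altsum (\<lambda>y r. B a y * pf B r) v"
    proof (rule altsum_cong[OF refl])
      fix y r assume r: "y \<in> set v" "set r \<subseteq> set v" "length r < length v"
      then have "xe (pf A r) = pf B r" using Cons less.prems by (intro less.hyps) auto
      then show "xe (A a y * pf A r) = B a y * pf B r" using r Cons less.prems by simp
    qed
    finally show ?thesis by (simp add: Cons)
  qed simp
qed

lemma pf_poly_ring:
  assumes "\<And>i j. i \<in> set w \<Longrightarrow> j \<in> set w \<Longrightarrow> A i j \<in> poly_ring V"
  shows "pf A w \<in> poly_ring V"
  using assms
proof (induction "length w" arbitrary: w rule: less_induct)
  case less
  have closed: "altsum F v \<in> poly_ring V"
    if "\<And>y r. y \<in> set v \<Longrightarrow> set r \<subseteq> set v \<Longrightarrow> length r < length v \<Longrightarrow> F y r \<in> poly_ring V" for F and v :: "'a list"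
    using that
  proof (induction v arbitrary: F)
    case (Cons c v)
    have "altsum (\<lambda>y r. F y (c # r)) v \<in> poly_ring V"
      by (rule Cons.IH, rule Cons.prems) auto
    moreover have "F c v \<in> poly_ring V" by (rule Cons.prems) auto
    ultimately have "F c v + - altsum (\<lambda>y r. F y (c # r)) v \<in> poly_ring V"
      by (intro poly_ring_add poly_ring_uminus)
    then show ?case by simp
  qed (simp add: poly_ring_0)
  show ?case
  proof (cases w)
    case (Cons a v)
    have "altsum (\<lambda>y r. A a y * pf A r) v \<in> poly_ring V"
    proof (rule closed)
      fix y and r :: "'a list" assume r: "y \<in> set v" "set r \<subseteq> set v" "length r < length v"
      have "pf A r \<in> poly_ring V" using r Cons less.prems by (intro less.hyps) auto
      then show "A a y * pf A r \<in> poly_ring V" using r Cons less.prems by (intro poly_ring_mult) auto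
    qed
    then show ?thesis by (simp add: Cons)
  qed (simp add: poly_ring_1)
qed

definition word_without :: "nat \<Rightarrow> nat \<Rightarrow> nat list" where
  "word_without n i = take i (word n) @ drop (Suc i) (word n)"

lemma skip_word:
  assumes "i < 2 * n + 1"
  shows "map (skip (Suc i)) [1..<Suc (2 * n)] = word_without n i"
  using assms
  by (intro nth_equalityI) (auto simp: word_without_def word_def skip_def nth_append min_def simp del: upt_Suc)

lemma sub_pfaffian_eq_pf:
  assumes "i < 2 * n + 1"
  shows "sub_pfaffian n (Suc i) = pf generic_skew (word_without n i)"
proof -
  have "sub_pfaffian n (Suc i) = pf (\<lambda>a b. generic_skew (skip (Suc i) a) (skip (Suc i) b)) [1..<Suc (2 * n)]"
    unfolding sub_pfaffian_def by (rule pfaffian_eq_pf) (simp add: generic_skew_def)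
  then show ?thesis by (simp only: pf_map[symmetric] skip_word[OF assms])
qed

lemma set_word: "set (word n) = {1..2 * n + 1}"
  by (auto simp: word_def)

lemma set_word_without: "set (word_without n i) \<subseteq> {1..2 * n + 1}"
  using set_take_subset[of i "word n"] set_drop_subset[of "Suc i" "word n"]
  by (auto simp: word_without_def set_word)

lemma xe_sub_pfaffian:
  assumes "i < 2 * n + 1"
  shows "xe (sub_pfaffian n (Suc i)) = pf big_entry (word_without n i)"
  unfolding sub_pfaffian_eq_pf[OF assms]
proof (rule xe_pf)
  fix a b assume "a \<in> set (word_without n i)" "b \<in> set (word_without n i)"
  then have "a \<noteq> 0" "b \<noteq> 0" using set_word_without[of n i] by auto
  then show "xe (generic_skew a b) = big_entry a b"
    by (simp add: generic_skew_def big_entry_def big_var_def)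
qed

lemma sub_pfaffian_poly_ring:
  assumes "k \<in> {1..2 * n + 1}"
  shows "sub_pfaffian n k \<in> poly_ring (skew_vars n)"
proof -
  obtain i where k: "k = Suc i" "i < 2 * n + 1" using assms by (cases k) auto
  have var: "mvar v \<in> poly_ring (skew_vars n)" if "v \<in> skew_vars n" for v :: "nat \<times> nat"
    using that by (simp add: mvar_def poly_ring_def)
  show ?thesis
    unfolding k(1) sub_pfaffian_eq_pf[OF k(2)]
  proof (rule pf_poly_ring)
    fix a b assume "a \<in> set (word_without n i)" "b \<in> set (word_without n i)"
    then have "a \<in> {1..2 * n + 1}" "b \<in> {1..2 * n + 1}" using set_word_without[of n i] by auto
    then have "a < b \<Longrightarrow> (a, b) \<in> skew_vars n" "b < a \<Longrightarrow> (b, a) \<in> skew_vars n"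
      by (auto simp: skew_vars_def)
    then show "generic_skew a b \<in> poly_ring (skew_vars n)"
      by (auto simp: generic_skew_def poly_ring_0 intro!: var poly_ring_uminus)
  qed
qed

lemma sub_pfaffian_nz:
  assumes "k \<in> {1..2 * n + 1}"
  shows "sub_pfaffian n k \<noteq> 0"
proof
  obtain i where k: "k = Suc i" "i < 2 * n + 1" using assms by (cases k) auto
  assume "sub_pfaffian n k = 0"
  then have "pf big_entry (word_without n i) = 0" using xe_sub_pfaffian[OF k(2)] k(1) by simp
  have inj: "inj_on (skip (Suc i)) X" for X by (rule inj_onI) (auto simp: skip_def split: if_splits)
  have "length (word_without n i) = 2 * n" "distinct (word_without n i)"
    unfolding skip_word[OF k(2), symmetric]
    by (simp_all add: distinct_map inj del: upt_Suc)
  from big.cayley[OF this, of 0] have "pfop big_deriv (word_without n i) (pf big_entry (word_without n i)) = of_nat (\<Prod>j<n. Suc 0 + 2 * j)"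
    by (simp only: power_0 power_Suc mult_1_right)
  with \<open>pf big_entry (word_without n i) = 0\<close> have "of_nat (\<Prod>j<n. Suc 0 + 2 * j) = (0 :: big_mpol)"
    by (simp only: pfop_0)
  then show False by (simp only: of_nat_eq_0_iff) simp
qed

text \<open>
  The signs of the expansion of the big Pfaffian along row \<open>0\<close>; they do not change the ideal.
\<close>

definition signed_pfaffian :: "nat \<Rightarrow> nat \<Rightarrow> (nat \<times> nat) mpol" where
  "signed_pfaffian n k = (-1) ^ (k - 1) * sub_pfaffian n k"

lemma phase_signed_pfaffian: "phase (2 * n + 1) (signed_pfaffian n) = bigpf n"
proof -
  have "bigpf n = (\<Sum>i<length (word n). (-1) ^ i * (big_entry 0 (word n ! i) * pf big_entry (word_without n i)))"
    by (simp only: bigpf_def pf.simps altsum_conv_sum word_without_def)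
  also have "\<dots> = (\<Sum>i<2 * n + 1. tv (Suc i) * xe (signed_pfaffian n (Suc i)))"
  proof (intro sum.cong)
    fix i assume i: "i \<in> {..<2 * n + 1}"
    have "xe ((-1) ^ i :: (nat \<times> nat) mpol) = (-1) ^ i" by (induction i) simp_all
    moreover have "word n ! i = Suc i" using i by (simp add: word_def del: upt_Suc)
    ultimately show "(-1) ^ i * (big_entry 0 (word n ! i) * pf big_entry (word_without n i)) = tv (Suc i) * xe (signed_pfaffian n (Suc i))"
      using i by (simp add: signed_pfaffian_def xe_sub_pfaffian big_entry_def big_var_def mult_ac)
  qed (simp add: word_def)
  also have "\<dots> = phase (2 * n + 1) (signed_pfaffian n)"
    unfolding phase_def One_nat_def sum.atLeast1_atMost_eq ..
  finally show ?thesis ..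
qed

lemma ideal_generated_tuple:
  fixes r :: nat
  shows "ideal_generated V (f ` {1..r}) = {\<Sum>k=1..r. b k * f k | b. \<forall>k. b k \<in> poly_ring V}"
proof (intro equalityI subsetI)
  fix p assume "p \<in> ideal_generated V (f ` {1..r})"
  then show "p \<in> {\<Sum>k=1..r. b k * f k | b. \<forall>k. b k \<in> poly_ring V}"
    by (rule ideal_generated_coeffs) blast
next
  fix p assume "p \<in> {\<Sum>k=1..r. b k * f k | b. \<forall>k. b k \<in> poly_ring V}"
  then obtain b where b: "\<And>k. b k \<in> poly_ring V" "p = (\<Sum>k=1..r. b k * f k)" by blast
  define a where "a = (\<lambda>h. \<Sum>k | k \<in> {1..r} \<and> f k = h. b k)"
  have "p = (\<Sum>h\<in>f ` {1..r}. \<Sum>k | k \<in> {1..r} \<and> f k = h. b k * f k)"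
    unfolding b(2) by (rule sum.group[symmetric]) auto
  also have "\<dots> = (\<Sum>h\<in>f ` {1..r}. a h * h)"
    unfolding a_def sum_distrib_right by (intro sum.cong refl) simp
  finally have "p = (\<Sum>h\<in>f ` {1..r}. a h * h)" .
  moreover have "a h \<in> poly_ring V" for h
    unfolding a_def by (intro poly_ring_sum b)
  ultimately show "p \<in> ideal_generated V (f ` {1..r})"
    unfolding ideal_generated_def mem_Collect_eq
    by (intro exI[of _ "f ` {1..r}"] exI[of _ a]) simp
qed

lemma ideal_signed_pfaffian:
  "ideal_generated V (signed_pfaffian n ` {1..2 * n + 1}) = ideal_generated V (sub_pfaffian n ` {1..2 * n + 1})"
proof -
  let ?s = "\<lambda>k. (-1) ^ (k - 1) :: (nat \<times> nat) mpol"
  have s: "?s k \<in> poly_ring V" for k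
    by (intro poly_ring_power poly_ring_uminus poly_ring_1)
  have ss: "?s k * (?s k * x) = x" for k x by (cases "even (k - 1)") simp_all
  show ?thesis
    unfolding ideal_generated_tuple
  proof (intro equalityI subsetI)
    fix p assume "p \<in> {\<Sum>k=1..2 * n + 1. b k * signed_pfaffian n k | b. \<forall>k. b k \<in> poly_ring V}"
    then obtain b where b: "\<And>k. b k \<in> poly_ring V" "p = (\<Sum>k=1..2 * n + 1. b k * signed_pfaffian n k)" by blast
    have bs: "b k * ?s k \<in> poly_ring V" for k by (intro poly_ring_mult b s)
    have "p = (\<Sum>k=1..2 * n + 1. (b k * ?s k) * sub_pfaffian n k)"
      unfolding b(2) signed_pfaffian_def by (simp only: mult.assoc)
    then show "p \<in> {\<Sum>k=1..2 * n + 1. b k * sub_pfaffian n k | b. \<forall>k. b k \<in> poly_ring V}"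
      using bs by (intro CollectI exI[of _ "\<lambda>k. b k * ?s k"] conjI allI)
  next
    fix p assume "p \<in> {\<Sum>k=1..2 * n + 1. b k * sub_pfaffian n k | b. \<forall>k. b k \<in> poly_ring V}"
    then obtain b where b: "\<And>k. b k \<in> poly_ring V" "p = (\<Sum>k=1..2 * n + 1. b k * sub_pfaffian n k)" by blast
    have bs: "b k * ?s k \<in> poly_ring V" for k by (intro poly_ring_mult b s)
    have "p = (\<Sum>k=1..2 * n + 1. (b k * ?s k) * signed_pfaffian n k)"
      unfolding b(2) signed_pfaffian_def by (simp only: mult.assoc ss)
    then show "p \<in> {\<Sum>k=1..2 * n + 1. b k * signed_pfaffian n k | b. \<forall>k. b k \<in> poly_ring V}"
      using bs by (intro CollectI exI[of _ "\<lambda>k. b k * ?s k"] conjI allI)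
  qed
qed

section \<open>The b-function\<close>

lemma vfil_altsum:
  assumes "\<And>y r. y \<in> set w \<Longrightarrow> set r \<subseteq> set w \<Longrightarrow> length r < length w \<Longrightarrow> vfil V R f k (F y r)"
  shows "vfil V R f k (\<lambda>d. altsum (\<lambda>y r. F y r d) w)"
  using assms
proof (induction w arbitrary: F)
  case (Cons c v)
  have "vfil V R f k (\<lambda>d. altsum (\<lambda>y r. F y (c # r) d) v)"
    by (rule Cons.IH, rule Cons.prems) auto
  moreover have "vfil V R f k (F c v)" by (rule Cons.prems) auto
  ultimately show ?case by (simp add: vfil_diff)
qed (simp add: vfil.zero)

lemma vfil_big_deriv:
  assumes "i \<in> {1..2 * n + 1}" "j \<in> {1..2 * n + 1}" "vfil (skew_vars n) R f k U"
  shows "vfil (skew_vars n) R f k (\<lambda>d. big_deriv i j (U d))"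
proof (cases i j rule: linorder_cases)
  case less
  then have "(i, j) \<in> skew_vars n" using assms by (simp add: skew_vars_def)
  then show ?thesis using less assms vfil.deriv by (simp add: big_deriv_def big_var_def)
next
  case equal
  then show ?thesis by (simp add: big_deriv_def vfil.zero)
next
  case greater
  then have "(j, i) \<in> skew_vars n" using assms by (simp add: skew_vars_def)
  then show ?thesis using greater assms by (simp add: big_deriv_def big_var_def vfil_uminus vfil.deriv)
qed

lemma vfil_pfop:
  assumes "set w \<subseteq> {1..2 * n + 1}" "vfil (skew_vars n) R f k U"
  shows "vfil (skew_vars n) R f k (\<lambda>d. pfop big_deriv w (U d))"
  using assms(1)
proof (induction "length w" arbitrary: w rule: less_induct)
  case less
  show ?case
  proof (cases w)
    case Nil
    then show ?thesis using assms(2) by simp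
  next
    case (Cons a v)
    have "vfil (skew_vars n) R f k (\<lambda>d. altsum (\<lambda>y r. big_deriv a y (pfop big_deriv r (U d))) v)"
      using less Cons by (intro vfil_altsum vfil_big_deriv) auto
    then show ?thesis by (simp add: Cons)
  qed
qed

text \<open>
  Expanding the operator of Cayley's identity along row \<open>0\<close> shows that it has weight \<open>1\<close>.
\<close>

lemma vfil_bpoly:
  "vfil (skew_vars n) (2 * n + 1) (signed_pfaffian n) 1 (\<lambda>d. cst (poly (bpoly n) (of_int d)) * dpow (phase (2 * n + 1) (signed_pfaffian n)) d)"
proof -
  let ?R = "2 * n + 1"
  have "vfil (skew_vars n) ?R (signed_pfaffian n) 1 (\<lambda>d. altsum (\<lambda>y r. big_deriv 0 y (pfop big_deriv r (dpow (bigpf n) (d + 1)))) (word n))"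
  proof (rule vfil_altsum)
    fix y r assume y: "y \<in> set (word n)" and r: "set r \<subseteq> set (word n)"
    have "vfil (skew_vars n) ?R (signed_pfaffian n) 0 (\<lambda>d. pfop big_deriv r (dpow (bigpf n) d))"
      using r vfil.base[of "skew_vars n" ?R "signed_pfaffian n"] unfolding set_word phase_signed_pfaffian by (rule vfil_pfop)
    from vfil.dtau[OF y[unfolded set_word] this]
    show "vfil (skew_vars n) ?R (signed_pfaffian n) 1 (\<lambda>d. big_deriv 0 y (pfop big_deriv r (dpow (bigpf n) (d + 1))))"
      using y by (simp add: big_deriv_def big_var_def set_word)
  qed
  then show ?thesis
    by (simp only: phase_signed_pfaffian pfop_dpow[symmetric] pfop.simps)
qed

text \<open>
  The polynomial \<open>bpoly n\<close> divides \<open>(s + 1) * b\<close>, and \<open>- 1\<close> is not among its roots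
  \<open>-3, -5, \<dots>, -(2 n + 1)\<close>.
\<close>

lemma degree_le_of_vfil:
  assumes "vfil (skew_vars n) (2 * n + 1) (signed_pfaffian n) 1 (\<lambda>d. cst (poly b (of_int d)) * dpow (phase (2 * n + 1) (signed_pfaffian n)) d)"
    and "b \<noteq> 0"
  shows "Polynomial.degree (bpoly n) \<le> Polynomial.degree b"
proof -
  interpret cayley_phase "bigpf n" "bpoly n" by (rule cayley_phase_bigpf)
  have "tame 1 (\<lambda>d. cst (poly b (of_int d)) * dpow (bigpf n) d)"
    using vfil_tame[OF _ assms(1)] cayley_phase_bigpf unfolding phase_signed_pfaffian by blast
  then obtain q where q: "[:1, 1:] * b = bpoly n * q"
    using tame_dpow_dvd by (auto elim: dvdE)
  have "poly (bpoly n) (- 1) \<noteq> 0"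
  proof -
    have "- 1 + of_nat (2 * i + 3) = (of_nat (2 * i + 2) :: complex)" for i by simp
    then have "- 1 + of_nat (2 * i + 3) \<noteq> (0 :: complex)" for i by (simp only: of_nat_eq_0_iff)
    then show ?thesis by (simp add: poly_bpoly)
  qed
  moreover have "poly (bpoly n) (- 1) * poly q (- 1) = 0"
    using arg_cong[OF q, of "\<lambda>p. poly p (- 1)"] by simp
  ultimately have "[:1, 1:] dvd q" using poly_eq_0_iff_dvd[of q "- 1"] by simp
  then obtain q' where "q = [:1, 1:] * q'" by (elim dvdE)
  then have "[:1, 1:] * b = [:1, 1:] * (bpoly n * q')" using q by (simp only: mult.left_commute)
  then have "b = bpoly n * q'" by (subst (asm) mult_left_cancel) simp_all
  then show ?thesis using assms(2) by (simp add: dvd_imp_degree_le)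
qed

lemma lead_coeff_bpoly: "lead_coeff (bpoly n) = 1"
  by (simp add: bpoly_def lead_coeff_prod)

theorem mainTheorem2:
  fixes n :: nat
  assumes "n \<ge> 1"
  shows "is_bfun_ideal (skew_vars n)
           (ideal_generated (skew_vars n) (sub_pfaffian n ` {1..2*n + 1}))
           (\<Prod>i = 0..n - 1. [:of_nat (2*i + 3), 1:])"
proof -
  let ?V = "skew_vars n" and ?N = "2 * n + 1"
  let ?I = "ideal_generated ?V (sub_pfaffian n ` {1..?N})"
  have "{0..n - 1} = {..<n}" using assms by auto
  then have b: "(\<Prod>i = 0..n - 1. [:of_nat (2*i + 3), 1:]) = bpoly n"
    by (simp only: bpoly_def)
  have tuple: "generating_tuple ?V ?I ?N (sub_pfaffian n)"
    unfolding generating_tuple_def using sub_pfaffian_poly_ring sub_pfaffian_nz by blast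
  have bfun: "is_bfun ?V r g (bpoly n)" if g: "generating_tuple ?V ?I r g" for r g
  proof -
    interpret generators ?V r g
      using g unfolding generating_tuple_def by unfold_locales auto
    have same: "ideal_generated ?V (g ` {1..r}) = ideal_generated ?V (signed_pfaffian n ` {1..?N})"
      using g unfolding generating_tuple_def ideal_signed_pfaffian by simp
    have iff: "bfun_equation ?V r g b \<longleftrightarrow>
        vfil ?V ?N (signed_pfaffian n) 1 (\<lambda>d. cst (poly b (of_int d)) * dpow (phase ?N (signed_pfaffian n)) d)" for b
      unfolding bfun_equation_iff_vfil
      using vfil_independent[OF same, of 1 "\<lambda>d. poly b (of_int d)"]
        vfil_independent[OF same[symmetric], of 1 "\<lambda>d. poly b (of_int d)"] by blast
    show ?thesis
      unfolding is_bfun_def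
    proof (intro conjI allI impI)
      show "bfun_equation ?V r g (bpoly n)" unfolding iff by (rule vfil_bpoly)
    next
      fix b assume "lead_coeff b = 1 \<and> bfun_equation ?V r g b"
      then show "Polynomial.degree (bpoly n) \<le> Polynomial.degree b"
        unfolding iff by (intro degree_le_of_vfil) auto
    qed (rule lead_coeff_bpoly)
  qed
  show ?thesis
    unfolding is_bfun_ideal_def b using tuple bfun by blast
qed

end
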